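(* Denote $X=(x,y,z,u)^{\top}$ and consider the system $$\dot x=(u+y^2+z^2)x,\quad \dot y=(u+y^2-2z^2)y,\quad \dot z=(u-2y^2+z^2)z,\quad \dot u=u^2-y^4+y^2z^2-z^4. \qquad(\mathrm{S})$$ (1) The system (S) is Hamiltonian: $$\dot X=\omega\,\nabla\mathcal{H},\qquad \mathcal{H}=\frac12\,\frac{y^2-z^2}{x^2},$$ where the degenerate rational (single-valued) Poisson bracket is $$\omega=\frac{x}{2\mathcal{H}}\begin{pmatrix}0&V_y&V_z&V_u\\-V_y&0&0&0\\-V_z&0&0&0\\-V_u&0&0&0\end{pmatrix},$$ $$V_y=(u+y^2-2z^2)y,\qquad V_z=(u-2y^2+z^2)z,\qquad V_u=u^2-y^4+y^2z^2-z^4 .$$ (2) A non-degenerate but transcendental multi-valued extension of $\omega$ is given by the Poisson bracket $$\Omega=\omega+\lambda\,\tilde\omega\qquad(\det\Omega\neq0)$$ with $\lambda\ne0$ an arbitrary constant, where $$\tilde\omega=\frac2\pi K^2\begin{pmatrix}0&\frac xy z^2&xz&xM_1\\[2pt]-\frac xy z^2&0&\frac zy(y^2-z^2)&\frac1yM_2\\[2pt]-xz&\frac zy(z^2-y^2)&0&zM_3\\[2pt]-xM_1&-\frac1yM_2&-zM_3&0\end{pmatrix}$$ and $$M_1=3y^2(EK^{-1}-1)^2-z^2,\qquad M_3=y^2(3E^2K^{-2}-1)+z^2,$$ $$M_2=3y^4(EK^{-1}-1)^2+y^2z^2(6EK^{-1}-5)+2z^4,$$ with $K=K(z/y)$, $E=E(z/y)$.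 (3) The matrix $\tilde\omega$ is a Poisson bracket as well, with $\det\tilde\omega=0$. The brackets $\omega,\tilde\omega$ are compatible with each other and have the following Casimir functions: $$\omega\,\nabla\boldsymbol{J}_1=\omega\,\nabla\boldsymbol{J}_2\equiv0,\qquad \tilde\omega\,\nabla\mathcal{H}=\tilde\omega\,\nabla\mathcal{N}\equiv0 .$$ The system may thus be treated as bi-Hamiltonian in the sense of Magri.
   Context: The dot denotes $d/d\tau$; $\nabla$ is the column of partial derivatives with respect to $(x,y,z,u)$. An antisymmetric matrix $\omega^{jk}(X)$ is called a Poisson bracket if $\{f,g\}=\omega^{jk}\,\nabla_jf\,\nabla_kg$ satisfies the Jacobi identity; two Poisson brackets are compatible if every linear combination of them with constant coefficients is a Poisson bracket. The Legendre complete elliptic integrals are $$K(k)=\int_0^1\frac{d\lambda}{\sqrt{(1-\lambda^2)(1-k^2\lambda^2)}},\quad K'(k)=\int_k^1\frac{d\lambda}{\sqrt{(1-\lambda^2)(\lambda^2-k^2)}},$$ $$E(k)=\int_0^1\sqrt{\frac{1-k^2\lambda^2}{1-\lambda^2}}\,d\lambda,\quad E'(k)=\int_0^1\sqrt{\frac{1-(1-k^2)\lambda^2}{1-\lambda^2}}\,d\lambda$$ (the prime is not a derivative), and $$\boldsymbol{J}_1=\tfrac1y(u-2y^2+z^2)K\big(\tfrac zy\big)+3yE\big(\tfrac zy\big),\qquad \boldsymbol{J}_2=\tfrac1y(u+y^2+z^2)K'\big(\tfrac zy\big)-3yE'\big(\tfrac zy\big),$$ $$\mathcal{N}=-\frac{K(z/y)}{y\,\boldsymbol{J}_1}=\frac{-K(z/y)}{(u-2y^2+z^2)K(z/y)+3y^2E(z/y)}.$$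 All statements are on the open set where these (multi-valued) expressions are defined; $\det\Omega\ne0$ means non-vanishing as a function, i.e. at generic points. *)

theory Defs
  imports "HOL-Complex_Analysis.Complex_Analysis"
begin

section \<open>Holomorphic, rational and algebraic functions on \<open>\<complex>\<^sup>n\<close>\<close>

text \<open>The \<^const>\<open>has_derivative\<close> of the library is real-linear; holomorphy asks for a
  complex-linear one.\<close>

definition holomorphic_Cn_on :: "((complex^'n) \<Rightarrow> complex) \<Rightarrow> (complex^'n) set \<Rightarrow> bool" where
  "holomorphic_Cn_on f U \<longleftrightarrow>
     (\<forall>X\<in>U. \<exists>a :: complex^'n. (f has_derivative (\<lambda>h. \<Sum>i\<in>UNIV. a $ i * h $ i)) (at X))"

definition cgrad :: "((complex^'n) \<Rightarrow> complex) \<Rightarrow> complex^'n \<Rightarrow> complex^'n" where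
  "cgrad f X = (\<chi> i. deriv (\<lambda>t. f (X + axis i t)) 0)"

inductive cpoly_fun :: "((complex^'n) \<Rightarrow> complex) \<Rightarrow> bool" where
  const: "cpoly_fun (\<lambda>X. c)"
| coord: "cpoly_fun (\<lambda>X. X $ i)"
| add: "cpoly_fun p \<Longrightarrow> cpoly_fun q \<Longrightarrow> cpoly_fun (\<lambda>X. p X + q X)"
| mult: "cpoly_fun p \<Longrightarrow> cpoly_fun q \<Longrightarrow> cpoly_fun (\<lambda>X. p X * q X)"

definition rational_on :: "((complex^'n) \<Rightarrow> complex) \<Rightarrow> (complex^'n) set \<Rightarrow> bool" where
  "rational_on f U \<longleftrightarrow>
     (\<exists>p q. cpoly_fun p \<and> cpoly_fun q \<and> (\<forall>X\<in>U. q X \<noteq> 0 \<and> f X = p X / q X))"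

text \<open>\<open>f\<close> is algebraic over the field of rational functions of the coordinates. The coefficients
  \<open>c i\<close> are polynomials in the coordinates, and one of them is not the zero polynomial.\<close>

definition algebraic_fun_on :: "((complex^'n) \<Rightarrow> complex) \<Rightarrow> (complex^'n) set \<Rightarrow> bool" where
  "algebraic_fun_on f U \<longleftrightarrow>
     (\<exists>n c. (\<forall>i\<le>n. cpoly_fun (c i)) \<and> (\<exists>i\<le>n. \<exists>X. c i X \<noteq> 0) \<and>
        (\<forall>X\<in>U. (\<Sum>i\<le>n. c i X * f X ^ i) = 0))"


section \<open>Poisson brackets\<close>

definition bracket ::
  "((complex^'n) \<Rightarrow> complex^'n^'n) \<Rightarrow> ((complex^'n) \<Rightarrow> complex) \<Rightarrow> ((complex^'n) \<Rightarrow> complex)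
     \<Rightarrow> (complex^'n) \<Rightarrow> complex" where
  "bracket P f g X = (\<Sum>j\<in>UNIV. \<Sum>k\<in>UNIV. P X $ j $ k * cgrad f X $ j * cgrad g X $ k)"

definition poisson_on :: "(complex^'n) set \<Rightarrow> ((complex^'n) \<Rightarrow> complex^'n^'n) \<Rightarrow> bool" where
  "poisson_on U P \<longleftrightarrow>
     (\<forall>j k. holomorphic_Cn_on (\<lambda>X. P X $ j $ k) U) \<and>
     (\<forall>X\<in>U. transpose (P X) = - P X) \<and>
     (\<forall>f g h. holomorphic_Cn_on f U \<longrightarrow> holomorphic_Cn_on g U \<longrightarrow> holomorphic_Cn_on h U \<longrightarrow>
        (\<forall>X\<in>U. bracket P f (bracket P g h) X + bracket P g (bracket P h f) X
                + bracket P h (bracket P f g) X = 0))"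

definition lin_comb ::
  "complex \<Rightarrow> ((complex^'n) \<Rightarrow> complex^'n^'n) \<Rightarrow> complex \<Rightarrow> ((complex^'n) \<Rightarrow> complex^'n^'n)
     \<Rightarrow> (complex^'n) \<Rightarrow> complex^'n^'n" where
  "lin_comb a P b Q X = (\<chi> j k. a * P X $ j $ k + b * Q X $ j $ k)"

definition compatible_on ::
  "(complex^'n) set \<Rightarrow> ((complex^'n) \<Rightarrow> complex^'n^'n) \<Rightarrow> ((complex^'n) \<Rightarrow> complex^'n^'n) \<Rightarrow> bool" where
  "compatible_on U P Q \<longleftrightarrow>
     poisson_on U P \<and> poisson_on U Q \<and> (\<forall>a b. poisson_on U (lin_comb a P b Q))"

definition casimir_on ::
  "(complex^'n) set \<Rightarrow> ((complex^'n) \<Rightarrow> complex^'n^'n) \<Rightarrow> ((complex^'n) \<Rightarrow> complex) \<Rightarrow> bool" where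
  "casimir_on U P C \<longleftrightarrow> holomorphic_Cn_on C U \<and> (\<forall>X\<in>U. P X *v cgrad C X = 0)"

text \<open>The autonomous system \<open>X' = V(X)\<close> is Hamiltonian with bracket \<open>P\<close> and Hamilton function
  \<open>H\<close>.\<close>

definition hamiltonian_on ::
  "(complex^'n) set \<Rightarrow> ((complex^'n) \<Rightarrow> complex^'n) \<Rightarrow> ((complex^'n) \<Rightarrow> complex^'n^'n)
     \<Rightarrow> ((complex^'n) \<Rightarrow> complex) \<Rightarrow> bool" where
  "hamiltonian_on U V P H \<longleftrightarrow>
     poisson_on U P \<and> holomorphic_Cn_on H U \<and> (\<forall>X\<in>U. V X = P X *v cgrad H X)"

text \<open>Bi-Hamiltonian in the sense of Magri: Hamiltonian for two compatible brackets. Linear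
  independence over the constants excludes the trivial case of proportional brackets.\<close>

definition bi_hamiltonian_on ::
  "(complex^'n) set \<Rightarrow> ((complex^'n) \<Rightarrow> complex^'n)
     \<Rightarrow> ((complex^'n) \<Rightarrow> complex^'n^'n) \<Rightarrow> ((complex^'n) \<Rightarrow> complex)
     \<Rightarrow> ((complex^'n) \<Rightarrow> complex^'n^'n) \<Rightarrow> ((complex^'n) \<Rightarrow> complex) \<Rightarrow> bool" where
  "bi_hamiltonian_on U V P F Q G \<longleftrightarrow>
     compatible_on U P Q \<and> hamiltonian_on U V P F \<and> hamiltonian_on U V Q G \<and>
     (\<forall>a b. (\<forall>X\<in>U. lin_comb a P b Q X = 0) \<longrightarrow> a = 0 \<and> b = 0)"


section \<open>Complete elliptic integrals and their branches\<close>

text \<open>The defining integrals, along straight segments and with principal square roots. The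
  primes of \<open>ellipticK'\<close> and \<open>ellipticE'\<close> do not denote derivatives.\<close>

definition ellipticK :: "complex \<Rightarrow> complex" where
  "ellipticK k =
     contour_integral (linepath 0 1) (\<lambda>w. 1 / csqrt ((1 - w\<^sup>2) * (1 - k\<^sup>2 * w\<^sup>2)))"

definition ellipticE :: "complex \<Rightarrow> complex" where
  "ellipticE k =
     contour_integral (linepath 0 1) (\<lambda>w. csqrt ((1 - k\<^sup>2 * w\<^sup>2) / (1 - w\<^sup>2)))"

definition ellipticK' :: "complex \<Rightarrow> complex" where
  "ellipticK' k =
     contour_integral (linepath k 1) (\<lambda>w. 1 / csqrt ((1 - w\<^sup>2) * (w\<^sup>2 - k\<^sup>2)))"

definition ellipticE' :: "complex \<Rightarrow> complex" where
  "ellipticE' k =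
     contour_integral (linepath 0 1) (\<lambda>w. csqrt ((1 - (1 - k\<^sup>2) * w\<^sup>2) / (1 - w\<^sup>2)))"

text \<open>\<open>continuation D0 f0 g0 D f g\<close>: the pair \<open>(f, g)\<close> on the region \<open>D\<close> arises from the pair
  \<open>(f0, g0)\<close> on \<open>D0\<close> by simultaneous analytic continuation along a finite chain of regions.\<close>

inductive continuation ::
  "complex set \<Rightarrow> (complex \<Rightarrow> complex) \<Rightarrow> (complex \<Rightarrow> complex)
     \<Rightarrow> complex set \<Rightarrow> (complex \<Rightarrow> complex) \<Rightarrow> (complex \<Rightarrow> complex) \<Rightarrow> bool"
  for D0 f0 g0 where
  base: "continuation D0 f0 g0 D0 f0 g0"
| step: "continuation D0 f0 g0 D f g \<Longrightarrow> open D' \<Longrightarrow> connected D' \<Longrightarrow>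
     f' holomorphic_on D' \<Longrightarrow> g' holomorphic_on D' \<Longrightarrow>
     open W \<Longrightarrow> W \<noteq> {} \<Longrightarrow> W \<subseteq> D \<inter> D' \<Longrightarrow> (\<And>k. k \<in> W \<Longrightarrow> f' k = f k \<and> g' k = g k) \<Longrightarrow>
     continuation D0 f0 g0 D' f' g'"

text \<open>On the doubly slit plane the radicands of \<open>ellipticK\<close>, \<open>ellipticE\<close> avoid the cut of
  \<^const>\<open>csqrt\<close>, so both integrals are holomorphic there.\<close>

definition KE_branch ::
  "complex set \<Rightarrow> (complex \<Rightarrow> complex) \<Rightarrow> (complex \<Rightarrow> complex) \<Rightarrow> bool" where
  "KE_branch = continuation (- {k \<in> \<real>. 1 \<le> norm k}) ellipticK ellipticE"

text \<open>On the strip \<open>0 < Re k < 1\<close> the same holds for \<open>ellipticK'\<close>, \<open>ellipticE'\<close>: for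
  \<open>w = k + t (1 - k)\<close> one has \<open>(1 - w\<^sup>2) (w\<^sup>2 - k\<^sup>2) = t (1 - t) (1 - k)\<^sup>2 (1 + w) (w + k)\<close>, and the
  arguments of \<open>(1 - k)\<^sup>2\<close> and \<open>(1 + w) (w + k)\<close> are of opposite sign and less than \<open>\<pi>\<close> in modulus.
  For larger \<open>Re k\<close> the principal root may jump along the segment.\<close>

definition KE'_branch ::
  "complex set \<Rightarrow> (complex \<Rightarrow> complex) \<Rightarrow> (complex \<Rightarrow> complex) \<Rightarrow> bool" where
  "KE'_branch = continuation {k. 0 < Re k \<and> Re k < 1} ellipticK' ellipticE'"


section \<open>The system, the brackets and the Casimir functions\<close>

text \<open>The coordinates \<open>(x, y, z, u)\<close> of \<open>X\<close> are \<open>(X $ 1, X $ 2, X $ 3, X $ 4)\<close>. In the functions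
  below \<open>K\<close>, \<open>E\<close> are a branch of the complete elliptic integrals and \<open>K'\<close>, \<open>E'\<close> one of the
  complementary integrals, all evaluated at \<open>z / y\<close>.\<close>

definition V_x :: "complex^4 \<Rightarrow> complex" where
  "V_x X = (X$4 + (X$2)\<^sup>2 + (X$3)\<^sup>2) * X$1"

definition V_y :: "complex^4 \<Rightarrow> complex" where
  "V_y X = (X$4 + (X$2)\<^sup>2 - 2 * (X$3)\<^sup>2) * X$2"

definition V_z :: "complex^4 \<Rightarrow> complex" where
  "V_z X = (X$4 - 2 * (X$2)\<^sup>2 + (X$3)\<^sup>2) * X$3"

definition V_u :: "complex^4 \<Rightarrow> complex" where
  "V_u X = (X$4)\<^sup>2 - (X$2)^4 + (X$2)\<^sup>2 * (X$3)\<^sup>2 - (X$3)^4"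

definition system_S :: "complex^4 \<Rightarrow> complex^4" where
  "system_S X = vector [V_x X, V_y X, V_z X, V_u X]"

definition Ham :: "complex^4 \<Rightarrow> complex" where
  "Ham X = 1/2 * (((X$2)\<^sup>2 - (X$3)\<^sup>2) / (X$1)\<^sup>2)"

definition omega :: "complex^4 \<Rightarrow> complex^4^4" where
  "omega X = (\<chi> i j. X$1 / (2 * Ham X) *
     (vector
       [vector [0, V_y X, V_z X, V_u X],
        vector [- V_y X, 0, 0, 0],
        vector [- V_z X, 0, 0, 0],
        vector [- V_u X, 0, 0, 0]] :: complex^4^4) $ i $ j)"

definition M1 :: "(complex \<Rightarrow> complex) \<Rightarrow> (complex \<Rightarrow> complex) \<Rightarrow> complex^4 \<Rightarrow> complex" where
  "M1 K E X = (let y = X$2; z = X$3; r = E (z/y) / K (z/y) in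
     3 * y\<^sup>2 * (r - 1)\<^sup>2 - z\<^sup>2)"

definition M2 :: "(complex \<Rightarrow> complex) \<Rightarrow> (complex \<Rightarrow> complex) \<Rightarrow> complex^4 \<Rightarrow> complex" where
  "M2 K E X = (let y = X$2; z = X$3; r = E (z/y) / K (z/y) in
     3 * y^4 * (r - 1)\<^sup>2 + y\<^sup>2 * z\<^sup>2 * (6 * r - 5) + 2 * z^4)"

definition M3 :: "(complex \<Rightarrow> complex) \<Rightarrow> (complex \<Rightarrow> complex) \<Rightarrow> complex^4 \<Rightarrow> complex" where
  "M3 K E X = (let y = X$2; z = X$3; r = E (z/y) / K (z/y) in
     y\<^sup>2 * (3 * r\<^sup>2 - 1) + z\<^sup>2)"

definition omega_t ::
  "(complex \<Rightarrow> complex) \<Rightarrow> (complex \<Rightarrow> complex) \<Rightarrow> complex^4 \<Rightarrow> complex^4^4" where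
  "omega_t K E X = (let x = X$1; y = X$2; z = X$3 in
     (\<chi> i j. 2 / complex_of_real pi * (K (z/y))\<^sup>2 *
       (vector
         [vector [0, x/y * z\<^sup>2, x * z, x * M1 K E X],
          vector [- (x/y * z\<^sup>2), 0, z/y * (y\<^sup>2 - z\<^sup>2), 1/y * M2 K E X],
          vector [- (x * z), z/y * (z\<^sup>2 - y\<^sup>2), 0, z * M3 K E X],
          vector [- (x * M1 K E X), - (1/y * M2 K E X), - (z * M3 K E X), 0]] :: complex^4^4) $ i $ j))"

definition Omega ::
  "complex \<Rightarrow> (complex \<Rightarrow> complex) \<Rightarrow> (complex \<Rightarrow> complex) \<Rightarrow> complex^4 \<Rightarrow> complex^4^4" where
  "Omega l K E = lin_comb 1 omega l (omega_t K E)"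

definition J1 :: "(complex \<Rightarrow> complex) \<Rightarrow> (complex \<Rightarrow> complex) \<Rightarrow> complex^4 \<Rightarrow> complex" where
  "J1 K E X = (let y = X$2; z = X$3; u = X$4 in
     1/y * (u - 2 * y\<^sup>2 + z\<^sup>2) * K (z/y) + 3 * y * E (z/y))"

definition J2 :: "(complex \<Rightarrow> complex) \<Rightarrow> (complex \<Rightarrow> complex) \<Rightarrow> complex^4 \<Rightarrow> complex" where
  "J2 K' E' X = (let y = X$2; z = X$3; u = X$4 in
     1/y * (u + y\<^sup>2 + z\<^sup>2) * K' (z/y) - 3 * y * E' (z/y))"

definition NN :: "(complex \<Rightarrow> complex) \<Rightarrow> (complex \<Rightarrow> complex) \<Rightarrow> complex^4 \<Rightarrow> complex" where
  "NN K E X = - (K (X$3 / X$2) / (X$2 * J1 K E X))"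

text \<open>The sets on which the formulas make sense, i.e. on which no denominator vanishes and \<open>z / y\<close>
  lies in the region of the branch: \<open>dom_omega\<close> for \<^const>\<open>Ham\<close>, \<^const>\<open>omega\<close>; \<open>dom_ell D\<close> for
  \<^const>\<open>J1\<close>, \<^const>\<open>J2\<close>; \<open>dom_omega_t D K\<close> for \<^const>\<open>omega_t\<close>.\<close>

definition dom_omega :: "(complex^4) set" where
  "dom_omega = {X. X$1 \<noteq> 0 \<and> (X$2)\<^sup>2 \<noteq> (X$3)\<^sup>2}"

definition dom_ell :: "complex set \<Rightarrow> (complex^4) set" where
  "dom_ell D = {X. X$2 \<noteq> 0 \<and> X$3 / X$2 \<in> D}"

definition dom_omega_t :: "complex set \<Rightarrow> (complex \<Rightarrow> complex) \<Rightarrow> (complex^4) set" where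
  "dom_omega_t D K = {X \<in> dom_ell D. K (X$3 / X$2) \<noteq> 0}"

end

theory Submission
  imports Defs
begin

text \<open>The proof has an algebraic and an analytic part, joined by the differential equations
  \<open>k (1 - k\<^sup>2) dK/dk = E - (1 - k\<^sup>2) K\<close> and \<open>k dE/dk = E - K\<close>.

  \<^emph>\<open>Poisson brackets and Casimir functions.\<close> The Jacobi identity for arbitrary holomorphic functions
  follows from that for coordinate functions (\<open>poisson_onI\<close>), since the terms with second
  derivatives cancel; that second derivatives exist and commute is a consequence of
  Cauchy's formula. In dimension four only four triples of coordinates matter, and for a
  combination \<open>a \<omega> + b \<omega>\<^sub>t\<close> the expression is a quadratic form in \<open>(a, b)\<close> (\<open>poisson_on_lin_comb\<close>).
  With \<open>k = z / y\<close> every entry of \<open>\<omega>\<^sub>t\<close> is a monomial in \<open>x\<close>, \<open>y\<close> times a polynomial in \<open>k\<close>, \<open>K(k)\<close>, \<open>E(k)\<close>. So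
  each identity required of the brackets and of the Casimir functions says that a polynomial vanishes
  modulo the differential equations. As these are used in polynomial form, the identities hold on
  all of a branch, even where \<open>k (1 - k\<^sup>2) = 0\<close>. The Hamiltonian is a Casimir function of \<open>\<omega>\<^sub>t\<close>, which is
  why it generates the same flow for \<open>\<omega>\<close> and for \<open>\<Omega> = \<omega> + \<lambda> \<omega>\<^sub>t\<close>.

  \<^emph>\<open>Branches.\<close> The substitution \<open>w = sin t\<close> turns the defining integrals into integrals over the fixed
  interval \<open>[0, \<pi>/2]\<close>, which may be differentiated under the integral sign (\<open>K_par_ode\<close>, \<open>E_par_ode\<close>).
  The complementary integrals are the same functions at \<open>1 - k\<^sup>2\<close>. The identity theorem carries the
  equations along every continuation (\<open>continuation_identity_iff\<close>).

  \<^emph>\<open>Non-degeneracy.\<close> The Pfaffian of \<open>\<Omega>\<close> is a quadratic polynomial in \<open>u\<close> whose leading coefficient is a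
  nonzero multiple of \<open>z K(z/y)\<^sup>2\<close>, so it vanishes on no nonempty open set (\<open>det_Omega_generic\<close>).

  \<^emph>\<open>Transcendence.\<close> For \<open>k = tanh s\<close> the differential equation gives \<open>d/ds (tanh s K(tanh s)) = E(tanh s)\<close>,
  and \<open>E\<close> lies between 1 and \<open>\<pi>/2\<close>. Hence \<open>K\<close> grows linearly in \<open>s\<close> while \<open>1 - k\<close> decays exponentially,
  which is impossible for an algebraic function (\<open>ellipticK_square_transcendental\<close>). The identity theorem
  brings an algebraic relation on any branch back to this one.

  \<^emph>\<open>Multivaluedness.\<close> When the path of integration is moved into the upper half plane, \<open>K\<close> extends
  from above across its cut near \<open>k = 2\<close>. The original values on the two sides of the cut are conjugate, and
  the imaginary part of \<open>K\<^sup>2\<close> stays away from 0 as the cut is approached, so the two branches of \<open>K\<^sup>2\<close> differ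
  (\<open>branches_differ\<close>).\<close>

(* the dollar sign is to denote vector components only *)
no_notation fps_nth (infixl "$" 75)

section \<open>Holomorphic functions of several variables\<close>

lemma bounded_linear_axis: "bounded_linear (axis i :: 'a::real_normed_vector \<Rightarrow> 'a^'n)"
proof (rule bounded_linear_intro[where K = 1])
  show "norm (axis i x :: 'a^'n) \<le> norm x * 1" for x :: 'a
    by (simp add: norm_vec_def L2_set_def axis_def if_distrib[of norm] if_distrib[of "\<lambda>a. a ^ 2"] sum.delta cong: if_cong)
qed (auto simp: axis_def vec_eq_iff)

lemma continuous_on_axis [continuous_intros]:
  "continuous_on S g \<Longrightarrow> continuous_on S (\<lambda>x. axis i (g x :: 'a::real_normed_vector) :: 'a^'n)"
  using bounded_linear.continuous_on[OF bounded_linear_axis] .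

lemma norm_axis_eq: "norm (axis i x :: 'a::real_normed_vector^'n) = norm x"
  by (simp add: norm_vec_def L2_set_def axis_def if_distrib[of norm] if_distrib[of "\<lambda>a. a ^ 2"] sum.delta cong: if_cong)

lemma axis_zero [simp]: "axis i 0 = (0 :: 'a::zero^'n)"
  by (simp add: axis_def vec_eq_iff)

lemma axis_add_distrib: "axis i (s + t) = axis i s + (axis i t :: 'a::monoid_add^'n)"
  by (simp add: axis_def vec_eq_iff)

lemma has_field_derivative_axis:
  fixes f :: "complex^'n \<Rightarrow> complex"
  assumes "(f has_derivative (\<lambda>h. \<Sum>m\<in>UNIV. a $ m * h $ m)) (at (X + axis i s))"
  shows "((\<lambda>t. f (X + axis i t)) has_field_derivative a $ i) (at s)"
proof -
  have 1: "((\<lambda>t. X + axis i t) has_derivative (\<lambda>t. axis i t)) (at s)"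
    by (rule derivative_eq_intros bounded_linear.has_derivative[OF bounded_linear_axis] has_derivative_ident | simp)+
  have 2: "(\<Sum>m\<in>UNIV. a $ m * axis i t $ m) = a $ i * t" for t
    by (simp add: axis_def if_distrib[of "\<lambda>x. _ * x"] cong: if_cong)
  show ?thesis
    using has_derivative_compose[OF 1 assms] by (simp add: has_field_derivative_def 2)
qed

lemma cgrad_eqI:
  assumes "(f has_derivative (\<lambda>h. \<Sum>m\<in>UNIV. a $ m * h $ m)) (at X)"
  shows "cgrad f X = a"
  using has_field_derivative_axis[of f a X _ 0] assms
  by (simp add: cgrad_def vec_eq_iff DERIV_imp_deriv)

lemma holomorphic_Cn_has_derivative:
  assumes "holomorphic_Cn_on f U" "X \<in> U"
  shows "(f has_derivative (\<lambda>h. \<Sum>m\<in>UNIV. cgrad f X $ m * h $ m)) (at X)"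
proof -
  obtain a where a: "(f has_derivative (\<lambda>h. \<Sum>m\<in>UNIV. a $ m * h $ m)) (at X)"
    using assms unfolding holomorphic_Cn_on_def by blast
  from cgrad_eqI[OF a] a show ?thesis by simp
qed

lemma holomorphic_Cn_has_field_derivative:
  assumes "holomorphic_Cn_on f U" "X + axis i s \<in> U"
  shows "((\<lambda>t. f (X + axis i t)) has_field_derivative cgrad f (X + axis i s) $ i) (at s)"
  by (rule has_field_derivative_axis[OF holomorphic_Cn_has_derivative[OF assms]])

lemma holomorphic_Cn_continuous_on:
  assumes "holomorphic_Cn_on f U"
  shows "continuous_on U f"
  using has_derivative_continuous[OF holomorphic_Cn_has_derivative[OF assms]]
  by (blast intro: continuous_at_imp_continuous_on)

lemma holomorphic_Cn_on_subset: "holomorphic_Cn_on f U \<Longrightarrow> V \<subseteq> U \<Longrightarrow> holomorphic_Cn_on f V"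
  by (auto simp: holomorphic_Cn_on_def)

definition circ :: "real \<Rightarrow> real \<Rightarrow> complex" where
  "circ r \<tau> = circlepath 0 r \<tau>"

lemma circ_simps: "0 < r \<Longrightarrow> norm (circ r \<tau>) = r" "0 < r \<Longrightarrow> circ r \<tau> \<noteq> 0"
  by (auto simp: circ_def circlepath norm_mult)

lemma continuous_on_circ [continuous_intros]:
  "continuous_on S g \<Longrightarrow> continuous_on S (\<lambda>x. circ r (g x))"
  by (auto simp: circ_def circlepath intro!: continuous_intros)

text \<open>Cauchy's formula for the derivative, with the circle parametrized over \<open>[0, 1]\<close>, so that
  parametric integrals over a box apply to it.\<close>

lemma deriv_eq_circle_average:
  assumes "\<phi> holomorphic_on ball 0 R" "0 < r" "r < R"
  shows "deriv \<phi> 0 = integral (cbox 0 1) (\<lambda>\<tau>. \<phi> (circ r \<tau>) / circ r \<tau>)"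
proof -
  have sub: "cball 0 r \<subseteq> ball (0::complex) R" using assms by auto
  have "(\<phi> has_field_derivative (1 / (2 * of_real pi * \<i>) * contour_integral (circlepath 0 r) (\<lambda>u. \<phi> u / (u - 0)^2))) (at 0)"
    using assms sub
    by (intro Cauchy_derivative_integral_circlepath(2))
       (auto intro: holomorphic_on_imp_continuous_on holomorphic_on_subset)
  then have "deriv \<phi> 0 = 1 / (2 * of_real pi * \<i>) * contour_integral (circlepath 0 r) (\<lambda>u. \<phi> u / u^2)"
    by (simp add: DERIV_imp_deriv)
  also have "\<dots> = 1 / (2 * of_real pi * \<i>) *
      integral {0..1} (\<lambda>\<tau>. \<phi> (circ r \<tau>) / (circ r \<tau>)^2 * (2 * of_real pi * \<i> * circ r \<tau>))"
    unfolding contour_integral_integral vector_derivative_circlepath circ_def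
    by (simp add: circlepath mult.assoc)
  also have "\<dots> = integral {0..1} (\<lambda>\<tau>. 1 / (2 * of_real pi * \<i>) * (\<phi> (circ r \<tau>) / (circ r \<tau>)^2 * (2 * of_real pi * \<i> * circ r \<tau>)))"
    by (rule integral_mult_right[symmetric])
  also have "\<dots> = integral {0..1} (\<lambda>\<tau>. \<phi> (circ r \<tau>) / circ r \<tau>)"
    using circ_simps(2)[OF assms(2)] by (intro integral_cong) (simp add: power2_eq_square)
  finally show ?thesis by simp
qed

lemma cgrad_eq_circle_average:
  assumes f: "holomorphic_Cn_on f U" and sub: "ball Y R \<subseteq> U" and r: "0 < r" "r < R"
  shows "cgrad f Y $ i = integral (cbox 0 1) (\<lambda>\<tau>. f (Y + axis i (circ r \<tau>)) / circ r \<tau>)"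
proof -
  have "(\<lambda>t. f (Y + axis i t)) holomorphic_on ball 0 R"
  proof (rule holomorphic_onI)
    fix t :: complex assume "t \<in> ball 0 R"
    then have "Y + axis i t \<in> U" using sub by (auto simp: dist_norm norm_axis_eq)
    from holomorphic_Cn_has_field_derivative[OF f this]
    show "(\<lambda>t. f (Y + axis i t)) field_differentiable at t within ball 0 R"
      using field_differentiable_at_within field_differentiable_def by blast
  qed
  from deriv_eq_circle_average[OF this r] show ?thesis by (simp add: cgrad_def)
qed

text \<open>The definition of holomorphy only asks for a derivative at each point. Continuity of the
  gradient comes from Cauchy's formula: each component is an average of the continuous function \<open>f\<close>
  over a small circle.\<close>

lemma continuous_on_cgrad:
  assumes f: "holomorphic_Cn_on f U" and "open U"
  shows "continuous_on U (\<lambda>X. cgrad f X $ i)"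
proof (rule continuous_at_imp_continuous_on, rule ballI)
  fix X assume "X \<in> U"
  then obtain R where R: "0 < R" "ball X R \<subseteq> U" using \<open>open U\<close> openE by blast
  have "continuous_on (ball X (R/2)) (\<lambda>Y. integral (cbox 0 1) (\<lambda>\<tau>. f (Y + axis i (circ (R/4) \<tau>)) / circ (R/4) \<tau>))"
  proof (rule integral_continuous_on_param)
    have "dist X (Y + axis i (circ (R/4) \<tau>)) < R" if "dist X Y < R / 2" for Y \<tau>
    proof -
      have "dist Y (Y + axis i (circ (R/4) \<tau>)) = R/4"
        using R by (simp add: dist_norm norm_axis_eq circ_simps)
      then show ?thesis using that R dist_triangle[of X "Y + axis i (circ (R/4) \<tau>)" Y] by simp
    qed
    then show "continuous_on (ball X (R/2) \<times> cbox 0 1) (\<lambda>(Y, \<tau>). f (Y + axis i (circ (R/4) \<tau>)) / circ (R/4) \<tau>)"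
      using R unfolding split_beta
      by (intro continuous_intros continuous_on_compose2[OF holomorphic_Cn_continuous_on[OF f]])
         (auto simp: circ_simps)
  qed
  moreover have "cgrad f Y $ i = integral (cbox 0 1) (\<lambda>\<tau>. f (Y + axis i (circ (R/4) \<tau>)) / circ (R/4) \<tau>)"
    if "Y \<in> ball X (R/2)" for Y
  proof (rule cgrad_eq_circle_average[OF f, of _ "R/2"])
    show "ball Y (R/2) \<subseteq> U"
    proof
      fix Z assume "Z \<in> ball Y (R/2)"
      with that have "dist X Z < R" using dist_triangle[of X Z Y] by simp
      then show "Z \<in> U" using R by auto
    qed
  qed (use R in auto)
  ultimately have "continuous_on (ball X (R/2)) (\<lambda>Y. cgrad f Y $ i)"
    using continuous_on_eq by (metis (no_types, lifting))
  then show "isCont (\<lambda>Y. cgrad f Y $ i) X"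
    using R by (simp add: continuous_on_eq_continuous_at)
qed

text \<open>Differentiating the circle average for \<open>\<partial>\<^sub>j f\<close> under the integral sign shows that the gradient
  is again differentiable along every axis, with a derivative that is the circle average of
  \<open>\<partial>\<^sub>i f\<close> in direction \<open>j\<close>.\<close>

lemma cgrad_has_field_derivative_average:
  assumes f: "holomorphic_Cn_on f U" and "open U" and R: "0 < R" "ball X R \<subseteq> U"
  shows "((\<lambda>s. cgrad f (X + axis i s) $ j) has_field_derivative
      integral (cbox 0 1) (\<lambda>\<tau>. cgrad f (X + axis j (circ (R/4) \<tau>)) $ i / circ (R/4) \<tau>)) (at 0)"
proof -
  have in_U: "X + axis i s + axis j t \<in> U" if "norm s + norm t < R" for s t i j
  proof -
    have "norm (axis i s + axis j t :: complex^'a) < R"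
      using norm_triangle_ineq[of "axis i s" "axis j t"] that by (simp add: norm_axis_eq)
    then show ?thesis using R(2) by (auto simp: subset_iff dist_norm norm_minus_commute add.assoc)
  qed
  have "((\<lambda>s. integral (cbox 0 1) (\<lambda>\<tau>. f (X + axis i s + axis j (circ (R/4) \<tau>)) / circ (R/4) \<tau>))
     has_field_derivative
      integral (cbox 0 1) (\<lambda>\<tau>. cgrad f (X + axis i 0 + axis j (circ (R/4) \<tau>)) $ i / circ (R/4) \<tau>)) (at 0 within ball 0 (R/2))"
  proof (rule leibniz_rule_field_derivative)
    fix s :: complex and \<tau> :: real assume s: "s \<in> ball 0 (R/2)"
    have "(\<lambda>s. f (X + axis i s + axis j (circ (R/4) \<tau>))) = (\<lambda>s. f ((X + axis j (circ (R/4) \<tau>)) + axis i s))"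
      by (simp add: add_ac)
    moreover have "X + axis j (circ (R/4) \<tau>) + axis i s \<in> U"
      using in_U[of s "circ (R/4) \<tau>" i j] s R by (simp add: circ_simps add_ac)
    ultimately have "((\<lambda>s. f (X + axis i s + axis j (circ (R/4) \<tau>))) has_field_derivative
          cgrad f (X + axis j (circ (R/4) \<tau>) + axis i s) $ i) (at s)"
      using holomorphic_Cn_has_field_derivative[OF f, of "X + axis j (circ (R/4) \<tau>)" i s] by simp
    then have "((\<lambda>s. f (X + axis i s + axis j (circ (R/4) \<tau>))) has_field_derivative
        cgrad f (X + axis i s + axis j (circ (R/4) \<tau>)) $ i) (at s)"
      by (simp add: add_ac)
    then show "((\<lambda>s. f (X + axis i s + axis j (circ (R/4) \<tau>)) / circ (R/4) \<tau>) has_field_derivative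
        cgrad f (X + axis i s + axis j (circ (R/4) \<tau>)) $ i / circ (R/4) \<tau>) (at s within ball 0 (R/2))"
      using DERIV_cdivide has_field_derivative_at_within by blast
  next
    fix s :: complex assume s: "s \<in> ball 0 (R/2)"
    show "(\<lambda>\<tau>. f (X + axis i s + axis j (circ (R/4) \<tau>)) / circ (R/4) \<tau>) integrable_on cbox 0 1"
      using R s in_U
      by (intro integrable_continuous continuous_intros continuous_on_compose2[OF holomorphic_Cn_continuous_on[OF f]])
         (auto simp: circ_simps)
  next
    show "continuous_on (ball 0 (R/2) \<times> cbox 0 1) (\<lambda>(s, \<tau>). cgrad f (X + axis i s + axis j (circ (R/4) \<tau>)) $ i / circ (R/4) \<tau>)"
      using R in_U unfolding split_beta
      by (intro continuous_intros continuous_on_compose2[OF continuous_on_cgrad[OF f \<open>open U\<close>]])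
         (auto simp: circ_simps)
  qed (use R in auto)
  moreover have average: "cgrad f (X + axis i s) $ j = integral (cbox 0 1) (\<lambda>\<tau>. f (X + axis i s + axis j (circ (R/4) \<tau>)) / circ (R/4) \<tau>)"
    if "s \<in> ball 0 (R/2)" for s
  proof (rule cgrad_eq_circle_average[OF f, of _ "R/2"])
    show "ball (X + axis i s) (R/2) \<subseteq> U"
    proof
      fix Y assume "Y \<in> ball (X + axis i s) (R/2)"
      moreover have "dist X (X + axis i s) < R/2" using that by (simp add: dist_norm norm_axis_eq)
      ultimately have "dist X Y < R" using dist_triangle[of X Y "X + axis i s"] by simp
      then show "Y \<in> U" using R by auto
    qed
  qed (use R in auto)
  moreover have "at 0 within ball 0 (R/2) = at (0::complex)"
    using R by (intro at_within_open) auto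
  ultimately have "((\<lambda>s. integral (cbox 0 1) (\<lambda>\<tau>. f (X + axis i s + axis j (circ (R/4) \<tau>)) / circ (R/4) \<tau>))
      has_field_derivative
        integral (cbox 0 1) (\<lambda>\<tau>. cgrad f (X + axis j (circ (R/4) \<tau>)) $ i / circ (R/4) \<tau>)) (at 0)"
    by simp
  then show ?thesis
    by (rule has_field_derivative_transform_within_open[where S = "ball 0 (R/2)"])
       (use R average in simp_all)
qed

text \<open>Second derivatives commute: the circle average of the previous lemma, which is
  \<open>\<partial>\<^sub>i \<partial>\<^sub>j f\<close>, is also Cauchy's formula for \<open>\<partial>\<^sub>j\<close> applied to the function \<open>\<partial>\<^sub>i f\<close>.\<close>

lemma cgrad_has_field_derivative:
  assumes f: "holomorphic_Cn_on f U" and "open U" and X: "X \<in> U"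
  shows "((\<lambda>t. cgrad f (X + axis i t) $ j) has_field_derivative
           deriv (\<lambda>t. cgrad f (X + axis j t) $ i) 0) (at 0)"
proof -
  obtain R where R: "0 < R" "ball X R \<subseteq> U" using \<open>open U\<close> X openE by blast
  have hol: "(\<lambda>t. cgrad f (X + axis j t) $ i) holomorphic_on ball 0 (R/2)"
  proof (rule holomorphic_onI)
    fix t :: complex assume "t \<in> ball 0 (R/2)"
    then have "X + axis j t \<in> U" using R by (auto simp: subset_iff dist_norm norm_axis_eq)
    then obtain r where "0 < r" "ball (X + axis j t) r \<subseteq> U" using \<open>open U\<close> openE by blast
    from cgrad_has_field_derivative_average[OF f \<open>open U\<close> this, of j i]
    have "(\<lambda>s. cgrad f (X + axis j (s + t)) $ i) field_differentiable at 0"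
      unfolding field_differentiable_def by (auto simp: axis_add_distrib add_ac)
    then have "(\<lambda>t. cgrad f (X + axis j t) $ i) field_differentiable at (0 + t)"
      unfolding field_differentiable_def DERIV_shift .
    then show "(\<lambda>t. cgrad f (X + axis j t) $ i) field_differentiable at t within ball 0 (R/2)"
      using field_differentiable_at_within by simp
  qed
  have "deriv (\<lambda>t. cgrad f (X + axis j t) $ i) 0 =
      integral (cbox 0 1) (\<lambda>\<tau>. cgrad f (X + axis j (circ (R/4) \<tau>)) $ i / circ (R/4) \<tau>)"
    using R by (intro deriv_eq_circle_average[OF hol]) auto
  with cgrad_has_field_derivative_average[OF f \<open>open U\<close> R, of i j] show ?thesis by simp
qed

section \<open>The Jacobi identity from coordinate functions\<close>

lemma sum_rotate:
  fixes T :: "'i::finite \<Rightarrow> 'i \<Rightarrow> 'i \<Rightarrow> 'a::comm_monoid_add"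
  shows "(\<Sum>a\<in>UNIV. \<Sum>b\<in>UNIV. \<Sum>c\<in>UNIV. T a b c) = (\<Sum>b\<in>UNIV. \<Sum>c\<in>UNIV. \<Sum>a\<in>UNIV. T a b c)"
  by (subst sum.swap, rule sum.cong[OF refl], rule sum.swap)

text \<open>The Jacobi identity at one point, in terms of the values \<open>p\<close> and first derivatives \<open>d\<close> of the
  bracket matrix, the gradients \<open>f\<close>, \<open>g\<close>, \<open>h\<close> and their Hessians \<open>F\<close>, \<open>G\<close>, \<open>H\<close>. In each of the
  three double brackets the terms with a Hessian have the form \<open>B S f g\<close>, the Hessian evaluated on
  the Hamiltonian vector fields of the other two functions. It is symmetric because \<open>S\<close> is, so in the
  cyclic sum these terms cancel in pairs; what remains is the identity for the coordinate functions.\<close>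

lemma jacobi_sum:
  fixes p :: "'n::finite \<Rightarrow> 'n \<Rightarrow> complex"
  assumes antisym: "\<And>i j. p j i = - p i j"
    and sym: "\<And>i j. F i j = F j i" "\<And>i j. G i j = G j i" "\<And>i j. H i j = H j i"
    and jacobi: "\<And>i j k. (\<Sum>l\<in>UNIV. p i l * d j k l) + (\<Sum>l\<in>UNIV. p j l * d k i l) + (\<Sum>l\<in>UNIV. p k l * d i j l) = 0"
  defines "T \<equiv> \<lambda>f g h G H. \<Sum>i\<in>UNIV. \<Sum>l\<in>UNIV. p i l * f i *
      (\<Sum>j\<in>UNIV. \<Sum>k\<in>UNIV. d j k l * g j * h k + p j k * G j l * h k + p j k * g j * H k l)"
  shows "T f g h G H + T g h f H F + T h f g F G = 0"
proof -
  \<comment> \<open>\<open>v f\<close> is the Hamiltonian vector field of \<open>f\<close>.\<close>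
  define v where "v f l = (\<Sum>i\<in>UNIV. p i l * f i)" for f l
  define c where "c i j k = (\<Sum>l\<in>UNIV. p i l * d j k l)" for i j k
  define A where "A f g h = (\<Sum>i\<in>UNIV. \<Sum>j\<in>UNIV. \<Sum>k\<in>UNIV. c i j k * (f i * g j * h k))" for f g h
  define B where "B S f g = (\<Sum>l\<in>UNIV. \<Sum>j\<in>UNIV. v f l * S j l * v g j)" for S f g
  have v': "(\<Sum>k\<in>UNIV. p j k * h k) = - v h j" for h j
  proof -
    have "(\<Sum>k\<in>UNIV. p j k * h k) = (\<Sum>k\<in>UNIV. - (p k j * h k))"
      by (intro sum.cong refl) (simp add: antisym[of _ j])
    then show ?thesis by (simp add: v_def sum_negf)
  qed
  have T_eq: "T f g h G H = A f g h - B G f h + B H f g" for f g h G H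
  proof -
    have A_eq: "(\<Sum>l\<in>UNIV. v f l * (\<Sum>j\<in>UNIV. \<Sum>k\<in>UNIV. d j k l * g j * h k)) = A f g h"
    proof -
      have "(\<Sum>l\<in>UNIV. v f l * (\<Sum>j\<in>UNIV. \<Sum>k\<in>UNIV. d j k l * g j * h k)) =
          (\<Sum>l\<in>UNIV. \<Sum>i\<in>UNIV. \<Sum>j\<in>UNIV. \<Sum>k\<in>UNIV. p i l * d j k l * (f i * g j * h k))"
        unfolding v_def sum_distrib_right unfolding sum_distrib_left by (simp add: mult_ac)
      also have "\<dots> = (\<Sum>i\<in>UNIV. \<Sum>j\<in>UNIV. \<Sum>k\<in>UNIV. \<Sum>l\<in>UNIV. p i l * d j k l * (f i * g j * h k))"
        by (subst sum.swap, rule sum.cong[OF refl], subst sum.swap, rule sum.cong[OF refl], rule sum.swap)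
      also have "\<dots> = A f g h"
        by (simp add: A_def c_def sum_distrib_right)
      finally show ?thesis .
    qed
    have G_part: "(\<Sum>j\<in>UNIV. \<Sum>k\<in>UNIV. p j k * G j l * h k) = - (\<Sum>j\<in>UNIV. G j l * v h j)" for l
    proof -
      have "(\<Sum>j\<in>UNIV. \<Sum>k\<in>UNIV. p j k * G j l * h k) = (\<Sum>j\<in>UNIV. G j l * (\<Sum>k\<in>UNIV. p j k * h k))"
        by (simp add: sum_distrib_left mult_ac)
      then show ?thesis by (simp add: v' sum_negf)
    qed
    have H_part: "(\<Sum>j\<in>UNIV. \<Sum>k\<in>UNIV. p j k * g j * H k l) = (\<Sum>k\<in>UNIV. H k l * v g k)" for l
      unfolding v_def sum_distrib_left
      by (rule trans[OF sum.swap], intro sum.cong refl) (simp only: mult_ac)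
    have "T f g h G H = (\<Sum>l\<in>UNIV. v f l * (\<Sum>j\<in>UNIV. \<Sum>k\<in>UNIV. d j k l * g j * h k + p j k * G j l * h k + p j k * g j * H k l))"
      unfolding T_def v_def sum_distrib_right by (rule sum.swap)
    also have "\<dots> = A f g h + (\<Sum>l\<in>UNIV. v f l * (\<Sum>j\<in>UNIV. \<Sum>k\<in>UNIV. p j k * G j l * h k))
        + (\<Sum>l\<in>UNIV. v f l * (\<Sum>j\<in>UNIV. \<Sum>k\<in>UNIV. p j k * g j * H k l))"
      by (simp add: sum.distrib distrib_left A_eq)
    finally show ?thesis
      unfolding G_part H_part by (simp add: B_def sum_distrib_left sum_negf mult_ac)
  qed
  have B_sym: "B S f g = B S g f" if "\<And>i j. S i j = S j i" for S f g
    unfolding B_def by (subst sum.swap) (simp add: that mult_ac)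
  have "A f g h + A g h f + A h f g = 0"
  proof -
    have "A g h f = (\<Sum>i\<in>UNIV. \<Sum>j\<in>UNIV. \<Sum>k\<in>UNIV. c j k i * (f i * g j * h k))"
      unfolding A_def by (subst sum_rotate, subst sum_rotate) (simp add: mult_ac)
    moreover have "A h f g = (\<Sum>i\<in>UNIV. \<Sum>j\<in>UNIV. \<Sum>k\<in>UNIV. c k i j * (f i * g j * h k))"
      unfolding A_def by (subst sum_rotate) (simp add: mult_ac)
    moreover have "c i j k * a + c j k i * a + c k i j * a = 0" for i j k a
      using jacobi[of i j k] by (simp add: c_def distrib_right[symmetric])
    ultimately show ?thesis
      by (simp add: A_def sum.distrib[symmetric])
  qed
  with B_sym[where S = F and f = g and g = h, OF sym(1)] B_sym[where S = G and f = h and g = f, OF sym(2)]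
    B_sym[where S = H and f = f and g = g, OF sym(3)] show ?thesis
    by (simp add: T_eq add.assoc)
qed

lemma cgrad_bracket:
  assumes "open U" "X \<in> U"
    and P: "\<And>j k. holomorphic_Cn_on (\<lambda>X. P X $ j $ k) U"
    and g: "holomorphic_Cn_on g U" and h: "holomorphic_Cn_on h U"
  shows "cgrad (bracket P g h) X $ l = (\<Sum>j\<in>UNIV. \<Sum>k\<in>UNIV.
      cgrad (\<lambda>X. P X $ j $ k) X $ l * cgrad g X $ j * cgrad h X $ k +
      P X $ j $ k * deriv (\<lambda>t. cgrad g (X + axis l t) $ j) 0 * cgrad h X $ k +
      P X $ j $ k * cgrad g X $ j * deriv (\<lambda>t. cgrad h (X + axis l t) $ k) 0)"
proof -
  have *: "((\<lambda>t. cgrad g (X + axis l t) $ j) has_field_derivative deriv (\<lambda>t. cgrad g (X + axis l t) $ j) 0) (at 0)"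
    if "holomorphic_Cn_on g U" for j and g :: "complex^'a \<Rightarrow> complex"
    using cgrad_has_field_derivative[OF that assms(1,2), of l j] by (simp add: DERIV_imp_deriv)
  have **: "((\<lambda>t. P (X + axis l t) $ j $ k) has_field_derivative cgrad (\<lambda>X. P X $ j $ k) X $ l) (at 0)" for j k
    using holomorphic_Cn_has_field_derivative[OF P, of X l 0] assms(2) by simp
  have "((\<lambda>t. bracket P g h (X + axis l t)) has_field_derivative (\<Sum>j\<in>UNIV. \<Sum>k\<in>UNIV.
      cgrad (\<lambda>X. P X $ j $ k) X $ l * cgrad g X $ j * cgrad h X $ k +
      P X $ j $ k * deriv (\<lambda>t. cgrad g (X + axis l t) $ j) 0 * cgrad h X $ k +
      P X $ j $ k * cgrad g X $ j * deriv (\<lambda>t. cgrad h (X + axis l t) $ k) 0)) (at 0)"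
    unfolding bracket_def
    by (intro DERIV_sum DERIV_cong[OF DERIV_mult[OF DERIV_mult[OF ** *[OF g]] *[OF h]]])
       (simp add: algebra_simps)
  then show ?thesis by (simp add: cgrad_def[of "bracket P g h"] DERIV_imp_deriv)
qed

text \<open>It suffices to check the Jacobi identity on coordinate functions, although the definition
  quantifies over all holomorphic triples.\<close>

lemma poisson_onI:
  fixes P :: "complex^'n \<Rightarrow> complex^'n^'n"
  assumes "open U"
    and P: "\<And>j k. holomorphic_Cn_on (\<lambda>X. P X $ j $ k) U"
    and antisym: "\<And>X i j. X \<in> U \<Longrightarrow> P X $ j $ i = - P X $ i $ j"
    and jacobi: "\<And>X i j k. X \<in> U \<Longrightarrow>
      (\<Sum>l\<in>UNIV. P X $ i $ l * cgrad (\<lambda>X. P X $ j $ k) X $ l)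
      + (\<Sum>l\<in>UNIV. P X $ j $ l * cgrad (\<lambda>X. P X $ k $ i) X $ l)
      + (\<Sum>l\<in>UNIV. P X $ k $ l * cgrad (\<lambda>X. P X $ i $ j) X $ l) = 0"
  shows "poisson_on U P"
  unfolding poisson_on_def
proof (intro conjI allI impI ballI)
  show "transpose (P X) = - P X" if "X \<in> U" for X
    unfolding vec_eq_iff transpose_def using that by (auto intro: antisym)
next
  fix f g h X
  assume hol: "holomorphic_Cn_on f U" "holomorphic_Cn_on g U" "holomorphic_Cn_on h U" and X: "X \<in> U"
  have sym: "deriv (\<lambda>t. cgrad f (X + axis l t) $ j) 0 = deriv (\<lambda>t. cgrad f (X + axis j t) $ l) 0"
    if "holomorphic_Cn_on f U" for f :: "complex^'n \<Rightarrow> complex" and j l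
    by (rule DERIV_imp_deriv[OF cgrad_has_field_derivative[OF that \<open>open U\<close> X]])
  note br = cgrad_bracket[OF \<open>open U\<close> X P]
  show "bracket P f (bracket P g h) X + bracket P g (bracket P h f) X + bracket P h (bracket P f g) X = 0"
    unfolding bracket_def[of P f "bracket P g h" X] bracket_def[of P g "bracket P h f" X] bracket_def[of P h "bracket P f g" X]
      br[OF hol(2,3)] br[OF hol(3,1)] br[OF hol(1,2)]
    by (rule jacobi_sum[OF antisym[OF X] sym[OF hol(1)] sym[OF hol(2)] sym[OF hol(3)] jacobi[OF X]])
qed (rule P)

section \<open>Complete elliptic integrals as functions of the parameter\<close>

text \<open>\<open>\<theta>'\<close> may blow up at the end points, as it does for \<open>arcsin\<close>; differentiability of the
  primitive in the interior, with continuity on the closed interval, is enough.\<close>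

lemma has_integral_substitution_interior:
  fixes h :: "real \<Rightarrow> complex"
  assumes "a \<le> b" and h: "continuous_on {c..d} h" and \<theta>: "continuous_on {a..b} \<theta>" "\<theta> ` {a..b} \<subseteq> {c..d}"
    and deriv: "\<And>t. t \<in> {a<..<b} \<Longrightarrow> (\<theta> has_real_derivative \<theta>' t) (at t)"
    and interior: "\<And>t. t \<in> {a<..<b} \<Longrightarrow> \<theta> t \<in> {c<..<d}"
  shows "((\<lambda>t. \<theta>' t *\<^sub>R h (\<theta> t)) has_integral (integral {c..\<theta> b} h - integral {c..\<theta> a} h)) {a..b}"
proof (rule fundamental_theorem_of_calculus_interior[OF \<open>a \<le> b\<close>])
  have "h integrable_on {c..d}" by (rule integrable_continuous_real[OF h])
  then have "continuous_on {c..d} (\<lambda>x. integral {c..x} h)"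
    by (rule indefinite_integral_continuous_1)
  then show "continuous_on {a..b} (\<lambda>t. integral {c..\<theta> t} h)"
    using \<theta> continuous_on_compose2 by blast
next
  fix t assume t: "t \<in> {a<..<b}"
  have "((\<lambda>x. integral {c..x} h) has_vector_derivative h (\<theta> t)) (at (\<theta> t) within {c..d})"
    using interior[OF t] by (intro integral_has_vector_derivative[OF h]) auto
  then have "((\<lambda>x. integral {c..x} h) has_vector_derivative h (\<theta> t)) (at (\<theta> t))"
    using interior[OF t] at_within_interior[of "\<theta> t" "{c..d}"] by simp
  moreover have "(\<theta> has_vector_derivative \<theta>' t) (at t)"
    using deriv[OF t] by (simp add: has_real_derivative_iff_has_vector_derivative)
  ultimately have "((\<lambda>x. integral {c..x} h) \<circ> \<theta> has_vector_derivative \<theta>' t *\<^sub>R h (\<theta> t)) (at t)"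
    by (intro vector_diff_chain_at)
  then show "((\<lambda>t. integral {c..\<theta> t} h) has_vector_derivative \<theta>' t *\<^sub>R h (\<theta> t)) (at t)"
    by (simp add: o_def)
qed

lemma has_field_derivative_param_integral:
  fixes f :: "complex \<Rightarrow> real \<Rightarrow> complex"
  assumes "open U" "m \<in> U"
    and deriv: "\<And>m t. m \<in> U \<Longrightarrow> t \<in> {a..b} \<Longrightarrow> ((\<lambda>m. f m t) has_field_derivative f' m t) (at m)"
    and f: "\<And>m. m \<in> U \<Longrightarrow> continuous_on {a..b} (f m)"
    and f': "continuous_on (U \<times> {a..b}) (\<lambda>(m, t). f' m t)"
  shows "((\<lambda>m. integral {a..b} (f m)) has_field_derivative integral {a..b} (f' m)) (at m)"
proof -
  obtain r where r: "0 < r" "ball m r \<subseteq> U" using assms(1,2) openE by blast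
  have "((\<lambda>m. integral (cbox a b) (f m)) has_field_derivative integral (cbox a b) (f' m)) (at m within ball m r)"
  proof (rule leibniz_rule_field_derivative)
    show "((\<lambda>m. f m t) has_field_derivative f' x t) (at x within ball m r)" if "x \<in> ball m r" "t \<in> cbox a b" for x t
      using that r by (intro has_field_derivative_at_within[OF deriv]) auto
    show "f x integrable_on cbox a b" if "x \<in> ball m r" for x
      unfolding cbox_interval using that r by (intro integrable_continuous_real f) auto
    show "continuous_on (ball m r \<times> cbox a b) (\<lambda>(m, t). f' m t)"
      using r(2) by (intro continuous_on_subset[OF f']) auto
  qed (use r in auto)
  then show ?thesis using r at_within_open[of m "ball m r"] by simp
qed

definition slit_plane :: "complex set" where
  "slit_plane = {m. \<not> (m \<in> \<real> \<and> 1 \<le> Re m)}"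

lemma open_slit_plane: "open slit_plane"
proof -
  have "open (- (\<real> \<inter> {m::complex. 1 \<le> Re m}))"
    by (intro open_Compl closed_Int closed_complex_Reals closed_halfspace_Re_ge)
  moreover have "- (\<real> \<inter> {m. 1 \<le> Re m}) = slit_plane" by (auto simp: slit_plane_def)
  ultimately show ?thesis by (rule subst[rotated])
qed

text \<open>This is what makes the principal root in \<open>\<Delta>\<close> holomorphic in the parameter for every
  point of the path of integration.\<close>

lemma slit_plane_radicand:
  assumes "m \<in> slit_plane" "0 \<le> s" "s \<le> (1::real)"
  shows "1 - m * of_real s \<notin> \<real>\<^sub>\<le>\<^sub>0"
proof
  assume "1 - m * of_real s \<in> \<real>\<^sub>\<le>\<^sub>0"
  then have *: "Im m * s = 0" "1 \<le> Re m * s" by (auto simp: complex_nonpos_Reals_iff)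
  then have "s \<noteq> 0" by auto
  with *(1) have "m \<in> \<real>" by (simp add: complex_is_Real_iff)
  moreover have "1 \<le> Re m"
  proof (rule ccontr)
    assume "\<not> 1 \<le> Re m"
    then have "Re m * s < 1"
      using assms mult_left_le[of s "Re m"] mult_nonpos_nonneg[of "Re m" s] by linarith
    with *(2) show False by simp
  qed
  ultimately show False using assms(1) by (simp add: slit_plane_def)
qed

text \<open>The classical \<open>\<Delta>(t)\<close>, as a function of the parameter \<open>m = k\<^sup>2\<close>. Both pairs of elliptic integrals
  are values of the same two functions \<open>K_par\<close>, \<open>E_par\<close>, at \<open>m = k\<^sup>2\<close> and at \<open>m = 1 - k\<^sup>2\<close>.\<close>

definition Delta :: "complex \<Rightarrow> real \<Rightarrow> complex" where
  "Delta m t = csqrt (1 - m * (sin (of_real t))\<^sup>2)"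

definition K_par :: "complex \<Rightarrow> complex" where
  "K_par m = integral {0..pi/2} (\<lambda>t. 1 / Delta m t)"

definition E_par :: "complex \<Rightarrow> complex" where
  "E_par m = integral {0..pi/2} (Delta m)"

lemma radicand_real: "1 - m * (sin (complex_of_real t))\<^sup>2 = 1 - m * of_real ((sin t)\<^sup>2)"
  by (simp add: sin_of_real)

lemma Delta_radicand:
  assumes "m \<in> slit_plane"
  shows "1 - m * (sin (complex_of_real t))\<^sup>2 \<notin> \<real>\<^sub>\<le>\<^sub>0"
  unfolding radicand_real using assms by (intro slit_plane_radicand) (auto simp: abs_square_le_1)

lemma Delta_nonzero:
  assumes "m \<in> slit_plane"
  shows "Delta m t \<noteq> 0"
  using Delta_radicand[OF assms, of t] by (auto simp: Delta_def)

lemma Delta_square: "(Delta m t)\<^sup>2 = 1 - m * (sin (of_real t))\<^sup>2"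
  by (simp add: Delta_def)

lemma continuous_on_Delta:
  "continuous_on (slit_plane \<times> S) (\<lambda>(m, t). Delta m t)"
  unfolding Delta_def split_beta using Delta_radicand
  by (auto intro!: continuous_intros continuous_on_compose2[OF continuous_on_csqrt])

lemma continuous_on_Delta_pair [continuous_intros]:
  "continuous_on S f \<Longrightarrow> continuous_on S g \<Longrightarrow> (\<And>x. x \<in> S \<Longrightarrow> f x \<in> slit_plane) \<Longrightarrow>
     continuous_on S (\<lambda>x. Delta (f x) (g x))"
  using continuous_on_compose2[OF continuous_on_Delta[of UNIV], of S "\<lambda>x. (f x, g x)"]
  by (auto intro: continuous_on_Pair simp: image_subset_iff)

lemma has_field_derivative_Delta:
  assumes "m \<in> slit_plane"
  shows "((\<lambda>m. Delta m t) has_field_derivative - (sin (of_real t))\<^sup>2 / (2 * Delta m t)) (at m)"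
  unfolding Delta_def using Delta_radicand[OF assms, of t]
  by (auto intro!: derivative_eq_intros simp: field_simps)

lemma K_par_has_field_derivative:
  assumes m: "m \<in> slit_plane"
  shows "(K_par has_field_derivative integral {0..pi/2} (\<lambda>t. (sin (of_real t))\<^sup>2 / (2 * Delta m t ^ 3))) (at m)"
  unfolding K_par_def
proof (rule has_field_derivative_param_integral[OF open_slit_plane m])
  show "((\<lambda>m. 1 / Delta m t) has_field_derivative (sin (of_real t))\<^sup>2 / (2 * Delta m t ^ 3)) (at m)"
    if "m \<in> slit_plane" for m t
    using Delta_nonzero[OF that, of t]
    by (auto intro!: derivative_eq_intros has_field_derivative_Delta[OF that] simp: field_simps power3_eq_cube)
qed (auto intro!: continuous_intros simp: split_beta Delta_nonzero)

lemma E_par_has_field_derivative: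
  assumes m: "m \<in> slit_plane"
  shows "(E_par has_field_derivative integral {0..pi/2} (\<lambda>t. - (sin (of_real t))\<^sup>2 / (2 * Delta m t))) (at m)"
  unfolding E_par_def
proof (rule has_field_derivative_param_integral[OF open_slit_plane m])
  show "((\<lambda>m. Delta m t) has_field_derivative - (sin (of_real t))\<^sup>2 / (2 * Delta m t)) (at m)"
    if "m \<in> slit_plane" for m t
    by (rule has_field_derivative_Delta[OF that])
qed (auto intro!: continuous_intros simp: split_beta Delta_nonzero)

lemma Delta_integrable:
  assumes m: "m \<in> slit_plane"
  shows "(\<lambda>t. 1 / Delta m t ^ n) integrable_on {0..pi/2}" "Delta m integrable_on {0..pi/2}"
    "(\<lambda>t. (sin (of_real t))\<^sup>2 / (2 * Delta m t ^ n)) integrable_on {0..pi/2}"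
  using m by (auto intro!: integrable_continuous_real continuous_intros simp: Delta_nonzero)

text \<open>Under the integral, \<open>- m sin\<^sup>2 t = \<Delta>\<^sup>2 - 1\<close>.\<close>

lemma E_par_ode:
  assumes m: "m \<in> slit_plane"
  shows "2 * m * deriv E_par m = E_par m - K_par m"
proof -
  have "2 * m * deriv E_par m = integral {0..pi/2} (\<lambda>t. 2 * m * (- (sin (of_real t))\<^sup>2 / (2 * Delta m t)))"
    by (simp only: DERIV_imp_deriv[OF E_par_has_field_derivative[OF m]] integral_mult_right)
  also have "\<dots> = integral {0..pi/2} (\<lambda>t. Delta m t - 1 / Delta m t ^ 1)"
  proof (intro integral_cong)
    fix t
    have "2 * m * (- (sin (of_real t))\<^sup>2 / (2 * Delta m t)) = ((Delta m t)\<^sup>2 - 1) / Delta m t"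
      by (simp add: Delta_square)
    then show "2 * m * (- (sin (of_real t))\<^sup>2 / (2 * Delta m t)) = Delta m t - 1 / Delta m t ^ 1"
      using Delta_nonzero[OF m, of t] by (simp add: field_simps power2_eq_square)
  qed
  also have "\<dots> = E_par m - K_par m"
    using Delta_integrable(2)[OF m] Delta_integrable(1)[OF m, of 1]
    by (subst integral_diff) (auto simp: E_par_def K_par_def)
  finally show ?thesis .
qed

text \<open>\<open>m sin t cos t / \<Delta>\<close> has the derivative \<open>\<Delta> - (1 - m) / \<Delta>\<^sup>3\<close> and vanishes at both end
  points. This is the one integration by parts behind the differential equation of \<open>K\<close>.\<close>

lemma integral_inverse_Delta_cubed:
  assumes m: "m \<in> slit_plane"
  shows "(1 - m) * integral {0..pi/2} (\<lambda>t. 1 / Delta m t ^ 3) = E_par m"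
proof -
  define F where "F z = m * (sin z * cos z / csqrt (1 - m * (sin z)\<^sup>2))" for z
  have "((\<lambda>t. Delta m t - (1 - m) * (1 / Delta m t ^ 3)) has_integral F (of_real (pi/2)) - F (of_real 0)) {0..pi/2}"
  proof (rule fundamental_theorem_of_calculus)
    fix t :: real
    define s c where "s = sin (complex_of_real t)" and "c = cos (complex_of_real t)"
    define R where "R = csqrt (1 - m * s\<^sup>2)"
    have nz: "1 - m * s\<^sup>2 \<notin> \<real>\<^sub>\<le>\<^sub>0" using Delta_radicand[OF m] by (simp add: s_def)
    then have R: "R \<noteq> 0" "R ^ 2 = 1 - m * s\<^sup>2" by (auto simp: R_def)
    have c: "c\<^sup>2 = 1 - s\<^sup>2" by (simp add: s_def c_def cos_squared_eq)
    have dS: "(sin has_field_derivative c) (at (of_real t))"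
      and dC: "(cos has_field_derivative - s) (at (of_real t))"
      by (auto simp: s_def c_def intro!: derivative_eq_intros)
    have dR: "((\<lambda>z. csqrt (1 - m * (sin z)\<^sup>2)) has_field_derivative - (m * (2 * s * c)) / (2 * R)) (at (of_real t))"
      using nz by (auto intro!: derivative_eq_intros simp: s_def c_def R_def)
    have "(F has_field_derivative m * (((c * c - s * s) * R - (s * c) * (- (m * (2 * s * c)) / (2 * R))) / R\<^sup>2)) (at (of_real t))"
      unfolding F_def
    proof (rule DERIV_cong[OF DERIV_cmult[OF DERIV_divide[OF DERIV_mult[OF dS dC] dR]]])
      show "csqrt (1 - m * (sin (complex_of_real t))\<^sup>2) \<noteq> 0"
        using R(1) by (simp add: R_def s_def)
    qed (simp only: s_def[symmetric] c_def[symmetric] R_def[symmetric], simp add: power2_eq_square)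
    moreover have "m * (((c * c - s * s) * R - (s * c) * (- (m * (2 * s * c)) / (2 * R))) / R\<^sup>2) = R - (1 - m) * (1 / R ^ 3)"
    proof -
      have "m * (((c * c - s * s) * R - (s * c) * (- (m * (2 * s * c)) / (2 * R))) / R\<^sup>2)
          = (m * ((c\<^sup>2 - s\<^sup>2) * R\<^sup>2 + m * s\<^sup>2 * c\<^sup>2)) / R ^ 3"
        using R(1) by (simp add: field_simps power2_eq_square power3_eq_cube)
      also have "m * ((c\<^sup>2 - s\<^sup>2) * R\<^sup>2 + m * s\<^sup>2 * c\<^sup>2) = (R\<^sup>2)\<^sup>2 - (1 - m)"
        unfolding c R(2) by algebra
      also have "((R\<^sup>2)\<^sup>2 - (1 - m)) / R ^ 3 = R - (1 - m) * (1 / R ^ 3)"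
        using R(1) by (simp add: field_simps eval_nat_numeral)
      finally show ?thesis .
    qed
    ultimately have "(F has_field_derivative Delta m t - (1 - m) * (1 / Delta m t ^ 3)) (at (of_real t))"
      by (simp add: R_def s_def Delta_def)
    then show "((\<lambda>t. F (of_real t)) has_vector_derivative Delta m t - (1 - m) * (1 / Delta m t ^ 3)) (at t within {0..pi/2})"
      by (rule has_vector_derivative_real_field)
  qed simp
  moreover have "F (of_real (pi/2)) = 0" "F (of_real 0) = 0"
    by (simp_all only: F_def sin_of_real cos_of_real) simp_all
  ultimately have "((\<lambda>t. Delta m t - (1 - m) * (1 / Delta m t ^ 3)) has_integral 0) {0..pi/2}"
    by simp
  moreover have "((\<lambda>t. Delta m t - (1 - m) * (1 / Delta m t ^ 3)) has_integral
      (E_par m - (1 - m) * integral {0..pi/2} (\<lambda>t. 1 / Delta m t ^ 3))) {0..pi/2}"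
    unfolding E_par_def
    by (intro has_integral_diff has_integral_mult_right integrable_integral Delta_integrable[OF m])
  ultimately have "0 = E_par m - (1 - m) * integral {0..pi/2} (\<lambda>t. 1 / Delta m t ^ 3)"
    by (rule has_integral_unique)
  then show ?thesis by simp
qed

lemma K_par_ode:
  assumes m: "m \<in> slit_plane"
  shows "2 * m * (1 - m) * deriv K_par m = E_par m - (1 - m) * K_par m"
proof -
  have "2 * m * deriv K_par m = integral {0..pi/2} (\<lambda>t. 2 * m * ((sin (of_real t))\<^sup>2 / (2 * Delta m t ^ 3)))"
    by (simp only: DERIV_imp_deriv[OF K_par_has_field_derivative[OF m]] integral_mult_right)
  also have "\<dots> = integral {0..pi/2} (\<lambda>t. 1 / Delta m t ^ 3 - 1 / Delta m t ^ 1)"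
  proof (intro integral_cong)
    fix t
    have "2 * m * ((sin (of_real t))\<^sup>2 / (2 * Delta m t ^ 3)) = (1 - (Delta m t)\<^sup>2) / Delta m t ^ 3"
      by (simp add: Delta_square)
    then show "2 * m * ((sin (of_real t))\<^sup>2 / (2 * Delta m t ^ 3)) = 1 / Delta m t ^ 3 - 1 / Delta m t ^ 1"
      using Delta_nonzero[OF m, of t] by (simp add: field_simps power2_eq_square power3_eq_cube)
  qed
  also have "\<dots> = integral {0..pi/2} (\<lambda>t. 1 / Delta m t ^ 3) - K_par m"
    using Delta_integrable(1)[OF m, of 3] Delta_integrable(1)[OF m, of 1] by (subst integral_diff) (auto simp: K_par_def)
  finally have *: "2 * m * deriv K_par m = integral {0..pi/2} (\<lambda>t. 1 / Delta m t ^ 3) - K_par m" .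
  have "2 * m * (1 - m) * deriv K_par m = (1 - m) * (2 * m * deriv K_par m)"
    by (simp add: algebra_simps)
  also have "\<dots> = E_par m - (1 - m) * K_par m"
    unfolding * integral_inverse_Delta_cubed[OF m, symmetric] by (simp add: right_diff_distrib)
  finally show ?thesis .
qed

section \<open>The defining integrals in trigonometric form\<close>

lemma csqrt_of_real_mult:
  assumes "0 \<le> r"
  shows "csqrt (of_real r * z) = of_real (sqrt r) * csqrt z"
proof (rule csqrt_unique)
  show "(of_real (sqrt r) * csqrt z)\<^sup>2 = of_real r * z"
    using assms by (simp add: power_mult_distrib flip: of_real_power)
  show "0 < Re (of_real (sqrt r) * csqrt z) \<or> Re (of_real (sqrt r) * csqrt z) = 0 \<and> 0 \<le> Im (of_real (sqrt r) * csqrt z)"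
    using assms csqrt_principal[of z] by (cases "r = 0") (auto simp: zero_less_mult_iff)
qed

lemma Re_csqrt_pos:
  assumes "z \<notin> \<real>\<^sub>\<le>\<^sub>0"
  shows "0 < Re (csqrt z)"
proof (rule ccontr)
  assume "\<not> 0 < Re (csqrt z)"
  then have "Re (csqrt z) = 0" using Re_csqrt[of z] by simp
  then have "(csqrt z)\<^sup>2 = - of_real ((Im (csqrt z))\<^sup>2)"
    by (simp add: complex_eq_iff power2_eq_square)
  then have "z = - of_real ((Im (csqrt z))\<^sup>2)" by simp
  then have "Im z = 0 \<and> Re z \<le> 0"
    by (metis Re_complex_of_real Im_complex_of_real uminus_complex.simps neg_le_0_iff_le neg_equal_0_iff_equal zero_le_power2)
  with assms show False by (simp add: complex_nonpos_Reals_iff)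
qed

lemma has_integral_arcsin:
  fixes h :: "real \<Rightarrow> complex"
  assumes "continuous_on {0..pi/2} h"
  shows "((\<lambda>t. inverse (sqrt (1 - t\<^sup>2)) *\<^sub>R h (arcsin t)) has_integral integral {0..pi/2} h) {0..1}"
proof -
  have 1: "arcsin t \<in> {0<..<pi/2}" if "t \<in> {0<..<1}" for t
    using that arcsin_less_arcsin[of 0 t] arcsin_less_arcsin[of t 1] by auto
  have 2: "arcsin t \<in> {0..pi/2}" if "t \<in> {0..1}" for t
    using that arcsin_le_arcsin[of 0 t] arcsin_le_arcsin[of t 1] by auto
  have "((\<lambda>t. inverse (sqrt (1 - t\<^sup>2)) *\<^sub>R h (arcsin t)) has_integral integral {0..arcsin 1} h - integral {0..arcsin 0} h) {0..1}"
    using 1 2 by (intro has_integral_substitution_interior[OF _ assms] DERIV_arcsin) (auto intro!: continuous_intros)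
  then show ?thesis by simp
qed

text \<open>The substitution \<open>t = sin\<^sup>2 \<theta>\<close> removes the end point singularities of integrals with weight
  \<open>1 / sqrt (t (1 - t))\<close>.\<close>

lemma has_integral_arcsin_sqrt:
  fixes h :: "real \<Rightarrow> complex"
  assumes "continuous_on {0..pi/2} h"
  shows "((\<lambda>t. inverse (2 * sqrt (t * (1 - t))) *\<^sub>R h (arcsin (sqrt t))) has_integral integral {0..pi/2} h) {0..1}"
proof -
  have 1: "arcsin (sqrt t) \<in> {0<..<pi/2}" if "t \<in> {0<..<1}" for t
    using that arcsin_less_arcsin[of 0 "sqrt t"] arcsin_less_arcsin[of "sqrt t" 1]
      order_trans[of "-1" 0 "sqrt t"] by auto
  have 2: "arcsin (sqrt t) \<in> {0..pi/2}" if "t \<in> {0..1}" for t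
    using that arcsin_le_arcsin[of 0 "sqrt t"] arcsin_le_arcsin[of "sqrt t" 1]
      order_trans[of "-1" 0 "sqrt t"] by auto
  have "((\<lambda>t. inverse (2 * sqrt (t * (1 - t))) *\<^sub>R h (arcsin (sqrt t))) has_integral integral {0..arcsin (sqrt 1)} h - integral {0..arcsin (sqrt 0)} h) {0..1}"
  proof (intro has_integral_substitution_interior[OF _ assms])
    fix t :: real assume t: "t \<in> {0<..<1}"
    have "((\<lambda>t. arcsin (sqrt t)) has_real_derivative inverse (sqrt (1 - (sqrt t)\<^sup>2)) * (inverse (sqrt t) / 2)) (at t)"
      using t by (intro DERIV_chain2[OF DERIV_arcsin] DERIV_real_sqrt) (auto intro: less_le_trans[of "-1" 0])
    then show "((\<lambda>t. arcsin (sqrt t)) has_real_derivative inverse (2 * sqrt (t * (1 - t)))) (at t)"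
      by (rule DERIV_cong) (use t in \<open>simp add: real_sqrt_mult\<close>)
  qed (use 1 2 in \<open>auto intro!: continuous_intros intro: order_trans[of "-1" 0]\<close>)
  then show ?thesis by simp
qed

lemma continuous_on_Delta_param [continuous_intros]:
  "m \<in> slit_plane \<Longrightarrow> continuous_on S (Delta m)"
  by (auto intro!: continuous_intros)

lemma Delta_arcsin:
  assumes "0 \<le> t" "t \<le> 1"
  shows "Delta m (arcsin t) = csqrt (1 - m * (of_real t)\<^sup>2)"
  using assms by (simp add: Delta_def sin_of_real)

text \<open>Along the segment \<open>w = sin t\<close> is real, and the non-negative real factor \<open>1 - w\<^sup>2\<close> may be taken
  out of the principal root.\<close>

lemma ellipticK_eq_K_par:
  assumes "k\<^sup>2 \<in> slit_plane"
  shows "ellipticK k = K_par (k\<^sup>2)"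
proof -
  have "((\<lambda>t. inverse (sqrt (1 - t\<^sup>2)) *\<^sub>R (1 / Delta (k\<^sup>2) (arcsin t))) has_integral K_par (k\<^sup>2)) {0..1}"
    unfolding K_par_def using assms
    by (intro has_integral_arcsin continuous_intros) (auto simp: Delta_nonzero)
  moreover have "inverse (sqrt (1 - t\<^sup>2)) *\<^sub>R (1 / Delta (k\<^sup>2) (arcsin t)) =
      1 / csqrt ((1 - (of_real t)\<^sup>2) * (1 - k\<^sup>2 * (of_real t)\<^sup>2))" if "t \<in> {0..1}" for t
  proof -
    have "csqrt ((1 - (of_real t)\<^sup>2) * (1 - k\<^sup>2 * (of_real t)\<^sup>2)) =
        csqrt (of_real (1 - t\<^sup>2) * (1 - k\<^sup>2 * (of_real t)\<^sup>2))"
      by simp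
    also have "\<dots> = of_real (sqrt (1 - t\<^sup>2)) * Delta (k\<^sup>2) (arcsin t)"
      using that by (subst csqrt_of_real_mult) (auto simp: Delta_arcsin abs_square_le_1)
    finally show ?thesis by (simp add: scaleR_conv_of_real field_simps)
  qed
  ultimately have "((\<lambda>t. 1 / csqrt ((1 - (of_real t)\<^sup>2) * (1 - k\<^sup>2 * (of_real t)\<^sup>2))) has_integral K_par (k\<^sup>2)) {0..1}"
    by (rule has_integral_eq[rotated])
  then show ?thesis
    by (simp add: ellipticK_def contour_integral_integral linepath_of_real[of 0 1, simplified] integral_unique vector_derivative_linepath_at)
qed

lemma ellipticE_integral_eq_E_par:
  assumes "m \<in> slit_plane"
  shows "contour_integral (linepath 0 1) (\<lambda>w. csqrt ((1 - m * w\<^sup>2) / (1 - w\<^sup>2))) = E_par m"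
proof -
  have "((\<lambda>t. inverse (sqrt (1 - t\<^sup>2)) *\<^sub>R Delta m (arcsin t)) has_integral E_par m) {0..1}"
    unfolding E_par_def using assms by (intro has_integral_arcsin continuous_intros)
  moreover have "inverse (sqrt (1 - t\<^sup>2)) *\<^sub>R Delta m (arcsin t) =
      csqrt ((1 - m * (of_real t)\<^sup>2) / (1 - (of_real t)\<^sup>2))" if "t \<in> {0..1}" for t
  proof -
    have "csqrt ((1 - m * (of_real t)\<^sup>2) / (1 - (of_real t)\<^sup>2)) =
        csqrt (of_real (inverse (1 - t\<^sup>2)) * (1 - m * (of_real t)\<^sup>2))"
      by (simp add: field_simps)
    also have "\<dots> = of_real (sqrt (inverse (1 - t\<^sup>2))) * Delta m (arcsin t)"
      using that by (subst csqrt_of_real_mult) (auto simp: Delta_arcsin abs_square_le_1)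
    finally show ?thesis by (simp add: scaleR_conv_of_real real_sqrt_inverse)
  qed
  ultimately have "((\<lambda>t. csqrt ((1 - m * (of_real t)\<^sup>2) / (1 - (of_real t)\<^sup>2))) has_integral E_par m) {0..1}"
    by (rule has_integral_eq[rotated])
  then show ?thesis
    by (simp add: contour_integral_integral linepath_of_real[of 0 1, simplified] integral_unique vector_derivative_linepath_at)
qed

lemma ellipticE_eq_E_par: "k\<^sup>2 \<in> slit_plane \<Longrightarrow> ellipticE k = E_par (k\<^sup>2)"
  unfolding ellipticE_def by (rule ellipticE_integral_eq_E_par)

lemma ellipticE'_eq_E_par: "1 - k\<^sup>2 \<in> slit_plane \<Longrightarrow> ellipticE' k = E_par (1 - k\<^sup>2)"
  unfolding ellipticE'_def by (rule ellipticE_integral_eq_E_par)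

definition strip :: "complex set" where
  "strip = {k. 0 < Re k \<and> Re k < 1}"

text \<open>For a complex \<open>k\<close> the factor \<open>(1 - k)\<^sup>2\<close> can be taken out of the principal root only if the
  arguments do not add up beyond \<open>\<pi>\<close>. On the strip \<open>Im q\<close> is a positive multiple of \<open>Im k\<close>, so \<open>1 - k\<close>
  and \<open>csqrt q\<close> have arguments of opposite sign and their product stays in the right half plane.\<close>

lemma csqrt_radicand_strip:
  assumes k: "k \<in> strip" and s: "0 \<le> s" "s \<le> (1::real)"
  defines "w \<equiv> k + of_real s * (1 - k)"
  defines "q \<equiv> (1 + w) * (w + k)"
  shows "q \<notin> \<real>\<^sub>\<le>\<^sub>0" and "csqrt ((1 - k)\<^sup>2 * q) = (1 - k) * csqrt q"
proof -
  have Re_k: "0 < Re k" "Re k < 1" using k by (auto simp: strip_def)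
  have Re_w: "0 < Re w"
    using Re_k s by (cases "s = 0") (auto simp: w_def intro!: add_pos_nonneg)
  have Im_w: "Im w = (1 - s) * Im k" by (simp add: w_def algebra_simps)
  define c where "c = (1 - s) * Re (w + k) + (2 - s) * Re (1 + w)"
  have c: "c > 0"
    using Re_w Re_k s unfolding c_def by (intro add_nonneg_pos mult_pos_pos mult_nonneg_nonneg) auto
  have Im_q: "Im q = c * Im k"
    by (simp add: q_def c_def Im_w algebra_simps)
  show q: "q \<notin> \<real>\<^sub>\<le>\<^sub>0"
  proof
    assume "q \<in> \<real>\<^sub>\<le>\<^sub>0"
    then have "Im q = 0" "Re q \<le> 0" by (auto simp: complex_nonpos_Reals_iff)
    then have "Im k = 0" using Im_q c by simp
    then have "Re q = (1 + Re w) * (Re w + Re k)" by (simp add: q_def Im_w)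
    also have "\<dots> > 0" using Re_w Re_k by (intro mult_pos_pos) auto
    finally show False using \<open>Re q \<le> 0\<close> by simp
  qed
  have Re_r: "0 < Re (csqrt q)"
    by (rule Re_csqrt_pos[OF q])
  have "2 * Re (csqrt q) * Im (csqrt q) = Im q"
    by (metis Im_power2 power2_csqrt)
  then have "(2 * Re (csqrt q)) * (Im k * Im (csqrt q)) = c * (Im k)\<^sup>2"
    using Im_q by (simp add: power2_eq_square algebra_simps)
  with c have "0 \<le> (2 * Re (csqrt q)) * (Im k * Im (csqrt q))" by simp
  with Re_r have "0 \<le> Im k * Im (csqrt q)"
    by (simp add: zero_le_mult_iff)
  show "csqrt ((1 - k)\<^sup>2 * q) = (1 - k) * csqrt q"
  proof (rule csqrt_unique)
    show "((1 - k) * csqrt q)\<^sup>2 = (1 - k)\<^sup>2 * q" by (simp add: power_mult_distrib)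
    have "0 < (1 - Re k) * Re (csqrt q)" using Re_k Re_r by simp
    with \<open>0 \<le> Im k * Im (csqrt q)\<close>
    show "0 < Re ((1 - k) * csqrt q) \<or> Re ((1 - k) * csqrt q) = 0 \<and> 0 \<le> Im ((1 - k) * csqrt q)"
      by simp
  qed
qed

text \<open>The factor \<open>(1 + w) (w + k)\<close> of the radicand of \<open>K'\<close> at \<open>w = k + (1 - k) sin\<^sup>2 t\<close>. The root of the
  other factor \<open>(1 - w) (w - k)\<close> is cancelled by \<open>dw / dt\<close> up to the constant 2.\<close>

definition Kc_radicand :: "complex \<Rightarrow> real \<Rightarrow> complex" where
  "Kc_radicand k t = (1 + (k + of_real ((sin t)\<^sup>2) * (1 - k))) * ((k + of_real ((sin t)\<^sup>2) * (1 - k)) + k)"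

lemma strip_eq: "strip = {k. 0 < Re k} \<inter> {k. Re k < 1}"
  by (auto simp: strip_def)

lemma open_strip: "open strip"
  unfolding strip_eq by (intro open_Int open_halfspace_Re_gt open_halfspace_Re_lt)

lemma convex_strip: "convex strip"
  unfolding strip_eq by (intro convex_Int convex_halfspace_Re_gt convex_halfspace_Re_lt)

lemma Kc_radicand_strip: "k \<in> strip \<Longrightarrow> Kc_radicand k t \<notin> \<real>\<^sub>\<le>\<^sub>0"
  unfolding Kc_radicand_def by (rule csqrt_radicand_strip) (auto simp: abs_square_le_1)

lemma continuous_on_Kc_radicand [continuous_intros]:
  fixes S :: "'a::t2_space set"
  shows "continuous_on S f \<Longrightarrow> continuous_on S g \<Longrightarrow> (\<And>x. x \<in> S \<Longrightarrow> f x \<in> strip) \<Longrightarrow>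
     continuous_on S (\<lambda>x. csqrt (Kc_radicand (f x) (g x)))"
  using Kc_radicand_strip
  by (intro continuous_on_compose2[OF continuous_on_csqrt, of S "\<lambda>x. Kc_radicand (f x) (g x)"])
     (auto simp: Kc_radicand_def intro!: continuous_intros)

lemma Kc_radicand_nonzero: "k \<in> strip \<Longrightarrow> Kc_radicand k t \<noteq> 0"
  using Kc_radicand_strip[of k t] by auto

lemma ellipticK'_eq_trigonometric:
  assumes k: "k \<in> strip"
  shows "ellipticK' k = integral {0..pi/2} (\<lambda>t. 2 / csqrt (Kc_radicand k t))"
proof -
  have "((\<lambda>t. inverse (2 * sqrt (t * (1 - t))) *\<^sub>R (2 / csqrt (Kc_radicand k (arcsin (sqrt t))))) has_integral
      integral {0..pi/2} (\<lambda>t. 2 / csqrt (Kc_radicand k t))) {0..1}"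
    using k by (intro has_integral_arcsin_sqrt continuous_intros) (auto simp: Kc_radicand_nonzero)
  moreover have "inverse (2 * sqrt (t * (1 - t))) *\<^sub>R (2 / csqrt (Kc_radicand k (arcsin (sqrt t)))) =
      1 / csqrt ((1 - (linepath k 1 t)\<^sup>2) * ((linepath k 1 t)\<^sup>2 - k\<^sup>2)) * (1 - k)" if t: "t \<in> {0..1}" for t
  proof -
    define w where "w = k + of_real t * (1 - k)"
    define q where "q = (1 + w) * (w + k)"
    have w: "linepath k 1 t = w" by (simp add: linepath_def w_def scaleR_conv_of_real algebra_simps)
    have q: "Kc_radicand k (arcsin (sqrt t)) = q"
      using t order_trans[of "-1" 0 "sqrt t"] by (simp add: Kc_radicand_def q_def w_def)
    have "(1 - w\<^sup>2) * (w\<^sup>2 - k\<^sup>2) = of_real (t * (1 - t)) * ((1 - k)\<^sup>2 * q)"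
      unfolding q_def w_def by (simp add: power2_eq_square algebra_simps)
    then have "csqrt ((1 - w\<^sup>2) * (w\<^sup>2 - k\<^sup>2)) = of_real (sqrt (t * (1 - t))) * csqrt ((1 - k)\<^sup>2 * q)"
      using t csqrt_of_real_mult[of "t * (1 - t)" "(1 - k)\<^sup>2 * q"] by simp
    also have "csqrt ((1 - k)\<^sup>2 * q) = (1 - k) * csqrt q"
      unfolding q_def w_def using t by (intro csqrt_radicand_strip(2)[OF k]) auto
    finally have eq: "csqrt ((1 - w\<^sup>2) * (w\<^sup>2 - k\<^sup>2)) = of_real (sqrt (t * (1 - t))) * ((1 - k) * csqrt q)" .
    have "k \<noteq> 1" using k by (auto simp: strip_def)
    then show ?thesis
      unfolding w q eq by (simp add: scaleR_conv_of_real) (simp add: divide_inverse)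
  qed
  ultimately have "((\<lambda>t. 1 / csqrt ((1 - (linepath k 1 t)\<^sup>2) * ((linepath k 1 t)\<^sup>2 - k\<^sup>2)) * (1 - k)) has_integral
      integral {0..pi/2} (\<lambda>t. 2 / csqrt (Kc_radicand k t))) {0..1}"
    by (rule has_integral_eq[rotated])
  then show ?thesis
    by (simp add: ellipticK'_def contour_integral_integral integral_unique vector_derivative_linepath_at)
qed

text \<open>The integrand depends holomorphically on \<open>k\<close> once the path of integration has been straightened
  to the fixed interval \<open>[0, \<pi>/2]\<close>.\<close>

lemma ellipticK'_holomorphic: "ellipticK' holomorphic_on strip"
proof -
  define q' :: "complex \<Rightarrow> real \<Rightarrow> complex" where "q' k t = (1 - of_real ((sin t)\<^sup>2)) * ((k + of_real ((sin t)\<^sup>2) * (1 - k)) + k)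
      + (1 + (k + of_real ((sin t)\<^sup>2) * (1 - k))) * (2 - of_real ((sin t)\<^sup>2))" for k t
  have "((\<lambda>k. integral {0..pi/2} (\<lambda>t. 2 / csqrt (Kc_radicand k t))) has_field_derivative
      integral {0..pi/2} (\<lambda>t. - q' k t / csqrt (Kc_radicand k t) ^ 3)) (at k)" if k: "k \<in> strip" for k
  proof (rule has_field_derivative_param_integral[OF open_strip k])
    fix k t assume k: "k \<in> strip"
    have "((\<lambda>k. Kc_radicand k t) has_field_derivative q' k t) (at k)"
      unfolding Kc_radicand_def q'_def by (auto intro!: derivative_eq_intros simp: algebra_simps)
    from has_field_derivative_csqrt'[OF this Kc_radicand_strip[OF k]]
    have *: "((\<lambda>k. csqrt (Kc_radicand k t)) has_field_derivative q' k t / (2 * csqrt (Kc_radicand k t))) (at k)" .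
    show "((\<lambda>k. 2 / csqrt (Kc_radicand k t)) has_field_derivative - q' k t / csqrt (Kc_radicand k t) ^ 3) (at k)"
      by (rule DERIV_cong[OF DERIV_divide[OF DERIV_const *]])
         (use Kc_radicand_nonzero[OF k, of t] in \<open>auto simp: field_simps power3_eq_cube\<close>)
  qed (auto intro!: continuous_intros simp: split_beta Kc_radicand_nonzero q'_def)
  then have "(\<lambda>k. integral {0..pi/2} (\<lambda>t. 2 / csqrt (Kc_radicand k t))) holomorphic_on strip"
    using open_strip by (auto simp: holomorphic_on_open)
  then show ?thesis
    by (rule holomorphic_transform) (simp add: ellipticK'_eq_trigonometric)
qed

text \<open>For real \<open>k\<close> the substitution \<open>w\<^sup>2 = 1 - (1 - k\<^sup>2) sin\<^sup>2 \<theta>\<close> runs through the segment from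
  \<open>k\<close> to 1 backwards and turns the integral into \<open>K_par (1 - k\<^sup>2)\<close>. For complex \<open>k\<close> it would leave the
  segment.\<close>

lemma ellipticK'_real:
  assumes k: "0 < k" "k < (1::real)"
  shows "ellipticK' (of_real k) = K_par (1 - (of_real k)\<^sup>2)"
proof -
  define m where "m = 1 - k\<^sup>2"
  have k2: "0 < k\<^sup>2" "k\<^sup>2 < 1" using k by (auto simp: abs_square_less_1)
  have m: "0 < m" "m < 1" using k2 by (auto simp: m_def)
  have slit: "complex_of_real m \<in> slit_plane" using m by (simp add: slit_plane_def)
  define h where "h = (\<lambda>t. 1 / Delta (of_real m) t)"
  define w where "w t = k + t * (1 - k)" for t
  \<comment> \<open>\<open>\<theta>\<close> decreases from \<open>\<pi>/2\<close> to 0, which accounts for the sign of the result.\<close>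
  define \<theta> where "\<theta> t = arcsin (sqrt ((1 - (w t)\<^sup>2) / m))" for t
  define \<theta>' where "\<theta>' t = - (1 - k) * w t / sqrt ((1 - (w t)\<^sup>2) * ((w t)\<^sup>2 - k\<^sup>2))" for t
  have w_bounds: "k \<le> w t" "w t \<le> 1" if "t \<in> {0..1}" for t
  proof -
    show "k \<le> w t" using that k by (simp add: w_def)
    have "t * (1 - k) \<le> 1 * (1 - k)" using that k by (intro mult_right_mono) auto
    then show "w t \<le> 1" by (simp add: w_def)
  qed
  have r_bounds: "0 \<le> (1 - (w t)\<^sup>2) / m" "(1 - (w t)\<^sup>2) / m \<le> 1" if "t \<in> {0..1}" for t
    using w_bounds[OF that] k m power_mono[of k "w t" 2] by (auto simp: m_def abs_square_le_1 field_simps)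
  have w_strict: "k < w t" "w t < 1" if "t \<in> {0<..<1}" for t
  proof -
    show "k < w t" using that k by (simp add: w_def)
    have "t * (1 - k) < 1 * (1 - k)" using that k by (intro mult_strict_right_mono) auto
    then show "w t < 1" by (simp add: w_def)
  qed
  have r_strict: "0 < (1 - (w t)\<^sup>2) / m" "(1 - (w t)\<^sup>2) / m < 1" if "t \<in> {0<..<1}" for t
    using w_strict[OF that] k m power_strict_mono[of k "w t" 2] power_strict_mono[of "w t" 1 2] by (auto simp: m_def field_simps)
  have subst: "((\<lambda>t. \<theta>' t *\<^sub>R h (\<theta> t)) has_integral (integral {0..\<theta> 1} h - integral {0..\<theta> 0} h)) {0..1}"
  proof (rule has_integral_substitution_interior)
    show "continuous_on {0..pi/2} h"
      unfolding h_def using slit by (auto intro!: continuous_intros simp: Delta_nonzero)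
    show "continuous_on {0..1} \<theta>"
      unfolding \<theta>_def
    proof (rule continuous_on_arcsin)
      show "continuous_on {0..1} (\<lambda>t. sqrt ((1 - (w t)\<^sup>2) / m))"
        unfolding w_def using m by (intro continuous_intros) auto
      show "\<forall>t\<in>{0..1}. - 1 \<le> sqrt ((1 - (w t)\<^sup>2) / m) \<and> sqrt ((1 - (w t)\<^sup>2) / m) \<le> 1"
      proof
        fix t :: real assume t: "t \<in> {0..1}"
        have "0 \<le> sqrt ((1 - (w t)\<^sup>2) / m)" by (rule real_sqrt_ge_zero[OF r_bounds(1)[OF t]])
        moreover have "sqrt ((1 - (w t)\<^sup>2) / m) \<le> 1" using r_bounds(2)[OF t] by simp
        ultimately show "- 1 \<le> sqrt ((1 - (w t)\<^sup>2) / m) \<and> sqrt ((1 - (w t)\<^sup>2) / m) \<le> 1" by linarith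
      qed
    qed
    show "\<theta> ` {0..1} \<subseteq> {0..pi/2}"
    proof (rule image_subsetI)
      fix t :: real assume "t \<in> {0..1}"
      from r_bounds[OF this] show "\<theta> t \<in> {0..pi/2}"
        using arcsin_le_arcsin[of 0 "sqrt ((1 - (w t)\<^sup>2) / m)"] arcsin_le_arcsin[of "sqrt ((1 - (w t)\<^sup>2) / m)" 1]
          order_trans[of "-1" 0 "sqrt ((1 - (w t)\<^sup>2) / m)"]
        unfolding \<theta>_def by simp
    qed
    fix t :: real assume t: "t \<in> {0<..<1}"
    from r_strict[OF t] show "\<theta> t \<in> {0<..<pi/2}"
      using arcsin_less_arcsin[of 0 "sqrt ((1 - (w t)\<^sup>2) / m)"] arcsin_less_arcsin[of "sqrt ((1 - (w t)\<^sup>2) / m)" 1]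
        order_trans[of "-1" 0 "sqrt ((1 - (w t)\<^sup>2) / m)"]
      unfolding \<theta>_def by simp
    have pos: "0 < 1 - (w t)\<^sup>2" "0 < (w t)\<^sup>2 - k\<^sup>2"
      using r_strict[OF t] m by (auto simp: m_def field_simps zero_less_divide_iff)
    have "((\<lambda>t. (1 - (w t)\<^sup>2) / m) has_real_derivative - (2 * w t * (1 - k)) / m) (at t)"
      unfolding w_def using m by (auto intro!: derivative_eq_intros)
    from DERIV_chain2[OF DERIV_real_sqrt[OF r_strict(1)[OF t]] this]
    have "((\<lambda>t. sqrt ((1 - (w t)\<^sup>2) / m)) has_real_derivative
        inverse (sqrt ((1 - (w t)\<^sup>2) / m)) / 2 * (- (2 * w t * (1 - k)) / m)) (at t)" .
    moreover have "-1 < sqrt ((1 - (w t)\<^sup>2) / m)" "sqrt ((1 - (w t)\<^sup>2) / m) < 1"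
      using r_strict[OF t] less_le_trans[of "-1" 0 "sqrt ((1 - (w t)\<^sup>2) / m)"] by auto
    ultimately have "(\<theta> has_real_derivative inverse (sqrt (1 - (sqrt ((1 - (w t)\<^sup>2) / m))\<^sup>2)) *
        (inverse (sqrt ((1 - (w t)\<^sup>2) / m)) / 2 * (- (2 * w t * (1 - k)) / m))) (at t)"
      unfolding \<theta>_def by (intro DERIV_chain2[OF DERIV_arcsin])
    also have "(sqrt ((1 - (w t)\<^sup>2) / m))\<^sup>2 = (1 - (w t)\<^sup>2) / m" using r_strict(1)[OF t] by simp
    also have "1 - (1 - (w t)\<^sup>2) / m = ((w t)\<^sup>2 - k\<^sup>2) / m" using m by (simp add: m_def field_simps)
    also have "inverse (sqrt (((w t)\<^sup>2 - k\<^sup>2) / m)) * (inverse (sqrt ((1 - (w t)\<^sup>2) / m)) / 2 * (- (2 * w t * (1 - k)) / m)) = \<theta>' t"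
    proof -
      have cancel: "inverse (B / S) * (inverse (A / S) / 2 * (- (2 * v * (1 - k)) / m)) = - (1 - k) * v / (A * B)"
        if "0 < A" "0 < B" "0 < S" "S * S = m" for A B S v :: real
        using that(1-3) unfolding that(4)[symmetric] by (simp add: field_simps)
      show ?thesis
        unfolding \<theta>'_def real_sqrt_mult real_sqrt_divide using pos m by (intro cancel) auto
    qed
    finally show "(\<theta> has_real_derivative \<theta>' t) (at t)" .
  qed auto
  have \<theta>: "\<theta> 1 = 0" "\<theta> 0 = pi/2" using m by (simp_all add: \<theta>_def w_def m_def)
  moreover have "integral {0..pi/2} h = K_par (1 - (of_real k)\<^sup>2)" by (simp add: h_def K_par_def m_def)
  ultimately have "((\<lambda>t. - (\<theta>' t *\<^sub>R h (\<theta> t))) has_integral K_par (1 - (of_real k)\<^sup>2)) {0..1}"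
    using has_integral_neg[OF subst] unfolding \<theta> by simp
  moreover have "- (\<theta>' t *\<^sub>R h (\<theta> t)) =
      1 / csqrt ((1 - (linepath (of_real k) 1 t)\<^sup>2) * ((linepath (of_real k) 1 t)\<^sup>2 - (of_real k)\<^sup>2)) * (1 - of_real k)"
    if t: "t \<in> {0..1}" for t
  proof -
    have lp: "linepath (of_real k) 1 t = complex_of_real (w t)"
      by (simp add: linepath_def w_def scaleR_conv_of_real algebra_simps)
    have sgn: "0 \<le> (1 - (w t)\<^sup>2) * ((w t)\<^sup>2 - k\<^sup>2)"
      using w_bounds[OF t] k power_mono[of k "w t" 2] by (intro mult_nonneg_nonneg) (auto simp: abs_square_le_1)
    have "csqrt ((1 - (of_real (w t))\<^sup>2) * ((of_real (w t))\<^sup>2 - (of_real k)\<^sup>2)) = of_real (sqrt ((1 - (w t)\<^sup>2) * ((w t)\<^sup>2 - k\<^sup>2)))"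
      using csqrt_of_real[OF sgn] by simp
    moreover have "Delta (of_real m) (\<theta> t) = of_real (w t)"
    proof -
      have "sin (\<theta> t) ^ 2 = (1 - (w t)\<^sup>2) / m"
        using r_bounds[OF t] order_trans[of "-1" 0 "sqrt ((1 - (w t)\<^sup>2) / m)"] by (simp add: \<theta>_def)
      then have "1 - of_real m * (sin (complex_of_real (\<theta> t)))\<^sup>2 = of_real ((w t)\<^sup>2)"
        using m unfolding radicand_real by (simp flip: of_real_mult)
      then show ?thesis
        using w_bounds[OF t] k by (simp add: Delta_def csqrt_of_real del: of_real_power)
    qed
    moreover have "w t \<noteq> 0" using w_bounds[OF t] k by simp
    ultimately show ?thesis
      by (simp add: lp h_def \<theta>'_def scaleR_conv_of_real) (simp add: minus_divide_left)
  qed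
  ultimately have "((\<lambda>t. 1 / csqrt ((1 - (linepath (of_real k) 1 t)\<^sup>2) * ((linepath (of_real k) 1 t)\<^sup>2 - (of_real k)\<^sup>2)) * (1 - of_real k))
      has_integral K_par (1 - (of_real k)\<^sup>2)) {0..1}"
    by (rule has_integral_eq[rotated])
  then show ?thesis
    by (simp add: ellipticK'_def contour_integral_integral integral_unique vector_derivative_linepath_at)
qed

lemma strip_square_slit_plane:
  assumes "k \<in> strip"
  shows "1 - k\<^sup>2 \<in> slit_plane"
proof -
  have "\<not> (Im (k\<^sup>2) = 0 \<and> Re (k\<^sup>2) \<le> 0)"
    using assms by (auto simp: strip_def power2_eq_square mult_le_0_iff)
  then show ?thesis by (auto simp: slit_plane_def complex_is_Real_iff)
qed

text \<open>Both sides are holomorphic on the strip and agree on the real interval.\<close>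

lemma ellipticK'_eq_K_par:
  assumes k: "k \<in> strip"
  shows "ellipticK' k = K_par (1 - k\<^sup>2)"
proof -
  have lim: "complex_of_real (1/2) islimpt complex_of_real ` {0<..<1}"
  proof (rule islimpt_isCont_image)
    show "(1/2::real) islimpt {0<..<1}"
      by (intro interior_limit_point) (auto simp: interior_open)
    show "\<forall>\<^sub>F x in at (1/2). complex_of_real x \<noteq> complex_of_real (1/2)"
      unfolding of_real_eq_iff by (rule eventually_neq_at_within)
  qed auto
  have hol: "(\<lambda>k. K_par (1 - k\<^sup>2)) holomorphic_on strip"
  proof (intro holomorphic_on_compose_gen[of "\<lambda>k. 1 - k\<^sup>2" strip K_par slit_plane, unfolded o_def] holomorphic_intros)
    show "K_par holomorphic_on slit_plane"
      using K_par_has_field_derivative open_slit_plane by (auto simp: holomorphic_on_open)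
  qed (auto simp: strip_square_slit_plane)
  have "ellipticK' k - K_par (1 - k\<^sup>2) = 0"
  proof (rule analytic_continuation[OF _ open_strip _ _ _ lim _ k])
    show "(\<lambda>k. ellipticK' k - K_par (1 - k\<^sup>2)) holomorphic_on strip"
      by (intro holomorphic_intros ellipticK'_holomorphic hol)
    show "connected strip" using convex_strip by (rule convex_connected)
  qed (auto simp: strip_def ellipticK'_real)
  then show ?thesis by simp
qed

section \<open>Analytic continuation of the differential equations\<close>

lemma continuation_region:
  assumes "continuation D0 f0 g0 D f g" "open D0" "connected D0" "D0 \<noteq> {}"
    "f0 holomorphic_on D0" "g0 holomorphic_on D0"
  shows "open D \<and> connected D \<and> D \<noteq> {} \<and> f holomorphic_on D \<and> g holomorphic_on D"
  using assms by (induction rule: continuation.induct) auto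

text \<open>The identity theorem, passed along a chain of regions. \<open>\<Psi>\<close> stands for a local holomorphic
  expression in the two functions, such as a differential equation or a polynomial relation. From left
  to right the equivalence brings a relation on an arbitrary branch back to the defining
  integrals; from right to left it carries a property of the integrals to all branches.\<close>

lemma continuation_identity_iff:
  assumes cont: "continuation D0 f0 g0 D f g"
    and base: "open D0" "connected D0" "D0 \<noteq> {}" "f0 holomorphic_on D0" "g0 holomorphic_on D0"
    and hol: "\<And>D f g. open D \<Longrightarrow> f holomorphic_on D \<Longrightarrow> g holomorphic_on D \<Longrightarrow> \<Psi> f g holomorphic_on D"
    and loc: "\<And>W f g f' g' k. open W \<Longrightarrow> (\<And>k. k \<in> W \<Longrightarrow> f' k = f k \<and> g' k = g k) \<Longrightarrow>
                k \<in> W \<Longrightarrow> \<Psi> f' g' k = \<Psi> f g k"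
  shows "(\<forall>k\<in>D. \<Psi> f g k = 0) \<longleftrightarrow> (\<forall>k\<in>D0. \<Psi> f0 g0 k = 0)"
  using cont
proof (induction rule: continuation.induct)
  case base
  show ?case ..
next
  case (step D f g D' f' g' W)
  have reg: "open D" "connected D" "f holomorphic_on D" "g holomorphic_on D"
    using continuation_region[OF step.hyps(1) base] by auto
  have on_W: "\<Psi> f' g' k = \<Psi> f g k" if "k \<in> W" for k
    using loc[of W f' f g' g] step.hyps that by blast
  have spread: "\<forall>k\<in>R. \<phi> k = 0"
    if "open R" "connected R" "\<phi> holomorphic_on R" "W \<subseteq> R" "\<forall>k\<in>W. \<phi> k = 0" for R and \<phi> :: "complex \<Rightarrow> complex"
    using analytic_continuation_open[of W R \<phi> "\<lambda>_. 0"] that step.hyps by auto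
  have "(\<forall>k\<in>D'. \<Psi> f' g' k = 0) \<longleftrightarrow> (\<forall>k\<in>W. \<Psi> f' g' k = 0)"
    using spread[of D' "\<Psi> f' g'"] step.hyps hol by blast
  also have "\<dots> \<longleftrightarrow> (\<forall>k\<in>D. \<Psi> f g k = 0)"
    using spread[of D "\<Psi> f g"] reg step.hyps hol on_W by auto
  finally show ?case using step.IH by simp
qed

definition K_region :: "complex set" where
  "K_region = - {k \<in> \<real>. 1 \<le> norm k}"

lemma K_region_square:
  assumes "k \<in> K_region"
  shows "k\<^sup>2 \<in> slit_plane"
proof -
  have "k \<in> \<real> \<and> 1 \<le> norm k" if "k\<^sup>2 \<in> \<real>" "1 \<le> Re (k\<^sup>2)"
  proof -
    have "Re k * Im k = 0" "1 \<le> (Re k)\<^sup>2 - (Im k)\<^sup>2"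
      using that by (auto simp: complex_is_Real_iff power2_eq_square)
    then have "Im k = 0" by (smt (verit) mult_eq_0_iff zero_le_power2 power_zero_numeral)
    with \<open>1 \<le> (Re k)\<^sup>2 - (Im k)\<^sup>2\<close> show ?thesis
      using abs_le_square_iff[of 1 "Re k"] by (simp add: complex_is_Real_iff cmod_def)
  qed
  with assms show ?thesis by (auto simp: slit_plane_def K_region_def)
qed

lemma open_K_region: "open K_region"
proof -
  have "open (- (\<real> \<inter> {k::complex. 1 \<le> norm k}))"
    by (intro open_Compl closed_Int closed_complex_Reals closed_Collect_le continuous_intros)
  moreover have "- (\<real> \<inter> {k. 1 \<le> norm k}) = K_region" by (auto simp: K_region_def)
  ultimately show ?thesis by (rule subst[rotated])
qed

lemma connected_K_region: "connected K_region"
proof (rule starlike_imp_connected, unfold starlike_def, intro bexI ballI)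
  fix k assume k: "k \<in> K_region"
  show "closed_segment 0 k \<subseteq> K_region"
  proof
    fix w assume "w \<in> closed_segment 0 k"
    then obtain t where t: "0 \<le> t" "t \<le> 1" "w = of_real t * k"
      by (auto simp: closed_segment_def scaleR_conv_of_real)
    show "w \<in> K_region"
      unfolding K_region_def
    proof (rule ComplI)
      assume w: "w \<in> {k \<in> \<real>. 1 \<le> norm k}"
      then have "t \<noteq> 0" using t by auto
      with w t have "k \<in> \<real>" by (auto simp: complex_is_Real_iff)
      moreover have "norm w \<le> norm k" using t by (simp add: norm_mult mult_left_le_one_le)
      ultimately show False using w k by (auto simp: K_region_def)
    qed
  qed
qed (simp add: K_region_def)

lemma holomorphic_K_par: "K_par holomorphic_on slit_plane" and holomorphic_E_par: "E_par holomorphic_on slit_plane"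
  using K_par_has_field_derivative E_par_has_field_derivative open_slit_plane
  by (auto simp: holomorphic_on_open)

lemma par_compose_has_field_derivative:
  assumes "\<mu> k \<in> slit_plane" "(\<mu> has_field_derivative d) (at k)"
  shows "((\<lambda>k. K_par (\<mu> k)) has_field_derivative deriv K_par (\<mu> k) * d) (at k)"
    and "((\<lambda>k. E_par (\<mu> k)) has_field_derivative deriv E_par (\<mu> k) * d) (at k)"
  using DERIV_chain2[OF holomorphic_derivI[OF holomorphic_K_par open_slit_plane assms(1)] assms(2)]
    DERIV_chain2[OF holomorphic_derivI[OF holomorphic_E_par open_slit_plane assms(1)] assms(2)] .

lemma ellipticK_holomorphic: "ellipticK holomorphic_on K_region"
  and ellipticE_holomorphic: "ellipticE holomorphic_on K_region"
proof -
  have "(\<lambda>k. K_par (k\<^sup>2)) holomorphic_on K_region" "(\<lambda>k. E_par (k\<^sup>2)) holomorphic_on K_region"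
    by (auto intro!: holomorphic_intros K_region_square
        holomorphic_on_compose_gen[of "\<lambda>k. k\<^sup>2" K_region _ slit_plane, unfolded o_def]
        holomorphic_K_par holomorphic_E_par)
  then show "ellipticK holomorphic_on K_region" "ellipticE holomorphic_on K_region"
    by (auto intro: holomorphic_transform[of "\<lambda>k. K_par (k\<^sup>2)"] holomorphic_transform[of "\<lambda>k. E_par (k\<^sup>2)"]
          simp: K_region_square ellipticK_eq_K_par ellipticE_eq_E_par)
qed

text \<open>The differential equations in \<open>m\<close> with \<open>m = k\<^sup>2\<close>. Multiplied by their denominators they make
  sense at \<open>k = 0\<close> and at \<open>k = \<plusminus>1\<close>.\<close>

lemma ellipticK_ode:
  assumes k: "k \<in> K_region"
  shows "k * (1 - k\<^sup>2) * deriv ellipticK k = ellipticE k - (1 - k\<^sup>2) * ellipticK k"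
    and "k * deriv ellipticE k = ellipticE k - ellipticK k"
proof -
  have sq: "((\<lambda>k. k\<^sup>2) has_field_derivative 2 * k) (at k)"
    by (auto intro!: derivative_eq_intros)
  have K: "(ellipticK has_field_derivative deriv K_par (k\<^sup>2) * (2 * k)) (at k)"
    using par_compose_has_field_derivative(1)[OF K_region_square[OF k] sq] open_K_region k
    by (rule has_field_derivative_transform_within_open) (simp add: ellipticK_eq_K_par K_region_square)
  have E: "(ellipticE has_field_derivative deriv E_par (k\<^sup>2) * (2 * k)) (at k)"
    using par_compose_has_field_derivative(2)[OF K_region_square[OF k] sq] open_K_region k
    by (rule has_field_derivative_transform_within_open) (simp add: ellipticE_eq_E_par K_region_square)
  have sp: "k\<^sup>2 \<in> slit_plane" by (rule K_region_square[OF k])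
  show "k * (1 - k\<^sup>2) * deriv ellipticK k = ellipticE k - (1 - k\<^sup>2) * ellipticK k"
    unfolding DERIV_imp_deriv[OF K] ellipticK_eq_K_par[OF sp] ellipticE_eq_E_par[OF sp]
    using K_par_ode[OF sp] by (simp add: power2_eq_square algebra_simps)
  show "k * deriv ellipticE k = ellipticE k - ellipticK k"
    unfolding DERIV_imp_deriv[OF E] ellipticK_eq_K_par[OF sp] ellipticE_eq_E_par[OF sp]
    using E_par_ode[OF sp] by (simp add: power2_eq_square algebra_simps)
qed

lemma ellipticE'_eq_E_par_strip: "k \<in> strip \<Longrightarrow> ellipticE' k = E_par (1 - k\<^sup>2)"
  by (intro ellipticE'_eq_E_par strip_square_slit_plane)

lemma ellipticE'_holomorphic: "ellipticE' holomorphic_on strip"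
proof -
  have "(\<lambda>k. E_par (1 - k\<^sup>2)) holomorphic_on strip"
    by (auto intro!: holomorphic_intros holomorphic_E_par strip_square_slit_plane
        holomorphic_on_compose_gen[of "\<lambda>k. 1 - k\<^sup>2" strip _ slit_plane, unfolded o_def])
  then show ?thesis by (rule holomorphic_transform) (simp add: ellipticE'_eq_E_par_strip)
qed

text \<open>The same equations at \<open>m = 1 - k\<^sup>2\<close>, where \<open>dm / dk = - 2 k\<close>.\<close>

lemma ellipticK'_ode:
  assumes k: "k \<in> strip"
  shows "k * (1 - k\<^sup>2) * deriv ellipticK' k = k\<^sup>2 * ellipticK' k - ellipticE' k"
    and "(1 - k\<^sup>2) * deriv ellipticE' k = k * (ellipticK' k - ellipticE' k)"
proof -
  have sp: "1 - k\<^sup>2 \<in> slit_plane" by (rule strip_square_slit_plane[OF k])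
  have sq: "((\<lambda>k. 1 - k\<^sup>2) has_field_derivative - 2 * k) (at k)"
    by (auto intro!: derivative_eq_intros)
  have K: "(ellipticK' has_field_derivative deriv K_par (1 - k\<^sup>2) * (- 2 * k)) (at k)"
    using par_compose_has_field_derivative(1)[OF sp sq] open_strip k
    by (rule has_field_derivative_transform_within_open) (simp add: ellipticK'_eq_K_par)
  have E: "(ellipticE' has_field_derivative deriv E_par (1 - k\<^sup>2) * (- 2 * k)) (at k)"
    using par_compose_has_field_derivative(2)[OF sp sq] open_strip k
    by (rule has_field_derivative_transform_within_open) (simp add: ellipticE'_eq_E_par_strip)
  have eq: "k * (1 - k\<^sup>2) * (deriv K_par (1 - k\<^sup>2) * (- 2 * k)) =
      - (2 * (1 - k\<^sup>2) * (1 - (1 - k\<^sup>2)) * deriv K_par (1 - k\<^sup>2))"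
    by (simp add: power2_eq_square algebra_simps)
  show "k * (1 - k\<^sup>2) * deriv ellipticK' k = k\<^sup>2 * ellipticK' k - ellipticE' k"
    unfolding DERIV_imp_deriv[OF K] ellipticK'_eq_K_par[OF k] ellipticE'_eq_E_par_strip[OF k] eq K_par_ode[OF sp]
    by simp
  have eq: "(1 - k\<^sup>2) * (deriv E_par (1 - k\<^sup>2) * (- 2 * k)) = - k * (2 * (1 - k\<^sup>2) * deriv E_par (1 - k\<^sup>2))"
    by (simp add: algebra_simps)
  show "(1 - k\<^sup>2) * deriv ellipticE' k = k * (ellipticK' k - ellipticE' k)"
    unfolding DERIV_imp_deriv[OF E] ellipticK'_eq_K_par[OF k] ellipticE'_eq_E_par_strip[OF k] eq E_par_ode[OF sp]
    by (simp add: algebra_simps)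
qed

lemma continuation_linear_ode:
  assumes cont: "continuation D0 f0 g0 D f g"
    and base: "open D0" "connected D0" "D0 \<noteq> {}" "f0 holomorphic_on D0" "g0 holomorphic_on D0"
    and coeff: "a holomorphic_on UNIV" "b holomorphic_on UNIV" "c holomorphic_on UNIV" "d holomorphic_on UNIV"
    and ode: "\<And>k. k \<in> D0 \<Longrightarrow> a k * deriv f0 k + b k * deriv g0 k = c k * f0 k + d k * g0 k"
    and "k \<in> D"
  shows "a k * deriv f k + b k * deriv g k = c k * f k + d k * g k"
proof -
  have "(\<forall>k\<in>D. a k * deriv f k + b k * deriv g k - (c k * f k + d k * g k) = 0) \<longleftrightarrow>
      (\<forall>k\<in>D0. a k * deriv f0 k + b k * deriv g0 k - (c k * f0 k + d k * g0 k) = 0)"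
  proof (rule continuation_identity_iff[OF cont base])
    show "(\<lambda>k. a k * deriv f k + b k * deriv g k - (c k * f k + d k * g k)) holomorphic_on D"
      if "open D" "f holomorphic_on D" "g holomorphic_on D" for D f g
      using that coeff by (intro holomorphic_intros) (auto intro: holomorphic_on_subset)
    show "a k * deriv f' k + b k * deriv g' k - (c k * f' k + d k * g' k) = a k * deriv f k + b k * deriv g k - (c k * f k + d k * g k)"
      if "open W" "\<And>k. k \<in> W \<Longrightarrow> f' k = f k \<and> g' k = g k" "k \<in> W" for W f g f' g' k
    proof -
      have "deriv f' k = deriv f k" "deriv g' k = deriv g k"
        using that by (auto intro!: deriv_cong_ev exI[of _ W] simp: eventually_nhds)
      with that show ?thesis by simp
    qed
  qed
  with ode \<open>k \<in> D\<close> show ?thesis by auto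
qed

lemma K_region_nonempty: "K_region \<noteq> {}"
proof -
  have "0 \<in> K_region" by (simp add: K_region_def)
  then show ?thesis by blast
qed

lemma KE_branch_continuation: "KE_branch D K E \<Longrightarrow> continuation K_region ellipticK ellipticE D K E"
  by (simp add: KE_branch_def K_region_def)

lemma KE_branch_region:
  assumes "KE_branch D K E"
  shows "open D" "connected D" "D \<noteq> {}" "K holomorphic_on D" "E holomorphic_on D"
  using continuation_region[OF KE_branch_continuation[OF assms] open_K_region connected_K_region
      K_region_nonempty ellipticK_holomorphic ellipticE_holomorphic] by auto

text \<open>A region reached by continuation may contain \<open>0\<close>, \<open>1\<close> or \<open>-1\<close>. The polynomial form holds there as
  well, so the brackets need no separate treatment at \<open>z = 0\<close>.\<close>

lemma KE_branch_ode:
  assumes br: "KE_branch D K E" and k: "k \<in> D"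
  shows "k * (1 - k\<^sup>2) * deriv K k = E k - (1 - k\<^sup>2) * K k" "k * deriv E k = E k - K k"
proof -
  note ode = continuation_linear_ode[OF KE_branch_continuation[OF br] open_K_region connected_K_region
      K_region_nonempty ellipticK_holomorphic ellipticE_holomorphic _ _ _ _ _ k]
  have "k * (1 - k\<^sup>2) * deriv K k + 0 * deriv E k = (k\<^sup>2 - 1) * K k + 1 * E k"
    by (rule ode) (auto intro!: holomorphic_intros simp: ellipticK_ode(1) left_diff_distrib)
  then show "k * (1 - k\<^sup>2) * deriv K k = E k - (1 - k\<^sup>2) * K k" by (simp add: left_diff_distrib)
  have "0 * deriv K k + k * deriv E k = - 1 * K k + 1 * E k"
    by (rule ode) (auto intro!: holomorphic_intros simp: ellipticK_ode(2))
  then show "k * deriv E k = E k - K k" by simp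
qed

lemma KE'_branch_region:
  assumes "KE'_branch D K' E'"
  shows "open D" "connected D" "D \<noteq> {}" "K' holomorphic_on D" "E' holomorphic_on D"
  and KE'_branch_ode: "\<And>k. k \<in> D \<Longrightarrow> k * (1 - k\<^sup>2) * deriv K' k = k\<^sup>2 * K' k - E' k"
     "\<And>k. k \<in> D \<Longrightarrow> (1 - k\<^sup>2) * deriv E' k = k * (K' k - E' k)"
proof -
  have "complex_of_real (1/2) \<in> strip" by (simp add: strip_def)
  then have ne: "strip \<noteq> {}" by blast
  note cont = assms[unfolded KE'_branch_def strip_def[symmetric]]
  note base = open_strip convex_connected[OF convex_strip] ne ellipticK'_holomorphic ellipticE'_holomorphic
  show "open D" "connected D" "D \<noteq> {}" "K' holomorphic_on D" "E' holomorphic_on D"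
    using continuation_region[OF cont base] by auto
  fix k assume k: "k \<in> D"
  note ode = continuation_linear_ode[OF cont base _ _ _ _ _ k]
  have "k * (1 - k\<^sup>2) * deriv K' k + 0 * deriv E' k = k\<^sup>2 * K' k + - 1 * E' k"
    by (rule ode) (auto intro!: holomorphic_intros simp: ellipticK'_ode(1))
  then show "k * (1 - k\<^sup>2) * deriv K' k = k\<^sup>2 * K' k - E' k" by simp
  have "0 * deriv K' k + (1 - k\<^sup>2) * deriv E' k = k * K' k + - k * E' k"
    by (rule ode) (auto intro!: holomorphic_intros simp: ellipticK'_ode(2) right_diff_distrib)
  then show "(1 - k\<^sup>2) * deriv E' k = k * (K' k - E' k)" by (simp add: right_diff_distrib)
qed

lemma ellipticK_zero: "ellipticK 0 = of_real (pi/2)"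
proof -
  have "(0::complex) \<in> slit_plane" by (simp add: slit_plane_def)
  then have "ellipticK 0 = K_par 0" using ellipticK_eq_K_par[of 0] by simp
  then show ?thesis by (simp add: K_par_def Delta_def scaleR_conv_of_real)
qed

section \<open>Skew-symmetric matrices in dimension four\<close>

definition skew4 :: "complex \<Rightarrow> complex \<Rightarrow> complex \<Rightarrow> complex \<Rightarrow> complex \<Rightarrow> complex \<Rightarrow> complex^4^4" where
  "skew4 a b c d e f = vector
     [vector [0, a, b, c], vector [- a, 0, d, e], vector [- b, - d, 0, f], vector [- c, - e, - f, 0]]"

lemma vector_4_nth:
  "(vector [a, b, c, d] :: 'a::zero^4) $ 1 = a" "(vector [a, b, c, d] :: 'a^4) $ 2 = b"
  "(vector [a, b, c, d] :: 'a^4) $ 3 = c" "(vector [a, b, c, d] :: 'a^4) $ 4 = d"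
  unfolding vector_def by auto

lemmas skew4_nth = skew4_def vector_4_nth

lemma skew4_antisym: "skew4 a b c d e f $ j $ i = - skew4 a b c d e f $ i $ j"
  using exhaust_4[of i] exhaust_4[of j] by (elim disjE) (simp_all add: skew4_nth)

text \<open>The second matrix is the Hodge dual of the first one up to sign. The product is the Pfaffian
  times the identity, which gives the zero set of the determinant without expanding it.\<close>

lemma skew4_mult_dual:
  "skew4 a b c d e f ** skew4 (- f) e (- d) (- c) b (- a) = mat (a * f - b * e + c * d)"
  by (simp add: vec_eq_iff forall_4 matrix_matrix_mult_def sum_4 skew4_nth mat_def algebra_simps)

lemma det_skew4_eq_0_iff: "det (skew4 a b c d e f) = 0 \<longleftrightarrow> a * f - b * e + c * d = 0"
proof
  let ?P = "skew4 a b c d e f" and ?Q = "skew4 (- f) e (- d) (- c) b (- a)"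
  show "det ?P = 0" if pf: "a * f - b * e + c * d = 0"
  proof (rule ccontr)
    assume "det ?P \<noteq> 0"
    then obtain R where R: "R ** ?P = mat 1"
      by (metis invertible_det_nz invertible_def)
    have "?Q = R ** (?P ** ?Q)" by (simp add: R matrix_mul_assoc)
    also have "?P ** ?Q = 0"
      unfolding skew4_mult_dual pf by (simp add: mat_def vec_eq_iff)
    finally have "?Q = 0" by simp
    then have "a = 0" "b = 0" "c = 0" "d = 0" "e = 0" "f = 0"
      by (auto simp: vec_eq_iff forall_4 skew4_nth)
    then have "row 1 ?P = 0" by (simp add: row_def vec_eq_iff forall_4 skew4_nth)
    then show False using \<open>det ?P \<noteq> 0\<close> det_zero_row(1) by blast
  qed
  show "a * f - b * e + c * d = 0" if "det ?P = 0"
  proof (rule ccontr)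
    assume pf: "a * f - b * e + c * d \<noteq> 0"
    have "mat (a * f - b * e + c * d) ** mat (inverse (a * f - b * e + c * d)) = (mat 1 :: complex^4^4)"
      using pf by (simp add: vec_eq_iff forall_4 matrix_matrix_mult_def sum_4 mat_def)
    then have "det ?P * det (?Q ** mat (inverse (a * f - b * e + c * d))) = 1"
      by (simp add: det_mul[symmetric] matrix_mul_assoc skew4_mult_dual)
    with that show False by simp
  qed
qed

section \<open>Gradients in dimension four\<close>

text \<open>A gradient calculus in which differentiation rules yield the four partial derivatives as
  explicit terms.\<close>

definition grad4 :: "(complex^4 \<Rightarrow> complex) \<Rightarrow> complex^4 \<Rightarrow> complex \<Rightarrow> complex \<Rightarrow> complex \<Rightarrow> complex \<Rightarrow> bool" where
  "grad4 f X a b c d \<longleftrightarrow> (f has_derivative (\<lambda>h. a * h $ 1 + b * h $ 2 + c * h $ 3 + d * h $ 4)) (at X)"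

lemma grad4_const: "grad4 (\<lambda>X. c) X 0 0 0 0"
  by (simp add: grad4_def)

lemma has_derivative_component: "((\<lambda>X. X $ i) has_derivative (\<lambda>h. h $ i)) (at X)"
  by (rule bounded_linear_imp_has_derivative[OF bounded_linear_vec_nth])

lemma grad4_coord:
  "grad4 (\<lambda>X. X $ 1) X 1 0 0 0" "grad4 (\<lambda>X. X $ 2) X 0 1 0 0"
  "grad4 (\<lambda>X. X $ 3) X 0 0 1 0" "grad4 (\<lambda>X. X $ 4) X 0 0 0 1"
  by (simp_all add: grad4_def has_derivative_component)

lemma grad4_add:
  "grad4 f X a b c d \<Longrightarrow> grad4 g X a' b' c' d' \<Longrightarrow> grad4 (\<lambda>X. f X + g X) X (a + a') (b + b') (c + c') (d + d')"
  unfolding grad4_def by (drule (1) has_derivative_add) (simp add: algebra_simps)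

lemma grad4_diff:
  "grad4 f X a b c d \<Longrightarrow> grad4 g X a' b' c' d' \<Longrightarrow> grad4 (\<lambda>X. f X - g X) X (a - a') (b - b') (c - c') (d - d')"
  unfolding grad4_def by (drule (1) has_derivative_diff) (simp add: algebra_simps)

lemma grad4_mult:
  "grad4 f X a b c d \<Longrightarrow> grad4 g X a' b' c' d' \<Longrightarrow>
     grad4 (\<lambda>X. f X * g X) X (f X * a' + a * g X) (f X * b' + b * g X) (f X * c' + c * g X) (f X * d' + d * g X)"
  unfolding grad4_def by (drule (1) has_derivative_mult) (simp add: algebra_simps)

lemma grad4_chain:
  "(\<phi> has_field_derivative \<phi>') (at (f X)) \<Longrightarrow> grad4 f X a b c d \<Longrightarrow>
     grad4 (\<lambda>X. \<phi> (f X)) X (\<phi>' * a) (\<phi>' * b) (\<phi>' * c) (\<phi>' * d)"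
  unfolding grad4_def has_field_derivative_def
  by (drule (1) has_derivative_compose[rotated]) (simp add: algebra_simps)

lemma grad4_power:
  assumes "grad4 f X a b c d"
  shows "grad4 (\<lambda>X. f X ^ n) X (of_nat n * f X ^ (n - 1) * a) (of_nat n * f X ^ (n - 1) * b)
           (of_nat n * f X ^ (n - 1) * c) (of_nat n * f X ^ (n - 1) * d)"
  by (intro grad4_chain assms) (rule DERIV_cong[OF DERIV_power[OF DERIV_ident]], simp)

lemma grad4_inverse:
  assumes "grad4 f X a b c d" "f X \<noteq> 0"
  shows "grad4 (\<lambda>X. inverse (f X)) X (- inverse ((f X)\<^sup>2) * a) (- inverse ((f X)\<^sup>2) * b)
           (- inverse ((f X)\<^sup>2) * c) (- inverse ((f X)\<^sup>2) * d)"
  using DERIV_inverse[OF assms(2), of UNIV]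
  by (intro grad4_chain[OF _ assms(1)]) (simp add: power2_eq_square eval_nat_numeral)

lemma grad4_divide:
  assumes "grad4 f X a b c d" "grad4 g X a' b' c' d'" "g X \<noteq> 0"
  shows "grad4 (\<lambda>X. f X / g X) X ((a * g X - f X * a') / (g X)\<^sup>2) ((b * g X - f X * b') / (g X)\<^sup>2)
           ((c * g X - f X * c') / (g X)\<^sup>2) ((d * g X - f X * d') / (g X)\<^sup>2)"
  using grad4_mult[OF assms(1) grad4_inverse[OF assms(2,3)]] assms(3)
  by (simp add: divide_inverse[symmetric] field_simps power2_eq_square)

lemma grad4_transform:
  assumes "grad4 f X a b c d" "open U" "X \<in> U" "\<And>Y. Y \<in> U \<Longrightarrow> f Y = g Y"
  shows "grad4 g X a b c d"
  using assms unfolding grad4_def by (rule has_derivative_transform_within_open)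

lemma grad4_cong:
  "grad4 f X a b c d \<Longrightarrow> a = a' \<Longrightarrow> b = b' \<Longrightarrow> c = c' \<Longrightarrow> d = d' \<Longrightarrow> grad4 f X a' b' c' d'"
  by simp

lemmas grad4_intros = grad4_const grad4_coord grad4_add grad4_diff grad4_mult grad4_power

lemma grad4_imp_has_derivative:
  assumes "grad4 f X a b c d"
  shows "(f has_derivative (\<lambda>h. \<Sum>i\<in>UNIV. (vector [a, b, c, d] :: complex^4) $ i * h $ i)) (at X)"
  using assms unfolding grad4_def sum_4 vector_4_nth .

lemma grad4_cgrad: "grad4 f X a b c d \<Longrightarrow> cgrad f X = vector [a, b, c, d]"
  by (intro cgrad_eqI grad4_imp_has_derivative)

lemma holomorphic_Cn_onI:
  "(\<And>X. X \<in> U \<Longrightarrow> \<exists>a b c d. grad4 f X a b c d) \<Longrightarrow> holomorphic_Cn_on f U"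
  unfolding holomorphic_Cn_on_def using grad4_imp_has_derivative by blast

lemma grad4_holomorphic:
  assumes "holomorphic_Cn_on f U" "X \<in> U"
  shows "grad4 f X (cgrad f X $ 1) (cgrad f X $ 2) (cgrad f X $ 3) (cgrad f X $ 4)"
  using holomorphic_Cn_has_derivative[OF assms] unfolding grad4_def sum_4 .

section \<open>The Jacobiator of a pencil\<close>

text \<open>The Jacobiator in coordinates with the derivatives taken of \<open>Q\<close> only. The value for \<open>P = Q\<close>
  must vanish for \<open>P\<close> to be a Poisson bracket, and the sum of the values for \<open>(P, Q)\<close> and \<open>(Q, P)\<close> is the
  obstruction to compatibility: up to normalization, the Schouten bracket.\<close>

definition trivector :: "(complex^4 \<Rightarrow> complex^4^4) \<Rightarrow> (complex^4 \<Rightarrow> complex^4^4) \<Rightarrow> complex^4 \<Rightarrow> 4 \<Rightarrow> 4 \<Rightarrow> 4 \<Rightarrow> complex" where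
  "trivector P Q X i j k =
     (\<Sum>l\<in>UNIV. P X $ i $ l * cgrad (\<lambda>X. Q X $ j $ k) X $ l)
     - (\<Sum>l\<in>UNIV. P X $ j $ l * cgrad (\<lambda>X. Q X $ i $ k) X $ l)
     + (\<Sum>l\<in>UNIV. P X $ k $ l * cgrad (\<lambda>X. Q X $ i $ j) X $ l)"

text \<open>An alternating tensor of rank 3 in dimension 4 has four independent components.\<close>

lemma alternating_4:
  fixes S :: "4 \<Rightarrow> 4 \<Rightarrow> 4 \<Rightarrow> complex"
  assumes swap: "\<And>i j k. S i j k = - S j i k" and cyc: "\<And>i j k. S i j k = S k i j"
    and base: "S 1 2 3 = 0" "S 1 2 4 = 0" "S 1 3 4 = 0" "S 2 3 4 = 0"
  shows "S i j k = 0"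
proof -
  have diag: "S i i k = 0" for i k using swap[of i i k] by simp
  have diag': "S i k i = 0" "S k i i = 0" for i k using diag[of i k] cyc[of i k i] cyc[of k i i] by simp_all
  have perm: "S b c a = 0 \<and> S c a b = 0 \<and> S b a c = 0 \<and> S a c b = 0 \<and> S c b a = 0" if "S a b c = 0" for a b c
  proof -
    have "S b c a = 0" using cyc[of b c a] that by simp
    moreover from this have "S c a b = 0" using cyc[of c a b] by simp
    moreover have "S b a c = 0" using swap[of b a c] that by simp
    moreover from this have "S a c b = 0" using cyc[of a c b] by simp
    moreover from this have "S c b a = 0" using cyc[of c b a] by simp
    ultimately show ?thesis by blast
  qed
  show ?thesis
    using exhaust_4[of i] exhaust_4[of j] exhaust_4[of k] base perm[OF base(1)] perm[OF base(2)] perm[OF base(3)] perm[OF base(4)]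
    by (elim disjE) (simp_all add: diag diag')
qed

definition skew_holomorphic_on :: "(complex^4) set \<Rightarrow> (complex^4 \<Rightarrow> complex^4^4) \<Rightarrow> bool" where
  "skew_holomorphic_on U P \<longleftrightarrow>
     (\<forall>i j. holomorphic_Cn_on (\<lambda>X. P X $ i $ j) U) \<and> (\<forall>X i j. P X $ j $ i = - P X $ i $ j)"

lemma holomorphic_Cn_on_uminus:
  fixes f :: "complex^4 \<Rightarrow> complex"
  assumes "holomorphic_Cn_on f U"
  shows "holomorphic_Cn_on (\<lambda>X. - f X) U"
proof (rule holomorphic_Cn_onI)
  fix X assume "X \<in> U"
  from grad4_diff[OF grad4_const grad4_holomorphic[OF assms this], of 0]
  show "\<exists>a b c d. grad4 (\<lambda>X. - f X) X a b c d" by auto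
qed

lemma skew_holomorphic_onI:
  assumes antisym: "\<And>X i j. P X $ j $ i = - P X $ i $ j"
    and hol: "\<And>i j. (i, j) \<in> {(1, 2), (1, 3), (1, 4), (2, 3), (2, 4), (3, 4)} \<Longrightarrow> holomorphic_Cn_on (\<lambda>X. P X $ i $ j) U"
  shows "skew_holomorphic_on U P"
proof -
  have diag: "P X $ i $ i = 0" for X i using antisym[of X i i] by simp
  have zero: "holomorphic_Cn_on (\<lambda>X. 0 :: complex) U"
    by (rule holomorphic_Cn_onI) (use grad4_const in blast)
  have up: "holomorphic_Cn_on (\<lambda>X. P X $ j $ i) U" if "holomorphic_Cn_on (\<lambda>X. P X $ i $ j) U" for i j
    by (subst antisym) (rule holomorphic_Cn_on_uminus[OF that])
  have "holomorphic_Cn_on (\<lambda>X. P X $ i $ j) U" for i j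
    using exhaust_4[of i] exhaust_4[of j] hol[of 1 2] hol[of 1 3] hol[of 1 4] hol[of 2 3] hol[of 2 4] hol[of 3 4]
      up[of 1 2] up[of 1 3] up[of 1 4] up[of 2 3] up[of 2 4] up[of 3 4]
    by (elim disjE) (simp_all add: diag zero)
  then show ?thesis unfolding skew_holomorphic_on_def using antisym by blast
qed

lemma skew_holomorphic_on_subset:
  "skew_holomorphic_on U P \<Longrightarrow> V \<subseteq> U \<Longrightarrow> skew_holomorphic_on V P"
  unfolding skew_holomorphic_on_def using holomorphic_Cn_on_subset by blast

lemma cgrad_uminus:
  assumes "holomorphic_Cn_on f U" "X \<in> U"
  shows "cgrad (\<lambda>X. - f X) X = - cgrad f X"
proof (rule cgrad_eqI)
  show "((\<lambda>X. - f X) has_derivative (\<lambda>h. \<Sum>m\<in>UNIV. (- cgrad f X) $ m * h $ m)) (at X)"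
    using has_derivative_minus[OF holomorphic_Cn_has_derivative[OF assms]] by (simp add: sum_negf)
qed

lemma cgrad_linear:
  assumes "holomorphic_Cn_on f U" "holomorphic_Cn_on g U" "X \<in> U"
  shows "((\<lambda>X. a * f X + b * g X) has_derivative (\<lambda>h. \<Sum>m\<in>UNIV. (a *s cgrad f X + b *s cgrad g X) $ m * h $ m)) (at X)"
  by (rule has_derivative_eq_rhs[OF has_derivative_add[OF
        has_derivative_mult_right[OF holomorphic_Cn_has_derivative[OF assms(1,3)]]
        has_derivative_mult_right[OF holomorphic_Cn_has_derivative[OF assms(2,3)]]]])
     (simp add: fun_eq_iff sum_distrib_left sum.distrib algebra_simps)

text \<open>The Jacobiator of \<open>a P + b Q\<close> is a quadratic form in \<open>(a, b)\<close>. Stating the hypothesis for fixed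
  \<open>a\<close>, \<open>b\<close> makes single brackets and whole pencils instances of the same criterion.\<close>

lemma poisson_on_lin_comb:
  assumes "open U" and P: "skew_holomorphic_on U P" and Q: "skew_holomorphic_on U Q"
    and tri: "\<And>X i j k. X \<in> U \<Longrightarrow> (i, j, k) \<in> {(1, 2, 3), (1, 2, 4), (1, 3, 4), (2, 3, 4)} \<Longrightarrow>
      a * a * trivector P P X i j k + a * b * (trivector P Q X i j k + trivector Q P X i j k)
      + b * b * trivector Q Q X i j k = 0"
  shows "poisson_on U (lin_comb a P b Q)"
proof (rule poisson_onI[OF \<open>open U\<close>])
  let ?R = "lin_comb a P b Q"
  have hol: "holomorphic_Cn_on (\<lambda>X. P X $ i $ j) U" "holomorphic_Cn_on (\<lambda>X. Q X $ i $ j) U" for i j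
    using P Q unfolding skew_holomorphic_on_def by blast+
  have R_nth: "?R X $ i $ j = a * P X $ i $ j + b * Q X $ i $ j" for X i j
    by (simp add: lin_comb_def)
  have R_has_derivative: "((\<lambda>X. ?R X $ i $ j) has_derivative (\<lambda>h. \<Sum>m\<in>UNIV.
      (a *s cgrad (\<lambda>X. P X $ i $ j) X + b *s cgrad (\<lambda>X. Q X $ i $ j) X) $ m * h $ m)) (at X)" if "X \<in> U" for X i j
    unfolding R_nth by (rule cgrad_linear[OF hol that])
  show R_hol: "holomorphic_Cn_on (\<lambda>X. ?R X $ i $ j) U" for i j
    using R_has_derivative unfolding holomorphic_Cn_on_def by blast
  show R_antisym: "?R X $ j $ i = - ?R X $ i $ j" for X i j
  proof -
    have "P X $ j $ i = - P X $ i $ j" "Q X $ j $ i = - Q X $ i $ j"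
      using P Q unfolding skew_holomorphic_on_def by blast+
    then show ?thesis by (simp add: R_nth)
  qed
  fix X i j k assume X: "X \<in> U"
  have cgrad_R: "cgrad (\<lambda>X. ?R X $ i $ j) X = a *s cgrad (\<lambda>X. P X $ i $ j) X + b *s cgrad (\<lambda>X. Q X $ i $ j) X" for i j
    by (rule cgrad_eqI[OF R_has_derivative[OF X]])
  have cgrad_R_antisym: "cgrad (\<lambda>X. ?R X $ j $ i) X = - cgrad (\<lambda>X. ?R X $ i $ j) X" for i j
    by (subst R_antisym) (rule cgrad_uminus[OF R_hol X])
  define S where "S i j k = (\<Sum>l\<in>UNIV. ?R X $ i $ l * cgrad (\<lambda>X. ?R X $ j $ k) X $ l)
      + (\<Sum>l\<in>UNIV. ?R X $ j $ l * cgrad (\<lambda>X. ?R X $ k $ i) X $ l)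
      + (\<Sum>l\<in>UNIV. ?R X $ k $ l * cgrad (\<lambda>X. ?R X $ i $ j) X $ l)" for i j k
  define A where "A P Q m i j = (\<Sum>l\<in>UNIV. P X $ m $ l * cgrad (\<lambda>X. Q X $ i $ j) X $ l)"
    for P Q :: "complex^4 \<Rightarrow> complex^4^4" and m i j
  have A_R: "A ?R ?R m i j = a * a * A P P m i j + a * b * (A P Q m i j + A Q P m i j) + b * b * A Q Q m i j" for m i j
    unfolding A_def cgrad_R unfolding R_nth
    by (simp add: sum_distrib_left sum.distrib[symmetric] algebra_simps)
  have trivector_A: "trivector P Q X i j k = A P Q i j k - A P Q j i k + A P Q k i j" for P Q i j k
    by (simp add: trivector_def A_def)
  have "S i j k = A ?R ?R i j k - A ?R ?R j i k + A ?R ?R k i j" for i j k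
    unfolding S_def A_def cgrad_R_antisym[of i k] by (simp add: sum_negf)
  then have S_eq: "S i j k = a * a * trivector P P X i j k + a * b * (trivector P Q X i j k + trivector Q P X i j k)
      + b * b * trivector Q Q X i j k" for i j k
    unfolding A_R trivector_A by (simp add: algebra_simps)
  have "S i j k = 0"
  proof (rule alternating_4)
    show "S i j k = - S j i k" for i j k
      unfolding S_def using cgrad_R_antisym[of i j] cgrad_R_antisym[of j k] cgrad_R_antisym[of i k]
      by (simp add: sum_negf)
    show "S i j k = S k i j" for i j k by (simp add: S_def)
  qed (simp_all add: S_eq tri[OF X])
  then show "(\<Sum>l\<in>UNIV. ?R X $ i $ l * cgrad (\<lambda>X. ?R X $ j $ k) X $ l)
      + (\<Sum>l\<in>UNIV. ?R X $ j $ l * cgrad (\<lambda>X. ?R X $ k $ i) X $ l)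
      + (\<Sum>l\<in>UNIV. ?R X $ k $ l * cgrad (\<lambda>X. ?R X $ i $ j) X $ l) = 0"
    by (simp add: S_def)
qed

section \<open>The rational bracket\<close>

text \<open>With the Hamiltonian inserted, the prefactor \<open>x / (2 H)\<close> becomes \<open>x\<^sup>3 / (y\<^sup>2 - z\<^sup>2)\<close>.\<close>

lemma omega_eq_skew4:
  "omega X = skew4
     ((X$1)^3 * (inverse ((X$2)\<^sup>2 - (X$3)\<^sup>2) * V_y X))
     ((X$1)^3 * (inverse ((X$2)\<^sup>2 - (X$3)\<^sup>2) * V_z X))
     ((X$1)^3 * (inverse ((X$2)\<^sup>2 - (X$3)\<^sup>2) * V_u X)) 0 0 0"
proof -
  have "X$1 / (2 * Ham X) = (X$1)^3 * inverse ((X$2)\<^sup>2 - (X$3)\<^sup>2)"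
  proof -
    have "2 * Ham X = ((X$2)\<^sup>2 - (X$3)\<^sup>2) / (X$1)\<^sup>2"
      unfolding Ham_def by (simp only: mult.assoc[symmetric]) simp
    moreover have "a / (d / a\<^sup>2) = a ^ 3 * inverse d" for a d :: complex
      by (simp add: divide_inverse power2_eq_square power3_eq_cube)
    ultimately show ?thesis by simp
  qed
  then show ?thesis
    by (simp add: omega_def vec_eq_iff forall_4 skew4_nth mult.assoc)
qed

lemma omega_t_eq_skew4:
  fixes X :: "complex^4" and K E :: "complex \<Rightarrow> complex"
  defines "x \<equiv> X$1" and "y \<equiv> X$2" and "z \<equiv> X$3"
  defines "c \<equiv> 2 / complex_of_real pi * (K (z/y))\<^sup>2"
  shows "omega_t K E X = skew4 (c * (x/y * z\<^sup>2)) (c * (x * z)) (c * (x * M1 K E X))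
     (c * (z/y * (y\<^sup>2 - z\<^sup>2))) (c * (1/y * M2 K E X)) (c * (z * M3 K E X))"
  unfolding omega_t_def Let_def x_def[symmetric] y_def[symmetric] z_def[symmetric] c_def[symmetric]
  by (simp add: vec_eq_iff forall_4 skew4_nth algebra_simps)

lemma open_dom_omega: "open dom_omega"
proof -
  have "dom_omega = {X. X$1 \<noteq> 0} \<inter> {X. (X$2)\<^sup>2 \<noteq> (X$3)\<^sup>2}"
    by (auto simp: dom_omega_def)
  moreover have "open \<dots>"
    by (intro open_Int open_Collect_neq continuous_intros)
  ultimately show ?thesis by simp
qed

lemma open_dom_ell:
  assumes "open D"
  shows "open (dom_ell D)"
proof -
  have "open {X :: complex^4. X$2 \<noteq> 0}" by (intro open_Collect_neq continuous_intros)
  moreover have "continuous_on {X :: complex^4. X$2 \<noteq> 0} (\<lambda>X. X$3 / X$2)"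
    by (intro continuous_intros) auto
  ultimately have "open ({X. X$2 \<noteq> 0} \<inter> (\<lambda>X :: complex^4. X$3 / X$2) -` D)"
    using assms by (intro continuous_open_preimage)
  moreover have "dom_ell D = {X. X$2 \<noteq> 0} \<inter> (\<lambda>X. X$3 / X$2) -` D"
    by (auto simp: dom_ell_def)
  ultimately show ?thesis by simp
qed

lemma open_nonzero:
  fixes K :: "complex \<Rightarrow> complex"
  assumes "open D" "continuous_on D K"
  shows "open {k \<in> D. K k \<noteq> 0}"
  using continuous_open_preimage[OF assms(2,1), of "- {0}"] by (simp add: Int_def vimage_def open_Compl)

lemma open_dom_omega_t:
  assumes "open D" "continuous_on D K"
  shows "open (dom_omega_t D K)"
proof -
  have "open {k \<in> D. K k \<noteq> 0}" by (rule open_nonzero[OF assms])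
  moreover have "dom_omega_t D K = dom_ell {k \<in> D. K k \<noteq> 0}"
    by (auto simp: dom_omega_t_def dom_ell_def)
  ultimately show ?thesis by (simp add: open_dom_ell)
qed

lemma grad4_omega_entry:
  assumes X: "X \<in> dom_omega" and V: "grad4 V X 0 Vy Vz Vu"
  defines "x \<equiv> X$1" and "y \<equiv> X$2" and "z \<equiv> X$3"
  defines "w \<equiv> inverse (y\<^sup>2 - z\<^sup>2)"
  shows "grad4 (\<lambda>X. (X$1)^3 * (inverse ((X$2)\<^sup>2 - (X$3)\<^sup>2) * V X)) X
     (3 * x\<^sup>2 * w * V X) (x^3 * (w * Vy - 2 * y * w\<^sup>2 * V X)) (x^3 * (w * Vz + 2 * z * w\<^sup>2 * V X)) (x^3 * w * Vu)"
proof -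
  have nz: "(X$2)\<^sup>2 - (X$3)\<^sup>2 \<noteq> 0" using X by (auto simp: dom_omega_def)
  show ?thesis
    by (rule grad4_cong, ((rule grad4_intros grad4_inverse V nz)+)[1])
       (simp_all add: x_def y_def z_def w_def power_inverse algebra_simps)
qed

lemma grad4_V:
  fixes X :: "complex^4"
  defines "y \<equiv> X$2" and "z \<equiv> X$3" and "u \<equiv> X$4"
  shows "grad4 V_y X 0 (u + 3 * y\<^sup>2 - 2 * z\<^sup>2) (- (4 * y * z)) y"
    "grad4 V_z X 0 (- (4 * y * z)) (u - 2 * y\<^sup>2 + 3 * z\<^sup>2) z"
    "grad4 V_u X 0 (- (4 * y^3) + 2 * y * z\<^sup>2) (2 * y\<^sup>2 * z - 4 * z^3) (2 * u)"
proof -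
  show "grad4 V_y X 0 (u + 3 * y\<^sup>2 - 2 * z\<^sup>2) (- (4 * y * z)) y"
    unfolding V_y_def y_def z_def u_def
    by (rule grad4_cong, ((rule grad4_intros)+)[1]) (simp_all add: algebra_simps eval_nat_numeral)
  show "grad4 V_z X 0 (- (4 * y * z)) (u - 2 * y\<^sup>2 + 3 * z\<^sup>2) z"
    unfolding V_z_def y_def z_def u_def
    by (rule grad4_cong, ((rule grad4_intros)+)[1]) (simp_all add: algebra_simps eval_nat_numeral)
  show "grad4 V_u X 0 (- (4 * y^3) + 2 * y * z\<^sup>2) (2 * y\<^sup>2 * z - 4 * z^3) (2 * u)"
    unfolding V_u_def y_def z_def u_def
    by (rule grad4_cong, ((rule grad4_intros)+)[1]) (simp_all add: algebra_simps eval_nat_numeral)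
qed

lemma omega_nth:
  fixes X :: "complex^4"
  defines "f \<equiv> (X$1)^3 * inverse ((X$2)\<^sup>2 - (X$3)\<^sup>2)"
  shows "omega X $ 1 $ 1 = 0" "omega X $ 1 $ 2 = f * V_y X" "omega X $ 1 $ 3 = f * V_z X" "omega X $ 1 $ 4 = f * V_u X"
    "omega X $ 2 $ 1 = - (f * V_y X)" "omega X $ 2 $ 2 = 0" "omega X $ 2 $ 3 = 0" "omega X $ 2 $ 4 = 0"
    "omega X $ 3 $ 1 = - (f * V_z X)" "omega X $ 3 $ 2 = 0" "omega X $ 3 $ 3 = 0" "omega X $ 3 $ 4 = 0"
    "omega X $ 4 $ 1 = - (f * V_u X)" "omega X $ 4 $ 2 = 0" "omega X $ 4 $ 3 = 0" "omega X $ 4 $ 4 = 0"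
  by (simp_all add: omega_eq_skew4 skew4_nth f_def mult.assoc)

lemma cgrad_omega:
  assumes X: "X \<in> dom_omega"
  defines "x \<equiv> X$1" and "y \<equiv> X$2" and "z \<equiv> X$3" and "u \<equiv> X$4"
  defines "w \<equiv> inverse (y\<^sup>2 - z\<^sup>2)"
  shows "cgrad (\<lambda>X. omega X $ 1 $ 2) X = vector [3 * x\<^sup>2 * w * V_y X,
      x^3 * (w * (u + 3 * y\<^sup>2 - 2 * z\<^sup>2) - 2 * y * w\<^sup>2 * V_y X), x^3 * (w * (- (4 * y * z)) + 2 * z * w\<^sup>2 * V_y X), x^3 * w * y]"
    "cgrad (\<lambda>X. omega X $ 1 $ 3) X = vector [3 * x\<^sup>2 * w * V_z X,
      x^3 * (w * (- (4 * y * z)) - 2 * y * w\<^sup>2 * V_z X), x^3 * (w * (u - 2 * y\<^sup>2 + 3 * z\<^sup>2) + 2 * z * w\<^sup>2 * V_z X), x^3 * w * z]"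
    "cgrad (\<lambda>X. omega X $ 1 $ 4) X = vector [3 * x\<^sup>2 * w * V_u X,
      x^3 * (w * (- (4 * y^3) + 2 * y * z\<^sup>2) - 2 * y * w\<^sup>2 * V_u X), x^3 * (w * (2 * y\<^sup>2 * z - 4 * z^3) + 2 * z * w\<^sup>2 * V_u X), x^3 * w * (2 * u)]"
    "cgrad (\<lambda>X. omega X $ 2 $ 3) X = vector [0, 0, 0, 0]"
    "cgrad (\<lambda>X. omega X $ 2 $ 4) X = vector [0, 0, 0, 0]"
    "cgrad (\<lambda>X. omega X $ 3 $ 4) X = vector [0, 0, 0, 0]"
  unfolding omega_eq_skew4 skew4_nth x_def y_def z_def u_def w_def
  by (intro grad4_cgrad grad4_omega_entry grad4_V grad4_const X)+

lemma skew_holomorphic_omega: "skew_holomorphic_on dom_omega omega"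
proof (rule skew_holomorphic_onI)
  show "omega X $ j $ i = - omega X $ i $ j" for X i j
    unfolding omega_eq_skew4 by (rule skew4_antisym)
  note grads = grad4_omega_entry[OF _ grad4_V(1)] grad4_omega_entry[OF _ grad4_V(2)] grad4_omega_entry[OF _ grad4_V(3)]
  show "holomorphic_Cn_on (\<lambda>X. omega X $ i $ j) dom_omega"
    if "(i, j) \<in> {(1, 2), (1, 3), (1, 4), (2, 3), (2, 4), (3, 4)}" for i j
    unfolding omega_eq_skew4 using that
    by (auto simp only: insert_iff empty_iff prod.inject skew4_nth intro!: holomorphic_Cn_onI)
       (use grads grad4_const in blast)+
qed

text \<open>Any bivector \<open>\<partial>\<^sub>x \<and> W\<close> with \<open>W\<close> a multiple of a field in \<open>(y, z, u)\<close> that does not depend on \<open>x\<close>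
  satisfies the Jacobi identity, and \<open>\<omega>\<close> has this form; in coordinates the terms cancel without any use
  of the particular \<open>V\<close>.\<close>

lemma trivector_omega_omega:
  assumes X: "X \<in> dom_omega"
  shows "trivector omega omega X 1 2 3 = 0" "trivector omega omega X 1 2 4 = 0"
    "trivector omega omega X 1 3 4 = 0" "trivector omega omega X 2 3 4 = 0"
  unfolding trivector_def sum_4 cgrad_omega[OF X] unfolding omega_nth vector_4_nth
  by (simp_all add: algebra_simps power2_eq_square power3_eq_cube)

section \<open>The transcendental bracket and compatibility\<close>

definition two_over_pi :: complex where "two_over_pi = 2 / complex_of_real pi"

lemma grad4_quotient_chain:
  fixes X :: "complex^4"
  assumes g: "(g has_field_derivative g') (at (X$3 / X$2))" and y: "X$2 \<noteq> 0"
  defines "y \<equiv> X$2" and "k \<equiv> X$3 / X$2"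
  shows "grad4 (\<lambda>X. g (X$3 / X$2)) X 0 (- (g' * k / y)) (g' / y) 0"
  by (rule grad4_cong, rule grad4_chain[where f = "\<lambda>X. X$3 / X$2", OF g],
      rule grad4_divide[OF grad4_coord(3) grad4_coord(2) y])
     (use y in \<open>simp_all add: k_def y_def field_simps power2_eq_square\<close>)

text \<open>All that the brackets need to know about a branch: two holomorphic functions with the
  differential equations of \<open>K\<close> and \<open>E\<close>.\<close>

locale elliptic_pair =
  fixes D :: "complex set" and K E :: "complex \<Rightarrow> complex"
  assumes open_D: "open D" and holomorphic_K: "K holomorphic_on D" and holomorphic_E: "E holomorphic_on D"
    and ode_K: "\<And>k. k \<in> D \<Longrightarrow> k * (1 - k\<^sup>2) * deriv K k = E k - (1 - k\<^sup>2) * K k"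
    and ode_E: "\<And>k. k \<in> D \<Longrightarrow> k * deriv E k = E k - K k"
begin

lemma DERIV_K: "k \<in> D \<Longrightarrow> (K has_field_derivative deriv K k) (at k)"
  using holomorphic_derivI[OF holomorphic_K open_D] .

lemma DERIV_E: "k \<in> D \<Longrightarrow> (E has_field_derivative deriv E k) (at k)"
  using holomorphic_derivI[OF holomorphic_E open_D] .

text \<open>The entries of \<open>(\<pi>/2) \<omega>\<^sub>t\<close>, up to a monomial in \<open>x\<close> and \<open>y\<close>, as functions of \<open>k = z / y\<close>. The factor
  \<open>K\<^sup>2\<close> clears the quotients \<open>E / K\<close> in \<open>M\<^sub>1\<close>, \<open>M\<^sub>2\<close>, \<open>M\<^sub>3\<close>, so they are polynomials in \<open>k\<close>, \<open>K\<close> and \<open>E\<close>.\<close>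

definition "g12 k = k\<^sup>2 * (K k)\<^sup>2"
definition "g13 k = k * (K k)\<^sup>2"
definition "g14 k = 3 * (E k - K k)\<^sup>2 - k\<^sup>2 * (K k)\<^sup>2"
definition "g23 k = k * (1 - k\<^sup>2) * (K k)\<^sup>2"
definition "g24 k = 3 * (E k - K k)\<^sup>2 + k\<^sup>2 * (6 * E k * K k - 5 * (K k)\<^sup>2) + 2 * k^4 * (K k)\<^sup>2"
definition "g34 k = k * (3 * (E k)\<^sup>2 - (K k)\<^sup>2 + k\<^sup>2 * (K k)\<^sup>2)"

text \<open>The derivatives are kept in terms of \<open>K'\<close> and \<open>E'\<close> instead of being reduced by the differential
  equations, because the reduction divides by \<open>k (1 - k\<^sup>2)\<close>.\<close>

definition "g12' k = 2 * k * (K k)\<^sup>2 + 2 * k\<^sup>2 * K k * deriv K k"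
definition "g13' k = (K k)\<^sup>2 + 2 * k * K k * deriv K k"
definition "g14' k = 6 * (E k - K k) * (deriv E k - deriv K k) - 2 * k * (K k)\<^sup>2 - 2 * k\<^sup>2 * K k * deriv K k"
definition "g23' k = (1 - 3 * k\<^sup>2) * (K k)\<^sup>2 + 2 * k * (1 - k\<^sup>2) * K k * deriv K k"
definition "g24' k = 6 * (E k - K k) * (deriv E k - deriv K k) + 2 * k * (6 * E k * K k - 5 * (K k)\<^sup>2)
   + k\<^sup>2 * (6 * deriv E k * K k + 6 * E k * deriv K k - 10 * K k * deriv K k) + 8 * k^3 * (K k)\<^sup>2 + 4 * k^4 * K k * deriv K k"
definition "g34' k = 3 * (E k)\<^sup>2 - (K k)\<^sup>2 + 3 * k\<^sup>2 * (K k)\<^sup>2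
   + k * (6 * E k * deriv E k - 2 * K k * deriv K k + 2 * k\<^sup>2 * K k * deriv K k)"

lemma DERIV_g:
  assumes "k \<in> D"
  shows "(g12 has_field_derivative g12' k) (at k)" "(g13 has_field_derivative g13' k) (at k)"
    "(g14 has_field_derivative g14' k) (at k)" "(g23 has_field_derivative g23' k) (at k)"
    "(g24 has_field_derivative g24' k) (at k)" "(g34 has_field_derivative g34' k) (at k)"
proof -
  note K = DERIV_K[OF assms] and E = DERIV_E[OF assms]
  show "(g12 has_field_derivative g12' k) (at k)" unfolding g12_def[abs_def] g12'_def
    by (rule derivative_eq_intros K E refl | simp add: algebra_simps eval_nat_numeral)+
  show "(g13 has_field_derivative g13' k) (at k)" unfolding g13_def[abs_def] g13'_def
    by (rule derivative_eq_intros K E refl | simp add: algebra_simps eval_nat_numeral)+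
  show "(g14 has_field_derivative g14' k) (at k)" unfolding g14_def[abs_def] g14'_def
    by (rule derivative_eq_intros K E refl | simp add: algebra_simps eval_nat_numeral)+
  show "(g23 has_field_derivative g23' k) (at k)" unfolding g23_def[abs_def] g23'_def
    by (rule derivative_eq_intros K E refl | simp add: algebra_simps eval_nat_numeral)+
  show "(g24 has_field_derivative g24' k) (at k)" unfolding g24_def[abs_def] g24'_def
    by (rule derivative_eq_intros K E refl | simp add: algebra_simps eval_nat_numeral)+
  show "(g34 has_field_derivative g34' k) (at k)" unfolding g34_def[abs_def] g34'_def
    by (rule derivative_eq_intros K E refl | simp add: algebra_simps eval_nat_numeral)+
qed

lemma omega_t_normal:
  fixes X :: "complex^4"
  assumes X: "X \<in> dom_omega_t D K"
  defines "x \<equiv> X$1" and "y \<equiv> X$2" and "k \<equiv> X$3 / X$2"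
  shows "omega_t K E X = skew4 (two_over_pi * (x * y * g12 k)) (two_over_pi * (x * y * g13 k)) (two_over_pi * (x * y\<^sup>2 * g14 k))
     (two_over_pi * (y\<^sup>2 * g23 k)) (two_over_pi * (y^3 * g24 k)) (two_over_pi * (y^3 * g34 k))"
proof -
  have y: "y \<noteq> 0" and K: "K k \<noteq> 0" using X by (auto simp: dom_omega_t_def dom_ell_def y_def k_def)
  have z: "X$3 = k * y" using y by (simp add: y_def k_def)
  have e: "two_over_pi * (x * y * g12 k) = 2 / of_real pi * (K k)\<^sup>2 * (x / y * (k * y)\<^sup>2)"
    "two_over_pi * (x * y * g13 k) = 2 / of_real pi * (K k)\<^sup>2 * (x * (k * y))"
    "two_over_pi * (x * y\<^sup>2 * g14 k) = 2 / of_real pi * (K k)\<^sup>2 * (x * (3 * y\<^sup>2 * (E k / K k - 1)\<^sup>2 - (k * y)\<^sup>2))"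
    "two_over_pi * (y\<^sup>2 * g23 k) = 2 / of_real pi * (K k)\<^sup>2 * (k * (y\<^sup>2 - (k * y)\<^sup>2))"
    "two_over_pi * (y^3 * g24 k) = 2 / of_real pi * (K k)\<^sup>2 * (1 / y * (3 * y^4 * (E k / K k - 1)\<^sup>2 + y\<^sup>2 * (k * y)\<^sup>2 * (6 * (E k / K k) - 5) + 2 * (k * y)^4))"
    "two_over_pi * (y^3 * g34 k) = 2 / of_real pi * (K k)\<^sup>2 * (k * y * (y\<^sup>2 * (3 * (E k / K k)\<^sup>2 - 1) + (k * y)\<^sup>2))"
    using y K unfolding two_over_pi_def g12_def g13_def g14_def g23_def g24_def g34_def
    by (simp_all add: field_simps eval_nat_numeral)
  show ?thesis
    unfolding omega_t_eq_skew4 M1_def M2_def M3_def Let_def k_def[symmetric] x_def[symmetric] y_def[symmetric] z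
    unfolding e using y by (simp add: k_def)
qed

lemma omega_t_nth:
  fixes X :: "complex^4"
  assumes X: "X \<in> dom_omega_t D K"
  defines "x \<equiv> X$1" and "y \<equiv> X$2" and "k \<equiv> X$3 / X$2"
  shows "omega_t K E X $ 1 $ 1 = 0" "omega_t K E X $ 1 $ 2 = two_over_pi * (x * y * g12 k)"
    "omega_t K E X $ 1 $ 3 = two_over_pi * (x * y * g13 k)" "omega_t K E X $ 1 $ 4 = two_over_pi * (x * y\<^sup>2 * g14 k)"
    "omega_t K E X $ 2 $ 1 = - (two_over_pi * (x * y * g12 k))" "omega_t K E X $ 2 $ 2 = 0"
    "omega_t K E X $ 2 $ 3 = two_over_pi * (y\<^sup>2 * g23 k)" "omega_t K E X $ 2 $ 4 = two_over_pi * (y^3 * g24 k)"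
    "omega_t K E X $ 3 $ 1 = - (two_over_pi * (x * y * g13 k))" "omega_t K E X $ 3 $ 2 = - (two_over_pi * (y\<^sup>2 * g23 k))"
    "omega_t K E X $ 3 $ 3 = 0" "omega_t K E X $ 3 $ 4 = two_over_pi * (y^3 * g34 k)"
    "omega_t K E X $ 4 $ 1 = - (two_over_pi * (x * y\<^sup>2 * g14 k))" "omega_t K E X $ 4 $ 2 = - (two_over_pi * (y^3 * g24 k))"
    "omega_t K E X $ 4 $ 3 = - (two_over_pi * (y^3 * g34 k))" "omega_t K E X $ 4 $ 4 = 0"
  unfolding omega_t_normal[OF X] x_def y_def k_def by (simp_all add: skew4_nth)

text \<open>Each entry is homogeneous in \<open>(y, z)\<close>; the exponent is written as a successor so that it can be
  lowered by one without a case distinction.\<close>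

lemma grad4_homogeneous:
  fixes X :: "complex^4"
  assumes y: "X$2 \<noteq> 0" and g: "(g has_field_derivative g') (at (X$3 / X$2))"
  defines "x \<equiv> X$1" and "y \<equiv> X$2" and "k \<equiv> X$3 / X$2"
  shows "grad4 (\<lambda>X. c * (X$1 * X$2 ^ Suc n * g (X$3 / X$2))) X (c * (y ^ Suc n * g k))
      (c * (x * y ^ n * (of_nat (Suc n) * g k - k * g'))) (c * (x * y ^ n * g')) 0"
    and "grad4 (\<lambda>X. c * (X$2 ^ Suc n * g (X$3 / X$2))) X 0
      (c * (y ^ n * (of_nat (Suc n) * g k - k * g'))) (c * (y ^ n * g')) 0"
proof -
  note q = grad4_quotient_chain[OF g y]
  show "grad4 (\<lambda>X. c * (X$1 * X$2 ^ Suc n * g (X$3 / X$2))) X (c * (y ^ Suc n * g k))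
      (c * (x * y ^ n * (of_nat (Suc n) * g k - k * g'))) (c * (x * y ^ n * g')) 0"
    by (rule grad4_cong, ((rule grad4_const grad4_coord grad4_mult grad4_power q)+)[1])
       (use y in \<open>simp_all add: x_def y_def k_def field_simps\<close>)
  show "grad4 (\<lambda>X. c * (X$2 ^ Suc n * g (X$3 / X$2))) X 0
      (c * (y ^ n * (of_nat (Suc n) * g k - k * g'))) (c * (y ^ n * g')) 0"
    by (rule grad4_cong, ((rule grad4_const grad4_coord grad4_mult grad4_power q)+)[1])
       (use y in \<open>simp_all add: x_def y_def k_def field_simps\<close>)
qed

lemma open_dom: "open (dom_omega_t D K)"
  by (rule open_dom_omega_t[OF open_D holomorphic_on_imp_continuous_on[OF holomorphic_K]])

lemma grad4_omega_t:
  fixes X :: "complex^4"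
  assumes X: "X \<in> dom_omega_t D K"
  defines "x \<equiv> X$1" and "y \<equiv> X$2" and "k \<equiv> X$3 / X$2"
  shows "grad4 (\<lambda>X. omega_t K E X $ 1 $ 2) X (two_over_pi * (y * g12 k)) (two_over_pi * (x * (g12 k - k * g12' k))) (two_over_pi * (x * g12' k)) 0"
    "grad4 (\<lambda>X. omega_t K E X $ 1 $ 3) X (two_over_pi * (y * g13 k)) (two_over_pi * (x * (g13 k - k * g13' k))) (two_over_pi * (x * g13' k)) 0"
    "grad4 (\<lambda>X. omega_t K E X $ 1 $ 4) X (two_over_pi * (y\<^sup>2 * g14 k)) (two_over_pi * (x * y * (2 * g14 k - k * g14' k))) (two_over_pi * (x * y * g14' k)) 0"
    "grad4 (\<lambda>X. omega_t K E X $ 2 $ 3) X 0 (two_over_pi * (y * (2 * g23 k - k * g23' k))) (two_over_pi * (y * g23' k)) 0"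
    "grad4 (\<lambda>X. omega_t K E X $ 2 $ 4) X 0 (two_over_pi * (y\<^sup>2 * (3 * g24 k - k * g24' k))) (two_over_pi * (y\<^sup>2 * g24' k)) 0"
    "grad4 (\<lambda>X. omega_t K E X $ 3 $ 4) X 0 (two_over_pi * (y\<^sup>2 * (3 * g34 k - k * g34' k))) (two_over_pi * (y\<^sup>2 * g34' k)) 0"
proof -
  have y: "X$2 \<noteq> 0" and k: "X$3 / X$2 \<in> D" using X by (auto simp: dom_omega_t_def dom_ell_def)
  note tr = grad4_transform[OF _ open_dom X]
  note h1 = grad4_homogeneous(1)[OF y, folded x_def y_def k_def] and h2 = grad4_homogeneous(2)[OF y, folded x_def y_def k_def]
  note d = DERIV_g[OF k, folded k_def]
  show "grad4 (\<lambda>X. omega_t K E X $ 1 $ 2) X (two_over_pi * (y * g12 k)) (two_over_pi * (x * (g12 k - k * g12' k))) (two_over_pi * (x * g12' k)) 0"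
    by (rule tr, rule grad4_cong, rule h1[OF d(1), of two_over_pi 0]) (simp_all add: omega_t_nth)
  show "grad4 (\<lambda>X. omega_t K E X $ 1 $ 3) X (two_over_pi * (y * g13 k)) (two_over_pi * (x * (g13 k - k * g13' k))) (two_over_pi * (x * g13' k)) 0"
    by (rule tr, rule grad4_cong, rule h1[OF d(2), of two_over_pi 0]) (simp_all add: omega_t_nth)
  show "grad4 (\<lambda>X. omega_t K E X $ 1 $ 4) X (two_over_pi * (y\<^sup>2 * g14 k)) (two_over_pi * (x * y * (2 * g14 k - k * g14' k))) (two_over_pi * (x * y * g14' k)) 0"
    by (rule tr, rule grad4_cong, rule h1[OF d(3), of two_over_pi 1]) (simp_all add: omega_t_nth power2_eq_square)
  show "grad4 (\<lambda>X. omega_t K E X $ 2 $ 3) X 0 (two_over_pi * (y * (2 * g23 k - k * g23' k))) (two_over_pi * (y * g23' k)) 0"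
    by (rule tr, rule grad4_cong, rule h2[OF d(4), of two_over_pi 1]) (simp_all add: omega_t_nth power2_eq_square)
  show "grad4 (\<lambda>X. omega_t K E X $ 2 $ 4) X 0 (two_over_pi * (y\<^sup>2 * (3 * g24 k - k * g24' k))) (two_over_pi * (y\<^sup>2 * g24' k)) 0"
    by (rule tr, rule grad4_cong, rule h2[OF d(5), of two_over_pi 2]) (simp_all add: omega_t_nth power2_eq_square power3_eq_cube)
  show "grad4 (\<lambda>X. omega_t K E X $ 3 $ 4) X 0 (two_over_pi * (y\<^sup>2 * (3 * g34 k - k * g34' k))) (two_over_pi * (y\<^sup>2 * g34' k)) 0"
    by (rule tr, rule grad4_cong, rule h2[OF d(6), of two_over_pi 2]) (simp_all add: omega_t_nth power2_eq_square power3_eq_cube)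
qed

lemmas cgrad_omega_t = grad4_omega_t[THEN grad4_cgrad]

text \<open>After the substitution \<open>z = k y\<close> each component is a polynomial in \<open>x\<close>, \<open>y\<close>, \<open>k\<close>, \<open>K\<close>, \<open>E\<close>, \<open>K'\<close>,
  \<open>E'\<close> that lies in the ideal generated by the two differential equations.\<close>

lemma trivector_omega_t_omega_t:
  assumes X: "X \<in> dom_omega_t D K"
  shows "trivector (omega_t K E) (omega_t K E) X 1 2 3 = 0" "trivector (omega_t K E) (omega_t K E) X 1 2 4 = 0"
    "trivector (omega_t K E) (omega_t K E) X 1 3 4 = 0" "trivector (omega_t K E) (omega_t K E) X 2 3 4 = 0"
proof -
  define x y k where "x = X$1" and "y = X$2" and "k = X$3 / X$2"
  define \<kappa> \<epsilon> p q where "\<kappa> = K k" and "\<epsilon> = E k" and "p = deriv K k" and "q = deriv E k"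
  have "k \<in> D" using X by (auto simp: dom_omega_t_def dom_ell_def k_def)
  from ode_K[OF this] ode_E[OF this]
  have R: "k * (1 - k\<^sup>2) * p - (\<epsilon> - (1 - k\<^sup>2) * \<kappa>) = 0" "k * q - (\<epsilon> - \<kappa>) = 0"
    by (simp_all add: \<kappa>_def \<epsilon>_def p_def q_def)
  note fold = k_def[symmetric]
  note unfold = x_def[symmetric] y_def[symmetric] g12_def g13_def g14_def g23_def g24_def g34_def
    g12'_def g13'_def g14'_def g23'_def g24'_def g34'_def \<kappa>_def[symmetric] \<epsilon>_def[symmetric] p_def[symmetric] q_def[symmetric]
  show "trivector (omega_t K E) (omega_t K E) X 1 2 3 = 0"
    unfolding trivector_def sum_4 cgrad_omega_t[OF X] unfolding omega_t_nth[OF X] vector_4_nth unfolding fold unfolding unfold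
    by algebra
  show "trivector (omega_t K E) (omega_t K E) X 1 2 4 = 0"
    unfolding trivector_def sum_4 cgrad_omega_t[OF X] unfolding omega_t_nth[OF X] vector_4_nth unfolding fold unfolding unfold
    using R by algebra
  show "trivector (omega_t K E) (omega_t K E) X 1 3 4 = 0"
    unfolding trivector_def sum_4 cgrad_omega_t[OF X] unfolding omega_t_nth[OF X] vector_4_nth unfolding fold unfolding unfold
    using R by algebra
  show "trivector (omega_t K E) (omega_t K E) X 2 3 4 = 0"
    unfolding trivector_def sum_4 cgrad_omega_t[OF X] unfolding omega_t_nth[OF X] vector_4_nth unfolding fold unfolding unfold
    using R by algebra
qed

end

lemma grad4_Ham:
  fixes X :: "complex^4"
  assumes "X$1 \<noteq> 0"
  defines "x \<equiv> X$1" and "y \<equiv> X$2" and "z \<equiv> X$3"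
  shows "grad4 Ham X (- ((y\<^sup>2 - z\<^sup>2) / x^3)) (y / x\<^sup>2) (- (z / x\<^sup>2)) 0"
proof -
  have nz: "(X$1)\<^sup>2 \<noteq> 0" using assms(1) by simp
  have "grad4 (\<lambda>X. 1/2 * (((X$2)\<^sup>2 - (X$3)\<^sup>2) / (X$1)\<^sup>2)) X (- ((y\<^sup>2 - z\<^sup>2) / x^3)) (y / x\<^sup>2) (- (z / x\<^sup>2)) 0"
    by (rule grad4_cong, ((rule grad4_const grad4_coord grad4_diff grad4_mult grad4_power grad4_divide nz)+)[1])
       (use assms(1) in \<open>simp_all add: x_def y_def z_def field_simps eval_nat_numeral\<close>)
  then show ?thesis by (simp add: Ham_def[abs_def])
qed

lemma matrix_vector_4: "((P :: complex^4^4) *v v) $ i = P $ i $ 1 * v $ 1 + P $ i $ 2 * v $ 2 + P $ i $ 3 * v $ 3 + P $ i $ 4 * (v $ 4 :: complex)"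
  by (simp add: matrix_vector_mult_def sum_4)

text \<open>The \<open>x\<close>-component of the Hamiltonian vector field is a multiple of \<open>y V\<^sub>y - z V\<^sub>z\<close>, which equals
  \<open>(y\<^sup>2 - z\<^sup>2) (u + y\<^sup>2 + z\<^sup>2)\<close>; the prefactor of \<open>\<omega>\<close> cancels \<open>y\<^sup>2 - z\<^sup>2\<close>.\<close>

lemma Ham_flow_omega:
  assumes X: "X \<in> dom_omega"
  shows "system_S X = omega X *v cgrad Ham X"
proof -
  define x y z u w where "x = X$1" and "y = X$2" and "z = X$3" and "u = X$4" and "w = inverse (y\<^sup>2 - z\<^sup>2)"
  have x: "X$1 \<noteq> 0" and "y\<^sup>2 - z\<^sup>2 \<noteq> 0" using X by (auto simp: dom_omega_def y_def z_def)
  then have w: "w * (y\<^sup>2 - z\<^sup>2) = 1" by (simp add: w_def)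
  have x': "x \<noteq> 0" using x by (simp add: x_def)
  have cancel: "x^3 * w * V * ((y\<^sup>2 - z\<^sup>2) / x^3) = V" for V
  proof -
    have "x^3 * w * V * ((y\<^sup>2 - z\<^sup>2) / x^3) = V * (w * (y\<^sup>2 - z\<^sup>2))" using x' by (simp add: field_simps)
    then show ?thesis by (simp add: w)
  qed
  have "x^3 * w * V_y X * (y / x\<^sup>2) - x^3 * w * V_z X * (z / x\<^sup>2) = x * w * (V_y X * y - V_z X * z)"
    using x' by (simp add: field_simps eval_nat_numeral)
  also have "V_y X * y - V_z X * z = (y\<^sup>2 - z\<^sup>2) * (u + y\<^sup>2 + z\<^sup>2)"
    unfolding V_y_def V_z_def x_def[symmetric] y_def[symmetric] z_def[symmetric] u_def[symmetric] by algebra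
  also have "x * w * ((y\<^sup>2 - z\<^sup>2) * (u + y\<^sup>2 + z\<^sup>2)) = V_x X"
    using w unfolding V_x_def x_def[symmetric] y_def[symmetric] z_def[symmetric] u_def[symmetric] by algebra
  finally have 1: "V_x X = x^3 * w * V_y X * (y / x\<^sup>2) - x^3 * w * V_z X * (z / x\<^sup>2)" ..
  show ?thesis
    unfolding vec_eq_iff forall_4 matrix_vector_4 grad4_cgrad[OF grad4_Ham[OF x]] system_S_def vector_4_nth omega_nth
      x_def[symmetric] y_def[symmetric] z_def[symmetric] w_def[symmetric] 1
    using cancel by simp
qed

context elliptic_pair
begin

lemma skew_holomorphic_omega_t: "skew_holomorphic_on (dom_omega_t D K) (omega_t K E)"
proof (rule skew_holomorphic_onI)
  show "omega_t K E X $ j $ i = - omega_t K E X $ i $ j" for X i j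
    unfolding omega_t_eq_skew4 by (rule skew4_antisym)
  show "holomorphic_Cn_on (\<lambda>X. omega_t K E X $ i $ j) (dom_omega_t D K)"
    if "(i, j) \<in> {(1, 2), (1, 3), (1, 4), (2, 3), (2, 4), (3, 4)}" for i j
    using that grad4_omega_t by (intro holomorphic_Cn_onI) blast
qed

lemma dom_omega_tD:
  assumes "X \<in> dom_omega_t D K"
  shows "X$2 \<noteq> 0" "X$3 / X$2 \<in> D" "K (X$3 / X$2) \<noteq> 0" "X$3 = X$3 / X$2 * X$2"
  using assms by (auto simp: dom_omega_t_def dom_ell_def)

text \<open>Membership in a polynomial ideal again, with \<open>w = 1 / (y\<^sup>2 - z\<^sup>2)\<close> as a further variable and the
  relation \<open>w y\<^sup>2 (1 - k\<^sup>2) = 1\<close>.\<close>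

lemma trivector_omega_omega_t:
  assumes X: "X \<in> dom_omega" "X \<in> dom_omega_t D K"
  shows "trivector omega (omega_t K E) X 1 2 3 + trivector (omega_t K E) omega X 1 2 3 = 0"
    "trivector omega (omega_t K E) X 1 2 4 + trivector (omega_t K E) omega X 1 2 4 = 0"
    "trivector omega (omega_t K E) X 1 3 4 + trivector (omega_t K E) omega X 1 3 4 = 0"
    "trivector omega (omega_t K E) X 2 3 4 + trivector (omega_t K E) omega X 2 3 4 = 0"
proof -
  define x y z u k where "x = X$1" and "y = X$2" and "z = X$3" and "u = X$4" and "k = X$3 / X$2"
  define \<kappa> \<epsilon> p q w where "\<kappa> = K k" and "\<epsilon> = E k" and "p = deriv K k" and "q = deriv E k" and "w = inverse (y\<^sup>2 - z\<^sup>2)"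
  have "k \<in> D" using X by (auto simp: dom_omega_t_def dom_ell_def k_def)
  from ode_K[OF this] ode_E[OF this]
  have R: "k * (1 - k\<^sup>2) * p - (\<epsilon> - (1 - k\<^sup>2) * \<kappa>) = 0" "k * q - (\<epsilon> - \<kappa>) = 0"
    by (simp_all add: \<kappa>_def \<epsilon>_def p_def q_def)
  have z: "z = k * y" using dom_omega_tD(4)[OF X(2)] by (simp add: z_def k_def y_def)
  have "y\<^sup>2 - z\<^sup>2 \<noteq> 0" using X(1) by (auto simp: dom_omega_def y_def z_def)
  then have "w * (y\<^sup>2 - z\<^sup>2) = 1" by (simp add: w_def)
  then have W: "w * y\<^sup>2 * (1 - k\<^sup>2) - 1 = 0" unfolding z by algebra
  note fold = k_def[symmetric]
  note unfold = V_y_def V_z_def V_u_def x_def[symmetric] y_def[symmetric] z_def[symmetric] u_def[symmetric]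
    g12_def g13_def g14_def g23_def g24_def g34_def
    g12'_def g13'_def g14'_def g23'_def g24'_def g34'_def \<kappa>_def[symmetric] \<epsilon>_def[symmetric] p_def[symmetric] q_def[symmetric]
  show "trivector omega (omega_t K E) X 1 2 3 + trivector (omega_t K E) omega X 1 2 3 = 0"
    unfolding trivector_def sum_4 cgrad_omega_t[OF X(2)] cgrad_omega[OF X(1)]
    unfolding omega_t_nth[OF X(2)] omega_nth vector_4_nth unfolding fold unfolding unfold unfolding w_def[symmetric] unfolding z
    using R W by algebra
  show "trivector omega (omega_t K E) X 1 2 4 + trivector (omega_t K E) omega X 1 2 4 = 0"
    unfolding trivector_def sum_4 cgrad_omega_t[OF X(2)] cgrad_omega[OF X(1)]
    unfolding omega_t_nth[OF X(2)] omega_nth vector_4_nth unfolding fold unfolding unfold unfolding w_def[symmetric] unfolding z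
    using R W by algebra
  show "trivector omega (omega_t K E) X 1 3 4 + trivector (omega_t K E) omega X 1 3 4 = 0"
    unfolding trivector_def sum_4 cgrad_omega_t[OF X(2)] cgrad_omega[OF X(1)]
    unfolding omega_t_nth[OF X(2)] omega_nth vector_4_nth unfolding fold unfolding unfold unfolding w_def[symmetric] unfolding z
    using R W by algebra
  show "trivector omega (omega_t K E) X 2 3 4 + trivector (omega_t K E) omega X 2 3 4 = 0"
    unfolding trivector_def sum_4 cgrad_omega_t[OF X(2)] cgrad_omega[OF X(1)]
    unfolding omega_t_nth[OF X(2)] omega_nth vector_4_nth unfolding fold unfolding unfold unfolding w_def[symmetric] unfolding z
    by simp
qed

lemma Ham_casimir_omega_t:
  assumes X: "X \<in> dom_omega_t D K" and x: "X$1 \<noteq> 0"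
  shows "omega_t K E X *v cgrad Ham X = 0"
proof -
  define x y k where "x = X$1" and "y = X$2" and "k = X$3 / X$2"
  have x': "x \<noteq> 0" using x by (simp add: x_def)
  have z: "X$3 = k * y" using dom_omega_tD(4)[OF X] by (simp add: k_def y_def)
  show ?thesis
    unfolding vec_eq_iff forall_4 matrix_vector_4 grad4_cgrad[OF grad4_Ham[OF x]] vector_4_nth omega_t_nth[OF X]
      g12_def g13_def g14_def g23_def g24_def g34_def unfolding k_def[symmetric] 
    unfolding x_def[symmetric] y_def[symmetric] z
    using x' by (simp add: field_simps) (simp add: algebra_simps eval_nat_numeral)
qed

end

section \<open>Casimir functions\<close>

text \<open>The two Casimir functions of \<open>\<omega>\<close> differ only in the constants \<open>a\<close>, \<open>b\<close> and in the pair of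
  integrals.\<close>

lemma grad4_J:
  fixes X :: "complex^4"
  assumes y: "X$2 \<noteq> 0" and k: "X$3 / X$2 \<in> D" and D: "open D" "A holomorphic_on D" "B holomorphic_on D"
  defines "y \<equiv> X$2" and "k \<equiv> X$3 / X$2" and "u \<equiv> X$4"
  shows "grad4 (\<lambda>X. 1/X$2 * (X$4 + a * (X$2)\<^sup>2 + (X$3)\<^sup>2) * A (X$3 / X$2) + b * X$2 * B (X$3 / X$2)) X 0
    ((a - u / y\<^sup>2 - k\<^sup>2) * A k - k * (u / y\<^sup>2 + a + k\<^sup>2) * deriv A k + b * B k - b * k * deriv B k)
    (2 * k * A k + (u / y\<^sup>2 + a + k\<^sup>2) * deriv A k + b * deriv B k) (A k / y)"
proof -
  note dA = holomorphic_derivI[OF D(2,1) k] and dB = holomorphic_derivI[OF D(3,1) k]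
  have z: "X$3 = k * y" using y by (simp add: k_def y_def)
  have y': "y \<noteq> 0" using y by (simp add: y_def)
  show ?thesis
    by (rule grad4_cong, ((rule grad4_const grad4_coord grad4_add grad4_mult grad4_power
            grad4_quotient_chain[OF dA y] grad4_quotient_chain[OF dB y] grad4_divide y)+)[1])
       (unfold k_def[symmetric] y_def[symmetric] u_def[symmetric] z, use y' in \<open>simp_all add: field_simps eval_nat_numeral\<close>)
qed

text \<open>A function that does not depend on \<open>x\<close> is a Casimir function of \<open>\<omega>\<close> exactly if it is a first
  integral of the flow in \<open>(y, z, u)\<close>.\<close>

lemma flow_J:
  assumes X: "X \<in> dom_omega" and g: "grad4 J X 0 Jy Jz Ju"
    and flow: "V_y X * Jy + V_z X * Jz + V_u X * Ju = 0"
  shows "omega X *v cgrad J X = 0"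
proof -
  have "c * V_y X * Jy + c * V_z X * Jz + c * V_u X * Ju = 0" for c
    using flow by (metis (no_types, lifting) distrib_left mult.assoc mult_zero_right)
  then show ?thesis
    unfolding vec_eq_iff forall_4 matrix_vector_4 grad4_cgrad[OF g] vector_4_nth omega_nth by simp
qed

context elliptic_pair
begin

text \<open>With \<open>u = v y\<^sup>2\<close> and \<open>z = k y\<close> the derivative along the flow is \<open>y\<^sup>3\<close> times a polynomial in \<open>v\<close>,
  \<open>k\<close>, the integrals and their derivatives, which vanishes modulo the differential equations.\<close>

lemma J1_casimir: "casimir_on (dom_omega \<inter> dom_ell D) omega (J1 K E)"
  unfolding casimir_on_def
proof (intro conjI ballI holomorphic_Cn_onI)
  fix X assume X: "X \<in> dom_omega \<inter> dom_ell D"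
  define y k v where "y = X$2" and "k = X$3 / X$2" and "v = X$4 / (X$2)\<^sup>2"
  have y: "X$2 \<noteq> 0" and kD: "X$3 / X$2 \<in> D" using X by (auto simp: dom_ell_def)
  have z: "X$3 = k * y" and u: "X$4 = v * y\<^sup>2" using y by (simp_all add: k_def y_def v_def)
  have J1: "J1 K E = (\<lambda>X. 1/X$2 * (X$4 + (- 2) * (X$2)\<^sup>2 + (X$3)\<^sup>2) * K (X$3 / X$2) + 3 * X$2 * E (X$3 / X$2))"
    by (simp add: J1_def fun_eq_iff Let_def)
  note g = grad4_J[OF y kD open_D holomorphic_K holomorphic_E, of "- 2" 3, folded J1]
  then show "\<exists>a b c d. grad4 (J1 K E) X a b c d" by blast
  define \<kappa> \<epsilon> p q where "\<kappa> = K k" and "\<epsilon> = E k" and "p = deriv K k" and "q = deriv E k"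
  have R: "k * (1 - k\<^sup>2) * p - (\<epsilon> - (1 - k\<^sup>2) * \<kappa>) = 0" "k * q - (\<epsilon> - \<kappa>) = 0"
    using ode_K[OF kD] ode_E[OF kD] by (simp_all add: \<kappa>_def \<epsilon>_def p_def q_def k_def)
  have V_u: "V_u X / y = y^3 * (v\<^sup>2 - 1 + k\<^sup>2 - k^4)"
    unfolding V_u_def u z y_def[symmetric] using y by (simp add: y_def field_simps eval_nat_numeral)
  show "omega X *v cgrad (J1 K E) X = 0"
  proof (rule flow_J[OF _ g])
    show "X \<in> dom_omega" using X by simp
    have "V_u X * (K (X$3 / X$2) / X$2) = \<kappa> * (V_u X / y)"
      by (simp add: \<kappa>_def k_def y_def)
    then have "V_u X * (K (X$3 / X$2) / X$2) = \<kappa> * (y^3 * (v\<^sup>2 - 1 + k\<^sup>2 - k^4))"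
      by (simp only: V_u)
    then show "V_y X * ((- 2 - X$4 / (X$2)\<^sup>2 - (X$3 / X$2)\<^sup>2) * K (X$3 / X$2) -
        X$3 / X$2 * (X$4 / (X$2)\<^sup>2 + - 2 + (X$3 / X$2)\<^sup>2) * deriv K (X$3 / X$2) + 3 * E (X$3 / X$2)
        - 3 * (X$3 / X$2) * deriv E (X$3 / X$2))
      + V_z X * (2 * (X$3 / X$2) * K (X$3 / X$2) + (X$4 / (X$2)\<^sup>2 + - 2 + (X$3 / X$2)\<^sup>2) * deriv K (X$3 / X$2)
        + 3 * deriv E (X$3 / X$2)) + V_u X * (K (X$3 / X$2) / X$2) = 0"
      unfolding V_y_def V_z_def k_def[symmetric] v_def[symmetric] \<kappa>_def[symmetric] \<epsilon>_def[symmetric] p_def[symmetric] q_def[symmetric]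
      unfolding u z y_def[symmetric]
      using R by algebra
  qed
qed

text \<open>The gradient is a multiple of \<open>(0, m\<^sub>y, m\<^sub>z, K\<^sup>2)\<close> with \<open>m\<^sub>y\<close> and \<open>m\<^sub>z\<close> polynomial, so the
  common denominator leaves the computation before the differential equations are applied.\<close>

lemma NN_casimir: "casimir_on {X \<in> dom_omega_t D K. J1 K E X \<noteq> 0} (omega_t K E) (NN K E)"
  unfolding casimir_on_def
proof (intro conjI ballI holomorphic_Cn_onI)
  fix X assume "X \<in> {X \<in> dom_omega_t D K. J1 K E X \<noteq> 0}"
  then have X: "X \<in> dom_omega_t D K" and J: "J1 K E X \<noteq> 0" by auto
  define x y k v where "x = X$1" and "y = X$2" and "k = X$3 / X$2" and "v = X$4 / (X$2)\<^sup>2"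
  note y = dom_omega_tD(1)[OF X] and kD = dom_omega_tD(2)[OF X]
  have y': "y \<noteq> 0" using y by (simp add: y_def)
  have z: "X$3 = k * y" and u: "X$4 = v * y\<^sup>2" using y by (simp_all add: k_def y_def v_def)
  define \<kappa> \<epsilon> p q where "\<kappa> = K k" and "\<epsilon> = E k" and "p = deriv K k" and "q = deriv E k"
  have R: "k * (1 - k\<^sup>2) * p - (\<epsilon> - (1 - k\<^sup>2) * \<kappa>) = 0" "k * q - (\<epsilon> - \<kappa>) = 0"
    using ode_K[OF kD] ode_E[OF kD] by (simp_all add: \<kappa>_def \<epsilon>_def p_def q_def k_def)
  have J1: "J1 K E = (\<lambda>X. 1/X$2 * (X$4 + (- 2) * (X$2)\<^sup>2 + (X$3)\<^sup>2) * K (X$3 / X$2) + 3 * X$2 * E (X$3 / X$2))"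
    by (simp add: J1_def fun_eq_iff Let_def)
  note gJ = grad4_J[OF y kD open_D holomorphic_K holomorphic_E, of "- 2" 3, folded J1]
  note gK = grad4_quotient_chain[OF DERIV_K[OF kD] y]
  \<comment> \<open>\<open>Q = J\<^sub>1 / y\<close> depends on \<open>v\<close> and \<open>k\<close> only.\<close>
  define Q where "Q = (v - 2 + k\<^sup>2) * \<kappa> + 3 * \<epsilon>"
  have J_eq: "J1 K E X = y * Q"
    unfolding J1 k_def[symmetric] \<kappa>_def[symmetric] \<epsilon>_def[symmetric] Q_def unfolding u z y_def[symmetric]
    using y' by (simp add: field_simps power2_eq_square)
  have Q: "Q \<noteq> 0" using J J_eq by auto
  define m_y m_z where "m_y = y * (\<kappa> * ((- 2 - v - k\<^sup>2) * \<kappa> - k * (v + - 2 + k\<^sup>2) * p + 3 * \<epsilon> - 3 * k * q + Q) + p * k * Q)"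
    and "m_z = y * (\<kappa> * (2 * k * \<kappa> + (v + - 2 + k\<^sup>2) * p + 3 * q) - p * Q)"
  have g: "grad4 (NN K E) X 0 (m_y / (y * (y * Q))\<^sup>2) (m_z / (y * (y * Q))\<^sup>2) (\<kappa>\<^sup>2 / (y * (y * Q))\<^sup>2)"
  proof -
    have nz: "X$2 * J1 K E X \<noteq> 0" using y J by simp
    have "grad4 (\<lambda>X. (0 - K (X$3 / X$2)) / (X$2 * J1 K E X)) X 0
        (m_y / (y * (y * Q))\<^sup>2) (m_z / (y * (y * Q))\<^sup>2) (\<kappa>\<^sup>2 / (y * (y * Q))\<^sup>2)"
      by (rule grad4_cong, rule grad4_divide[OF grad4_diff[OF grad4_const gK] grad4_mult[OF grad4_coord(2) gJ] nz];
          unfold J_eq k_def[symmetric] v_def[symmetric]; unfold y_def[symmetric] \<kappa>_def[symmetric] \<epsilon>_def[symmetric]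
            p_def[symmetric] q_def[symmetric] m_y_def m_z_def; (rule arg_cong[where f = "\<lambda>t. t / (y * (y * Q))\<^sup>2"])?)
         (use y' in \<open>simp_all add: field_simps power2_eq_square\<close>)
    then show ?thesis by (simp add: NN_def[abs_def])
  qed
  then show "\<exists>a b c d. grad4 (NN K E) X a b c d" by blast
  have "cgrad (NN K E) X = (1 / (y * (y * Q))\<^sup>2) *s vector [0, m_y, m_z, \<kappa>\<^sup>2]"
    unfolding grad4_cgrad[OF g] by (simp add: vec_eq_iff forall_4 vector_4_nth)
  moreover have "omega_t K E X *v vector [0, m_y, m_z, \<kappa>\<^sup>2] = 0"
    unfolding vec_eq_iff forall_4 matrix_vector_4 vector_4_nth omega_t_nth[OF X] zero_index
    unfolding k_def[symmetric]
    unfolding x_def[symmetric] y_def[symmetric] g12_def g13_def g14_def g23_def g24_def g34_def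
      \<kappa>_def[symmetric] \<epsilon>_def[symmetric] m_y_def m_z_def Q_def
    using R by (intro conjI) algebra+
  ultimately show "omega_t K E X *v cgrad (NN K E) X = 0"
    by (simp add: vector_scalar_commute)
qed

end

lemma J2_casimir:
  assumes br: "KE'_branch D K' E'"
  shows "casimir_on (dom_omega \<inter> dom_ell D) omega (J2 K' E')"
  unfolding casimir_on_def
proof (intro conjI ballI holomorphic_Cn_onI)
  fix X assume X: "X \<in> dom_omega \<inter> dom_ell D"
  define y k v where "y = X$2" and "k = X$3 / X$2" and "v = X$4 / (X$2)\<^sup>2"
  have y: "X$2 \<noteq> 0" and kD: "X$3 / X$2 \<in> D" using X by (auto simp: dom_ell_def)
  have z: "X$3 = k * y" and u: "X$4 = v * y\<^sup>2" using y by (simp_all add: k_def y_def v_def)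
  have J2: "J2 K' E' = (\<lambda>X. 1/X$2 * (X$4 + 1 * (X$2)\<^sup>2 + (X$3)\<^sup>2) * K' (X$3 / X$2) + (- 3) * X$2 * E' (X$3 / X$2))"
    by (simp add: J2_def fun_eq_iff Let_def)
  note g = grad4_J[OF y kD KE'_branch_region(1,4,5)[OF br], of 1 "- 3", folded J2]
  then show "\<exists>a b c d. grad4 (J2 K' E') X a b c d" by blast
  define \<kappa> \<epsilon> p q where "\<kappa> = K' k" and "\<epsilon> = E' k" and "p = deriv K' k" and "q = deriv E' k"
  have R: "k * (1 - k\<^sup>2) * p - (k\<^sup>2 * \<kappa> - \<epsilon>) = 0" "(1 - k\<^sup>2) * q - k * (\<kappa> - \<epsilon>) = 0"
    using KE'_branch_ode[OF br kD] by (simp_all add: \<kappa>_def \<epsilon>_def p_def q_def k_def)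
  have V_u: "V_u X / y = y^3 * (v\<^sup>2 - 1 + k\<^sup>2 - k^4)"
    unfolding V_u_def u z y_def[symmetric] using y by (simp add: y_def field_simps eval_nat_numeral)
  show "omega X *v cgrad (J2 K' E') X = 0"
  proof (rule flow_J[OF _ g])
    show "X \<in> dom_omega" using X by simp
    have "V_u X * (K' (X$3 / X$2) / X$2) = \<kappa> * (V_u X / y)"
      by (simp add: \<kappa>_def k_def y_def)
    then have "V_u X * (K' (X$3 / X$2) / X$2) = \<kappa> * (y^3 * (v\<^sup>2 - 1 + k\<^sup>2 - k^4))"
      by (simp only: V_u)
    then show "V_y X * ((1 - X$4 / (X$2)\<^sup>2 - (X$3 / X$2)\<^sup>2) * K' (X$3 / X$2) -
        X$3 / X$2 * (X$4 / (X$2)\<^sup>2 + 1 + (X$3 / X$2)\<^sup>2) * deriv K' (X$3 / X$2) + - 3 * E' (X$3 / X$2)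
        - - 3 * (X$3 / X$2) * deriv E' (X$3 / X$2))
      + V_z X * (2 * (X$3 / X$2) * K' (X$3 / X$2) + (X$4 / (X$2)\<^sup>2 + 1 + (X$3 / X$2)\<^sup>2) * deriv K' (X$3 / X$2)
        + - 3 * deriv E' (X$3 / X$2)) + V_u X * (K' (X$3 / X$2) / X$2) = 0"
      unfolding V_y_def V_z_def k_def[symmetric] v_def[symmetric] \<kappa>_def[symmetric] \<epsilon>_def[symmetric] p_def[symmetric] q_def[symmetric]
      unfolding u z y_def[symmetric]
      using R by algebra
  qed
qed

section \<open>The pencil of brackets and its determinant\<close>

lemma poisson_onI_trivector:
  assumes "open U" and P: "skew_holomorphic_on U P"
    and "\<And>X i j k. X \<in> U \<Longrightarrow> (i, j, k) \<in> {(1, 2, 3), (1, 2, 4), (1, 3, 4), (2, 3, 4)} \<Longrightarrow> trivector P P X i j k = 0"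
  shows "poisson_on U P"
proof -
  have "poisson_on U (lin_comb 1 P 0 P)"
    by (rule poisson_on_lin_comb[OF assms(1) P P]) (simp only: assms(3), simp)
  moreover have "lin_comb 1 P 0 P = P" by (simp add: lin_comb_def fun_eq_iff vec_eq_iff)
  ultimately show ?thesis by simp
qed

lemma poisson_omega: "poisson_on dom_omega omega"
  by (rule poisson_onI_trivector[OF open_dom_omega skew_holomorphic_omega]) (auto simp: trivector_omega_omega)

lemma holomorphic_Ham: "U \<subseteq> {X. X$1 \<noteq> 0} \<Longrightarrow> holomorphic_Cn_on Ham U"
  by (rule holomorphic_Cn_onI) (use grad4_Ham in blast)

lemma hamiltonian_omega: "hamiltonian_on dom_omega system_S omega Ham"
  unfolding hamiltonian_on_def
  using poisson_omega Ham_flow_omega by (auto intro!: holomorphic_Ham simp: dom_omega_def)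

lemma det_omega: "det (omega X) = 0"
  unfolding omega_eq_skew4 det_skew4_eq_0_iff by simp

lemma cpoly_fun_uminus: "cpoly_fun p \<Longrightarrow> cpoly_fun (\<lambda>X. - p X)"
  using cpoly_fun.mult[OF cpoly_fun.const[of "-1"]] by simp

lemma cpoly_fun_diff: "cpoly_fun p \<Longrightarrow> cpoly_fun q \<Longrightarrow> cpoly_fun (\<lambda>X. p X - q X)"
  using cpoly_fun.add[OF _ cpoly_fun_uminus] by simp

lemma cpoly_fun_power: "cpoly_fun p \<Longrightarrow> cpoly_fun (\<lambda>X. p X ^ n)"
  by (induction n) (auto intro: cpoly_fun.intros)

lemmas cpoly_fun_intros = cpoly_fun.intros cpoly_fun_uminus cpoly_fun_diff cpoly_fun_power

lemma rational_omega: "rational_on (\<lambda>X. omega X $ i $ j) dom_omega"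
proof -
  have quotient: "rational_on (\<lambda>X. (X$1)^3 * (inverse ((X$2)\<^sup>2 - (X$3)\<^sup>2) * V X)) dom_omega"
    if "cpoly_fun V" for V :: "complex^4 \<Rightarrow> complex"
    unfolding rational_on_def
  proof (intro exI conjI ballI)
    show "cpoly_fun (\<lambda>X. (X$1)^3 * V X)" using that by (intro cpoly_fun_intros)
    show "cpoly_fun (\<lambda>X :: complex^4. (X$2)\<^sup>2 - (X$3)\<^sup>2)" by (intro cpoly_fun_intros)
  qed (auto simp: dom_omega_def divide_inverse)
  have V: "cpoly_fun V_y" "cpoly_fun V_z" "cpoly_fun V_u"
    unfolding V_y_def[abs_def] V_z_def[abs_def] V_u_def[abs_def] by (intro cpoly_fun_intros)+
  have zero: "rational_on (\<lambda>X. 0) dom_omega"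
    unfolding rational_on_def by (intro exI[of _ "\<lambda>X. 0"] exI[of _ "\<lambda>X. 1"]) (auto intro: cpoly_fun_intros)
  have neg: "rational_on (\<lambda>X. - f X) dom_omega" if "rational_on f dom_omega" for f :: "complex^4 \<Rightarrow> complex"
    using that cpoly_fun_uminus unfolding rational_on_def by (metis minus_divide_left)
  show ?thesis
    unfolding omega_eq_skew4 using exhaust_4[of i] exhaust_4[of j]
    by (elim disjE) (simp_all only: skew4_nth zero neg quotient V)
qed

lemma open_axis_perturbation:
  fixes X :: "complex^'n"
  assumes "open W" "X \<in> W"
  obtains r where "0 < r" "\<And>i t. norm t < r \<Longrightarrow> X + axis i t \<in> W"
proof -
  obtain r where "0 < r" "ball X r \<subseteq> W" using assms openE by blast
  then show ?thesis using that by (auto simp: subset_iff dist_norm norm_axis_eq)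
qed

lemma open_generic_coordinate:
  fixes W :: "(complex^'n) set"
  assumes "open W" "W \<noteq> {}"
  obtains X where "X \<in> W" "X $ i \<noteq> 0"
proof -
  obtain X where X: "X \<in> W" using assms by blast
  obtain r where r: "0 < r" "\<And>i t. norm t < r \<Longrightarrow> X + axis i t \<in> W"
    using open_axis_perturbation[OF assms(1) X] by blast
  show ?thesis
  proof (cases "X $ i = 0")
    case True
    have "X + axis i (of_real (r/2)) \<in> W" using r by (intro r(2)) simp
    moreover have "(X + axis i (of_real (r/2))) $ i \<noteq> 0" using True r(1) by (simp add: axis_def)
    ultimately show ?thesis using that by blast
  qed (use X that in blast)
qed

context elliptic_pair
begin

lemma poisson_omega_t: "poisson_on (dom_omega_t D K) (omega_t K E)"
  by (rule poisson_onI_trivector[OF open_dom skew_holomorphic_omega_t]) (auto simp: trivector_omega_t_omega_t)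

lemma open_dom_both: "open (dom_omega \<inter> dom_omega_t D K)"
  by (intro open_Int open_dom_omega open_dom)

lemma poisson_pencil: "poisson_on (dom_omega \<inter> dom_omega_t D K) (lin_comb a omega b (omega_t K E))"
proof (rule poisson_on_lin_comb[OF open_dom_both])
  show "skew_holomorphic_on (dom_omega \<inter> dom_omega_t D K) omega"
    by (rule skew_holomorphic_on_subset[OF skew_holomorphic_omega]) simp
  show "skew_holomorphic_on (dom_omega \<inter> dom_omega_t D K) (omega_t K E)"
    by (rule skew_holomorphic_on_subset[OF skew_holomorphic_omega_t]) simp
  fix X and i j k :: 4
  assume "X \<in> dom_omega \<inter> dom_omega_t D K" "(i, j, k) \<in> {(1, 2, 3), (1, 2, 4), (1, 3, 4), (2, 3, 4)}"
  then show "a * a * trivector omega omega X i j k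
      + a * b * (trivector omega (omega_t K E) X i j k + trivector (omega_t K E) omega X i j k)
      + b * b * trivector (omega_t K E) (omega_t K E) X i j k = 0"
    by (auto simp: trivector_omega_omega trivector_omega_omega_t trivector_omega_t_omega_t)
qed

lemma poisson_omega_both: "poisson_on (dom_omega \<inter> dom_omega_t D K) omega"
proof -
  have "lin_comb 1 omega 0 (omega_t K E) = omega" by (simp add: lin_comb_def fun_eq_iff vec_eq_iff)
  with poisson_pencil[of 1 0] show ?thesis by simp
qed

lemma poisson_omega_t_both: "poisson_on (dom_omega \<inter> dom_omega_t D K) (omega_t K E)"
proof -
  have "lin_comb 0 omega 1 (omega_t K E) = omega_t K E" by (simp add: lin_comb_def fun_eq_iff vec_eq_iff)
  with poisson_pencil[of 0 1] show ?thesis by simp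
qed

lemma poisson_Omega: "poisson_on (dom_omega \<inter> dom_omega_t D K) (Omega l K E)"
  unfolding Omega_def by (rule poisson_pencil)

lemma compatible_omega_omega_t: "compatible_on (dom_omega \<inter> dom_omega_t D K) omega (omega_t K E)"
  unfolding compatible_on_def using poisson_omega_both poisson_omega_t_both poisson_pencil by blast

lemma lin_comb_Omega: "lin_comb a omega b (Omega l K E) = lin_comb (a + b) omega (b * l) (omega_t K E)"
  by (simp add: Omega_def lin_comb_def fun_eq_iff vec_eq_iff algebra_simps)

lemma det_omega_t:
  assumes X: "X \<in> dom_omega_t D K"
  shows "det (omega_t K E X) = 0"
  unfolding omega_t_normal[OF X] det_skew4_eq_0_iff g12_def g13_def g14_def g23_def g24_def g34_def by algebra

lemma Omega_normal:
  fixes X :: "complex^4"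
  assumes X: "X \<in> dom_omega_t D K"
  defines "x \<equiv> X$1" and "y \<equiv> X$2" and "k \<equiv> X$3 / X$2" and "f \<equiv> (X$1)^3 * inverse ((X$2)\<^sup>2 - (X$3)\<^sup>2)"
  shows "Omega l K E X = skew4 (f * V_y X + l * (two_over_pi * (x * y * g12 k))) (f * V_z X + l * (two_over_pi * (x * y * g13 k)))
     (f * V_u X + l * (two_over_pi * (x * y\<^sup>2 * g14 k))) (l * (two_over_pi * (y\<^sup>2 * g23 k))) (l * (two_over_pi * (y^3 * g24 k))) (l * (two_over_pi * (y^3 * g34 k)))"
  unfolding Omega_def lin_comb_def x_def y_def k_def f_def
  by (simp add: vec_eq_iff forall_4 omega_nth omega_t_nth[OF X] skew4_nth)

text \<open>Neither bracket contributes alone, as both Pfaffians vanish; only the mixed terms remain, and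
  they have the common factor \<open>\<lambda> x\<^sup>3 y\<^sup>2 / (y\<^sup>2 - z\<^sup>2)\<close>.\<close>

lemma pfaffian_Omega:
  fixes X :: "complex^4"
  assumes X: "X \<in> dom_omega_t D K"
  defines "y \<equiv> X$2" and "k \<equiv> X$3 / X$2" and "f \<equiv> (X$1)^3 * inverse ((X$2)\<^sup>2 - (X$3)\<^sup>2)"
  shows "det (Omega l K E X) = 0 \<longleftrightarrow>
     l * two_over_pi * f * y\<^sup>2 * (V_y X * y * g34 k - V_z X * y * g24 k + V_u X * g23 k) = 0"
proof -
  have "(f * V_y X + l * (two_over_pi * (X$1 * y * g12 k))) * (l * (two_over_pi * (y^3 * g34 k)))
      - (f * V_z X + l * (two_over_pi * (X$1 * y * g13 k))) * (l * (two_over_pi * (y^3 * g24 k)))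
      + (f * V_u X + l * (two_over_pi * (X$1 * y\<^sup>2 * g14 k))) * (l * (two_over_pi * (y\<^sup>2 * g23 k)))
      = l * two_over_pi * f * y\<^sup>2 * (V_y X * y * g34 k - V_z X * y * g24 k + V_u X * g23 k)"
    unfolding g12_def g13_def g14_def g23_def g24_def g34_def by algebra
  then show ?thesis
    unfolding Omega_normal[OF X] det_skew4_eq_0_iff y_def k_def f_def by simp
qed

lemma g23_nonzero:
  assumes X: "X \<in> dom_omega" "X \<in> dom_omega_t D K" and z: "X$3 \<noteq> 0"
  shows "g23 (X$3 / X$2) \<noteq> 0"
proof -
  note dom = dom_omega_tD[OF X(2)]
  have "(X$3 / X$2)\<^sup>2 \<noteq> 1" using X(1) dom(1) by (auto simp: dom_omega_def power_divide)
  then show ?thesis using dom z by (simp add: g23_def)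
qed

text \<open>In the Pfaffian \<open>u\<close> occurs only through \<open>V\<^sub>y\<close> and \<open>V\<^sub>z\<close>, which are linear, and through \<open>V\<^sub>u\<close>, which
  is quadratic. So the coefficient of \<open>u\<^sup>2\<close> is a nonzero multiple of \<open>g23 (z / y)\<close>, and this is nonzero
  as soon as \<open>z \<noteq> 0\<close>.\<close>

lemma det_Omega_generic:
  assumes l: "l \<noteq> 0" and W: "open W" "W \<noteq> {}" "W \<subseteq> dom_omega \<inter> dom_omega_t D K"
  shows "\<exists>X\<in>W. det (Omega l K E X) \<noteq> 0"
proof (rule ccontr)
  assume "\<not> (\<exists>X\<in>W. det (Omega l K E X) \<noteq> 0)"
  then have zero: "det (Omega l K E X) = 0" if "X \<in> W" for X using that by blast
  obtain X where X: "X \<in> W" "X $ 3 \<noteq> 0" using open_generic_coordinate[OF W(1,2)] by blast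
  obtain r where r: "0 < r" "\<And>i t. norm t < r \<Longrightarrow> X + axis i t \<in> W"
    using open_axis_perturbation[OF W(1) X(1)] by blast
  have dom: "Y \<in> dom_omega" "Y \<in> dom_omega_t D K" if "Y \<in> W" for Y using W(3) that by auto
  define f where "f = (X$1)^3 * inverse ((X$2)\<^sup>2 - (X$3)\<^sup>2)"
  have f: "f \<noteq> 0" using dom(1)[OF X(1)] by (auto simp: f_def dom_omega_def)
  have y: "X$2 \<noteq> 0" using dom_omega_tD[OF dom(2)[OF X(1)]] by simp
  define h where "h Y = V_y Y * X$2 * g34 (X$3 / X$2) - V_z Y * X$2 * g24 (X$3 / X$2) + V_u Y * g23 (X$3 / X$2)" for Y
  have h: "h (X + axis 4 t) = 0" if "norm t < r" for t
  proof -
    have "X + axis 4 t \<in> W" using r(2) that by blast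
    from zero[OF this, unfolded pfaffian_Omega[OF dom(2)[OF this]]] l f y show ?thesis
      by (simp add: h_def axis_def f_def two_over_pi_def)
  qed
  define t where "t = complex_of_real (r/2)"
  have t: "norm t < r" "norm (- t) < r" "norm (0::complex) < r" "t \<noteq> 0" using r(1) by (auto simp: t_def)
  \<comment> \<open>The second difference in \<open>u\<close> isolates the quadratic coefficient.\<close>
  have "h (X + axis 4 t) + h (X + axis 4 (- t)) - 2 * h (X + axis 4 0) = 2 * t\<^sup>2 * g23 (X$3 / X$2)"
    unfolding h_def V_y_def V_z_def V_u_def by (simp add: axis_def algebra_simps power2_eq_square)
  then have "2 * t\<^sup>2 * g23 (X$3 / X$2) = 0" using h[OF t(1)] h[OF t(2)] h[OF t(3)] by simp
  then show False using t(4) g23_nonzero[OF dom[OF X(1)] X(2)] by simp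
qed

lemma casimir_Ham: "casimir_on ({X. X$1 \<noteq> 0} \<inter> dom_omega_t D K) (omega_t K E) Ham"
  unfolding casimir_on_def using Ham_casimir_omega_t by (auto intro!: holomorphic_Ham)

lemma hamiltonian_omega_both: "hamiltonian_on (dom_omega \<inter> dom_omega_t D K) system_S omega Ham"
  unfolding hamiltonian_on_def
  using poisson_omega_both Ham_flow_omega by (auto intro!: holomorphic_Ham simp: dom_omega_def)

lemma hamiltonian_Omega: "hamiltonian_on (dom_omega \<inter> dom_omega_t D K) system_S (Omega l K E) Ham"
  unfolding hamiltonian_on_def
proof (intro conjI ballI poisson_Omega holomorphic_Ham)
  fix X assume X: "X \<in> dom_omega \<inter> dom_omega_t D K"
  have "Omega l K E X = omega X + (\<chi> i. l *s omega_t K E X $ i)"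
    by (simp add: Omega_def lin_comb_def vec_eq_iff)
  moreover have "(\<chi> i. l *s omega_t K E X $ i) *v v = l *s (omega_t K E X *v v)" for v
    by (simp add: vec_eq_iff matrix_vector_4 algebra_simps)
  ultimately have "Omega l K E X *v cgrad Ham X = omega X *v cgrad Ham X + l *s (omega_t K E X *v cgrad Ham X)"
    by (simp add: matrix_vector_mult_add_rdistrib)
  also have "\<dots> = system_S X"
    using Ham_flow_omega Ham_casimir_omega_t X by (auto simp: dom_omega_def)
  finally show "system_S X = Omega l K E X *v cgrad Ham X" ..
qed (auto simp: dom_omega_def)

text \<open>\<open>H\<close> is a Casimir function of \<open>\<omega>\<^sub>t\<close>, so it generates the same flow for \<open>\<omega>\<close> and for \<open>\<Omega>\<close>. The
  brackets are independent: the entry \<open>(2, 3)\<close> belongs to \<open>\<omega>\<^sub>t\<close> only, and \<open>V\<^sub>y\<close> depends on \<open>u\<close>.\<close>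

lemma bi_hamiltonian_Omega:
  assumes l: "l \<noteq> 0" and ne: "dom_omega \<inter> dom_omega_t D K \<noteq> {}"
  shows "bi_hamiltonian_on (dom_omega \<inter> dom_omega_t D K) system_S omega Ham (Omega l K E) Ham"
  unfolding bi_hamiltonian_on_def compatible_on_def lin_comb_Omega
proof (intro conjI allI impI poisson_omega_both poisson_Omega poisson_pencil hamiltonian_omega_both hamiltonian_Omega)
  fix a b
  let ?U = "dom_omega \<inter> dom_omega_t D K"
  assume zero: "\<forall>X\<in>?U. lin_comb (a + b) omega (b * l) (omega_t K E) X = 0"
  obtain X where X: "X \<in> ?U" "X $ 3 \<noteq> 0" using open_generic_coordinate[OF open_dom_both ne] by blast
  obtain r where r: "0 < r" "\<And>i t. norm t < r \<Longrightarrow> X + axis i t \<in> ?U"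
    using open_axis_perturbation[OF open_dom_both X(1)] by blast
  have entry: "(a + b) * omega Y $ i $ j + b * l * omega_t K E Y $ i $ j = 0" if "Y \<in> ?U" for Y i j
    using bspec[OF zero that] by (simp add: lin_comb_def vec_eq_iff)
  have y: "X$2 \<noteq> 0" using dom_omega_tD X by blast
  show b: "b = 0"
    using entry[OF X(1), of 2 3] l y g23_nonzero[of X] X omega_t_nth(7)[of X] by (simp add: omega_nth two_over_pi_def)
  define f where "f = (X$1)^3 * inverse ((X$2)\<^sup>2 - (X$3)\<^sup>2)"
  have f: "f \<noteq> 0" using X by (auto simp: f_def dom_omega_def)
  define t where "t = complex_of_real (r/2)"
  have "X + axis 4 t \<in> ?U" "t \<noteq> 0" using r by (auto simp: t_def)
  have "a * (f * V_y (X + axis 4 t)) = 0" "a * (f * V_y X) = 0"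
    using entry[OF \<open>X + axis 4 t \<in> ?U\<close>, of 1 2] entry[OF X(1), of 1 2] b
    by (auto simp: omega_nth f_def axis_def)
  then have "a * f * (V_y (X + axis 4 t) - V_y X) = 0" by auto
  moreover have "V_y (X + axis 4 t) - V_y X = t * X$2" by (simp add: V_y_def axis_def algebra_simps)
  ultimately show "a = 0" using f y \<open>t \<noteq> 0\<close> by simp
qed

end

lemma KE_branch_elliptic_pair: "KE_branch D K E \<Longrightarrow> elliptic_pair D K E"
  using KE_branch_region KE_branch_ode by unfold_locales blast+

text \<open>A branch of \<open>K\<close> that vanished identically would force \<open>K(0) = 0\<close>, but \<open>K(0) = \<pi>/2\<close>.\<close>

lemma KE_branch_nonzero:
  assumes "KE_branch D K E"
  shows "\<exists>k\<in>D. K k \<noteq> 0"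
proof -
  have "(\<forall>k\<in>D. K k = 0) \<longleftrightarrow> (\<forall>k\<in>K_region. ellipticK k = 0)"
    by (rule continuation_identity_iff[OF KE_branch_continuation[OF assms] open_K_region connected_K_region
          K_region_nonempty ellipticK_holomorphic ellipticE_holomorphic]) auto
  moreover have "0 \<in> K_region" "ellipticK 0 \<noteq> 0" by (simp_all add: K_region_def ellipticK_zero)
  ultimately show ?thesis by blast
qed

lemma dom_point:
  assumes "k \<in> D" "K k \<noteq> 0" "k\<^sup>2 \<noteq> 1"
  shows "vector [1, 1, k, 0] \<in> dom_omega \<inter> dom_omega_t D K"
  using assms by (auto simp: dom_omega_def dom_omega_t_def dom_ell_def vector_4_nth)

lemma KE_branch_generic:
  assumes "KE_branch D K E"
  obtains k where "k \<in> D" "K k \<noteq> 0" "k\<^sup>2 \<noteq> 1"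
proof -
  have "open {k \<in> D. K k \<noteq> 0}"
    by (intro open_nonzero holomorphic_on_imp_continuous_on KE_branch_region[OF assms])
  moreover have "{k \<in> D. K k \<noteq> 0} \<noteq> {}" using KE_branch_nonzero[OF assms] by blast
  ultimately have "infinite {k \<in> D. K k \<noteq> 0}" using finite_imp_not_open by blast
  then have "{k \<in> D. K k \<noteq> 0} - {1, - 1} \<noteq> {}"
    by (intro infinite_imp_nonempty Diff_infinite_finite) auto
  then obtain k where "k \<in> {k \<in> D. K k \<noteq> 0}" "k \<notin> {1, - 1}" by blast
  then show ?thesis using that by (auto simp: power2_eq_1_iff)
qed

text \<open>Needed because on an empty set the two brackets would be linearly dependent.\<close>

lemma KE_branch_dom_nonempty:
  assumes "KE_branch D K E"
  shows "dom_omega \<inter> dom_omega_t D K \<noteq> {}"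
proof -
  obtain k where "k \<in> D" "K k \<noteq> 0" "k\<^sup>2 \<noteq> 1" using KE_branch_generic[OF assms] .
  from dom_point[of k D K, OF this] show ?thesis by blast
qed

section \<open>Transcendence\<close>

text \<open>A function \<open>c\<close> that tends to infinity more slowly than every power of \<open>1 / (k - 1)\<close>, for
  \<open>k\<close> tending to 1, satisfies no polynomial relation over \<open>k\<close>. Divide the relation by the highest power
  of \<open>k - 1\<close> common to all coefficients, and then by the highest power \<open>c\<^sup>m\<close> whose remaining coefficient
  does not vanish at 1: every other term tends to 0, those above \<open>m\<close> because the vanishing
  coefficient beats every power of \<open>c\<close>.\<close>

lemma no_polynomial_relation_of_logarithmic_growth:
  fixes c k :: "real \<Rightarrow> complex" and p :: "nat \<Rightarrow> complex poly"
  assumes k: "(k \<longlongrightarrow> 1) at_top" "\<And>s. k s \<noteq> 1"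
    and c: "filterlim c at_infinity at_top" and slow: "\<And>j. ((\<lambda>s. (k s - 1) * c s ^ j) \<longlongrightarrow> 0) at_top"
    and nonzero: "i0 \<le> n" "p i0 \<noteq> 0"
    and rel: "\<forall>\<^sub>F s in at_top. (\<Sum>i\<le>n. poly (p i) (k s) * c s ^ i) = 0"
  shows False
proof -
  let ?N = "{i. i \<le> n \<and> p i \<noteq> 0}"
  have fin: "finite ?N" and ne: "?N \<noteq> {}" using nonzero by auto
  \<comment> \<open>\<open>d\<close> is the order to which all coefficients vanish at 1; \<open>m\<close> below is the top power of \<open>c\<close> after division.\<close>
  define d where "d = Min ((\<lambda>i. order 1 (p i)) ` ?N)"
  have d_le: "d \<le> order 1 (p i)" if "i \<in> ?N" for i
    unfolding d_def using fin that by (intro Min_le) auto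
  have "d \<in> (\<lambda>i. order 1 (p i)) ` ?N" unfolding d_def using fin ne by (intro Min_in) auto
  then obtain i1 where i1: "i1 \<le> n" "p i1 \<noteq> 0" "order 1 (p i1) = d" by auto
  have "[:-1, 1:] ^ d dvd p i" if "i \<le> n" for i
    using d_le[of i] that by (auto simp: order_divides)
  then have "\<exists>q. p i = [:-1, 1:] ^ d * q" if "i \<le> n" for i using that by (auto elim: dvdE)
  then obtain q where q: "\<And>i. i \<le> n \<Longrightarrow> p i = [:-1, 1:] ^ d * q i" by metis
  have q1: "poly (q i1) 1 \<noteq> 0"
  proof
    assume "poly (q i1) 1 = 0"
    then have "[:-1, 1:] dvd q i1" by (simp add: poly_eq_0_iff_dvd)
    then have "[:-1, 1:] ^ Suc d dvd p i1"
      unfolding q[OF i1(1)] power_Suc2 by (intro mult_dvd_mono dvd_refl)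
    then show False using i1 by (simp add: order_divides del: power_Suc)
  qed
  define m where "m = Max {i. i \<le> n \<and> poly (q i) 1 \<noteq> 0}"
  have "m \<in> {i. i \<le> n \<and> poly (q i) 1 \<noteq> 0}" unfolding m_def using i1 q1 by (intro Max_in) auto
  then have m: "m \<le> n" "poly (q m) 1 \<noteq> 0" by auto
  have above_m: "poly (q i) 1 = 0" if "m < i" "i \<le> n" for i
  proof (rule ccontr)
    assume "poly (q i) 1 \<noteq> 0"
    then have "i \<le> m" unfolding m_def using that by (intro Max_ge) auto
    with that show False by simp
  qed
  have inv_c: "((\<lambda>s. inverse (c s)) \<longlongrightarrow> 0) at_top"
    using c by (rule filterlim_compose[OF tendsto_inverse_0])
  have c_nz: "\<forall>\<^sub>F s in at_top. c s \<noteq> 0"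
    using c by (rule filterlim_at_infinity_imp_eventually_ne)
  have term_limit: "((\<lambda>s. poly (q i) (k s) * c s ^ i * inverse (c s) ^ m) \<longlongrightarrow> (if i = m then poly (q m) 1 else 0)) at_top"
    if "i \<le> n" for i
  proof (cases i m rule: linorder_cases)
    case less
    have "((\<lambda>s. poly (q i) (k s) * inverse (c s) ^ (m - i)) \<longlongrightarrow> poly (q i) 1 * 0 ^ (m - i)) at_top"
      by (intro tendsto_intros k inv_c)
    moreover have "\<forall>\<^sub>F s in at_top. poly (q i) (k s) * inverse (c s) ^ (m - i) = poly (q i) (k s) * c s ^ i * inverse (c s) ^ m"
      using c_nz
    proof eventually_elim
      case (elim s)
      have "inverse (c s) ^ m = inverse (c s) ^ (m - i) * inverse (c s) ^ i"
        using less by (simp flip: power_add)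
      with elim show ?case by (simp add: field_simps)
    qed
    ultimately show ?thesis using less by (auto intro: Lim_transform_eventually simp: power_0_left)
  next
    case equal
    have "((\<lambda>s. poly (q i) (k s)) \<longlongrightarrow> poly (q i) 1) at_top" by (intro tendsto_intros k)
    moreover have "\<forall>\<^sub>F s in at_top. poly (q i) (k s) = poly (q i) (k s) * c s ^ i * inverse (c s) ^ m"
      using c_nz by eventually_elim (simp add: equal power_inverse)
    ultimately show ?thesis using equal by (auto intro: Lim_transform_eventually)
  next
    case greater
    then have "[:-1, 1:] dvd q i" using above_m[of i] that by (simp add: poly_eq_0_iff_dvd)
    then obtain r where r: "q i = [:-1, 1:] * r" by (auto elim: dvdE)
    have "((\<lambda>s. poly r (k s) * ((k s - 1) * c s ^ (i - m))) \<longlongrightarrow> poly r 1 * 0) at_top"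
      by (intro tendsto_mult tendsto_poly k slow)
    moreover have "\<forall>\<^sub>F s in at_top. poly r (k s) * ((k s - 1) * c s ^ (i - m)) = poly (q i) (k s) * c s ^ i * inverse (c s) ^ m"
      using c_nz
    proof eventually_elim
      case (elim s)
      have "c s ^ i = c s ^ (i - m) * c s ^ m"
        using greater by (simp flip: power_add)
      with elim show ?case by (simp add: r field_simps)
    qed
    ultimately show ?thesis using greater by (auto intro: Lim_transform_eventually)
  qed
  have "((\<lambda>s. \<Sum>i\<le>n. poly (q i) (k s) * c s ^ i * inverse (c s) ^ m) \<longlongrightarrow> (\<Sum>i\<le>n. if i = m then poly (q m) 1 else 0)) at_top"
    using term_limit by (intro tendsto_sum) auto
  also have "(\<Sum>i\<le>n. if i = m then poly (q m) 1 else 0) = poly (q m) 1"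
    using m(1) by simp
  finally have lim: "((\<lambda>s. \<Sum>i\<le>n. poly (q i) (k s) * c s ^ i * inverse (c s) ^ m) \<longlongrightarrow> poly (q m) 1) at_top" .
  have "\<forall>\<^sub>F s in at_top. (\<Sum>i\<le>n. poly (q i) (k s) * c s ^ i * inverse (c s) ^ m) = 0"
    using rel
  proof eventually_elim
    case (elim s)
    have "(\<Sum>i\<le>n. poly (p i) (k s) * c s ^ i) = (k s - 1) ^ d * (\<Sum>i\<le>n. poly (q i) (k s) * c s ^ i)"
      unfolding sum_distrib_left by (intro sum.cong refl) (simp add: q)
    with elim k(2)[of s] have "(\<Sum>i\<le>n. poly (q i) (k s) * c s ^ i) = 0" by simp
    then show ?case by (simp flip: sum_distrib_right)
  qed
  then have "((\<lambda>s :: real. 0 :: complex) \<longlongrightarrow> poly (q m) 1) at_top"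
    using lim by (rule tendsto_cong[THEN iffD1])
  then have "poly (q m) 1 = 0" by (simp add: tendsto_const_iff)
  with m show False by simp
qed

lemma ellipticK_ellipticE_real:
  assumes "0 \<le> t" "t < 1"
  shows "ellipticK (of_real t) \<in> \<real>" and "ellipticE (of_real t) \<in> \<real>"
    and "1 \<le> Re (ellipticE (of_real t))" and "Re (ellipticE (of_real t)) \<le> pi/2"
proof -
  define m where "m = t\<^sup>2"
  have m: "0 \<le> m" "m < 1" using assms by (auto simp: m_def abs_square_less_1)
  have slit: "complex_of_real m \<in> slit_plane" using m by (simp add: slit_plane_def)
  have slit': "(complex_of_real t)\<^sup>2 \<in> slit_plane" using slit by (simp add: m_def)
  have bounds: "(cos \<theta>)\<^sup>2 \<le> 1 - m * (sin \<theta>)\<^sup>2" "1 - m * (sin \<theta>)\<^sup>2 \<le> 1" for \<theta>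
    using m mult_right_mono[of m 1 "(sin \<theta>)\<^sup>2"] by (auto simp: cos_squared_eq)
  have nn: "0 \<le> 1 - m * (sin \<theta>)\<^sup>2" for \<theta> using bounds(1)[of \<theta>] zero_le_power2[of "cos \<theta>"] by linarith
  have Delta: "Delta (of_real m) \<theta> = of_real (sqrt (1 - m * (sin \<theta>)\<^sup>2))" for \<theta>
    unfolding Delta_def radicand_real using csqrt_of_real[OF nn[of \<theta>]] by simp
  have pos: "0 < 1 - m * (sin \<theta>)\<^sup>2" for \<theta>
    using Delta_nonzero[OF slit, of \<theta>] nn[of \<theta>] unfolding Delta by (simp add: less_le)
  have cont: "continuous_on {0..pi/2} (\<lambda>\<theta>. sqrt (1 - m * (sin \<theta>)\<^sup>2))" by (intro continuous_intros)
  have "((\<lambda>\<theta>. 1 / sqrt (1 - m * (sin \<theta>)\<^sup>2)) has_integral integral {0..pi/2} (\<lambda>\<theta>. 1 / sqrt (1 - m * (sin \<theta>)\<^sup>2))) {0..pi/2}"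
    using pos by (intro integrable_integral integrable_continuous_real continuous_intros) (auto simp: less_imp_neq[THEN not_sym])
  from has_integral_of_real[OF this, where 'b = complex]
  have "K_par (of_real m) = of_real (integral {0..pi/2} (\<lambda>\<theta>. 1 / sqrt (1 - m * (sin \<theta>)\<^sup>2)))"
    unfolding K_par_def Delta by (simp add: integral_unique)
  then show "ellipticK (of_real t) \<in> \<real>"
    using ellipticK_eq_K_par[OF slit'] by (simp add: m_def)
  have int: "((\<lambda>\<theta>. sqrt (1 - m * (sin \<theta>)\<^sup>2)) has_integral integral {0..pi/2} (\<lambda>\<theta>. sqrt (1 - m * (sin \<theta>)\<^sup>2))) {0..pi/2}"
    by (intro integrable_integral integrable_continuous_real cont)
  from has_integral_of_real[OF this, where 'b = complex]
  have "E_par (of_real m) = of_real (integral {0..pi/2} (\<lambda>\<theta>. sqrt (1 - m * (sin \<theta>)\<^sup>2)))"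
    unfolding E_par_def Delta[abs_def] by (simp add: integral_unique)
  then have E: "ellipticE (of_real t) = of_real (integral {0..pi/2} (\<lambda>\<theta>. sqrt (1 - m * (sin \<theta>)\<^sup>2)))"
    using ellipticE_eq_E_par[OF slit'] by (simp add: m_def)
  then show "ellipticE (of_real t) \<in> \<real>" by simp
  have "(cos has_integral sin (pi/2) - sin 0) {0..pi/2}"
    by (rule fundamental_theorem_of_calculus)
       (auto intro!: derivative_eq_intros simp flip: has_real_derivative_iff_has_vector_derivative)
  then have cos: "(cos has_integral 1) {0..pi/2}" by simp
  have "1 \<le> integral {0..pi/2} (\<lambda>\<theta>. sqrt (1 - m * (sin \<theta>)\<^sup>2))"
    by (rule has_integral_le[OF cos int]) (use bounds in \<open>auto intro: real_le_rsqrt\<close>)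
  then show "1 \<le> Re (ellipticE (of_real t))" by (simp add: E)
  have one: "((\<lambda>_. 1 :: real) has_integral pi/2) {0..pi/2}"
    using has_integral_const_real[of "1 :: real" 0 "pi/2"] by simp
  have "integral {0..pi/2} (\<lambda>\<theta>. sqrt (1 - m * (sin \<theta>)\<^sup>2)) \<le> pi/2"
    by (rule has_integral_le[OF int one]) (use bounds in auto)
  then show "Re (ellipticE (of_real t)) \<le> pi/2" by (simp add: E)
qed

text \<open>By the differential equation the derivative of \<open>tanh s * K (tanh s)\<close> is \<open>E (tanh s)\<close>, which lies
  between 1 and \<open>\<pi>/2\<close>. So in terms of \<open>s\<close>, where \<open>1 - tanh s\<close> decays exponentially, \<open>K\<close> grows
  linearly; this is the logarithmic singularity at \<open>k = 1\<close>.\<close>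

lemma ellipticK_growth:
  assumes "0 \<le> s"
  shows "s \<le> tanh s * Re (ellipticK (of_real (tanh s)))" "tanh s * Re (ellipticK (of_real (tanh s))) \<le> pi/2 * s"
proof -
  define \<phi> where "\<phi> s = tanh s * Re (ellipticK (of_real (tanh s)))" for s :: real
  have deriv: "(\<phi> has_real_derivative Re (ellipticE (of_real (tanh s)))) (at s)" if "0 \<le> s" for s
  proof -
    have t: "0 \<le> tanh s" "tanh s < 1" using that by (auto simp: tanh_real_lt_1)
    then have K: "complex_of_real (tanh s) \<in> K_region" by (auto simp: K_region_def)
    note d = holomorphic_derivI[OF ellipticK_holomorphic open_K_region K]
    define D where "D = deriv ellipticK (of_real (tanh s))"
    have "((\<lambda>t. ellipticK (of_real t)) has_vector_derivative D) (at (tanh s))"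
      unfolding D_def using d by (rule has_vector_derivative_real_field)
    then have "((\<lambda>t. Re (ellipticK (of_real t))) has_real_derivative Re D) (at (tanh s))"
      using bounded_linear.has_vector_derivative[OF bounded_linear_Re] by (simp add: has_real_derivative_iff_has_vector_derivative)
    moreover have tanh: "(tanh has_real_derivative 1 - (tanh s)\<^sup>2) (at s)"
      by (auto intro!: derivative_eq_intros)
    ultimately have K': "((\<lambda>s. Re (ellipticK (of_real (tanh s)))) has_real_derivative Re D * (1 - (tanh s)\<^sup>2)) (at s)"
      by (rule DERIV_chain2[where f = "\<lambda>t. Re (ellipticK (of_real t))"])
    have "(\<phi> has_real_derivative (1 - (tanh s)\<^sup>2) * Re (ellipticK (of_real (tanh s)))
        + Re D * (1 - (tanh s)\<^sup>2) * tanh s) (at s)"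
      unfolding \<phi>_def by (rule DERIV_mult[OF tanh K'])
    moreover have "(1 - (tanh s)\<^sup>2) * Re (ellipticK (of_real (tanh s)))
        + Re D * (1 - (tanh s)\<^sup>2) * tanh s = Re (ellipticE (of_real (tanh s)))"
    proof -
      have "of_real (tanh s * (1 - (tanh s)\<^sup>2)) * D = ellipticE (of_real (tanh s)) - of_real (1 - (tanh s)\<^sup>2) * ellipticK (of_real (tanh s))"
        using ellipticK_ode(1)[OF K] by (simp add: D_def)
      then have "Re (of_real (tanh s * (1 - (tanh s)\<^sup>2)) * D) = Re (ellipticE (of_real (tanh s)) - of_real (1 - (tanh s)\<^sup>2) * ellipticK (of_real (tanh s)))"
        by simp
      then have "tanh s * (1 - (tanh s)\<^sup>2) * Re D = Re (ellipticE (of_real (tanh s))) - (1 - (tanh s)\<^sup>2) * Re (ellipticK (of_real (tanh s)))"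
        by (simp only: Re_complex_of_real Im_complex_of_real times_complex.simps minus_complex.simps mult_zero_left diff_0_right)
      then show ?thesis by (simp add: algebra_simps)
    qed
    ultimately show ?thesis by simp
  qed
  have e: "1 \<le> Re (ellipticE (of_real (tanh s)))" "Re (ellipticE (of_real (tanh s))) \<le> pi/2" if "0 \<le> s" for s
    using ellipticK_ellipticE_real(3,4)[of "tanh s"] that by (auto simp: tanh_real_lt_1)
  have "(\<lambda>s. \<phi> s - s) 0 \<le> (\<lambda>s. \<phi> s - s) s"
  proof (rule DERIV_nonneg_imp_nondecreasing[OF assms])
    fix x :: real assume "0 \<le> x"
    then show "\<exists>y. ((\<lambda>s. \<phi> s - s) has_real_derivative y) (at x) \<and> 0 \<le> y"
      using DERIV_diff[OF deriv DERIV_ident, of x] e(1)[of x]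
      by (intro exI[of _ "Re (ellipticE (of_real (tanh x))) - 1"]) auto
  qed
  then show "s \<le> tanh s * Re (ellipticK (of_real (tanh s)))" by (simp add: \<phi>_def)
  have "(\<lambda>s. pi/2 * s - \<phi> s) 0 \<le> (\<lambda>s. pi/2 * s - \<phi> s) s"
  proof (rule DERIV_nonneg_imp_nondecreasing[OF assms])
    fix x :: real assume "0 \<le> x"
    then show "\<exists>y. ((\<lambda>s. pi/2 * s - \<phi> s) has_real_derivative y) (at x) \<and> 0 \<le> y"
      using DERIV_diff[OF DERIV_cmult_Id deriv, of x "pi/2"] e(2)[of x]
      by (intro exI[of _ "pi/2 - Re (ellipticE (of_real (tanh x)))"]) auto
  qed
  then show "tanh s * Re (ellipticK (of_real (tanh s))) \<le> pi/2 * s" by (simp add: \<phi>_def)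
qed

lemma ellipticK_norm_growth:
  assumes "1 \<le> s"
  shows "s \<le> norm (ellipticK (of_real (tanh s)))" "norm (ellipticK (of_real (tanh s))) \<le> pi * s"
proof -
  have t: "0 < tanh s" "tanh s < 1" using assms by (auto simp: tanh_real_lt_1)
  have half: "1/2 \<le> tanh s"
  proof -
    have "exp (- 2 * s) \<le> 1/3"
    proof -
      have "1 + 2 * s \<le> exp (2 * s)" by (rule exp_ge_add_one_self)
      moreover have "3 \<le> 1 + 2 * s" using assms by simp
      ultimately have "3 \<le> exp (2 * s)" by (rule order_trans[rotated])
      then show ?thesis by (simp add: exp_minus field_simps)
    qed
    moreover have "0 < exp (- 2 * s)" by simp
    moreover have "1/2 \<le> (1 - e) / (1 + e)" if "e \<le> 1/3" "0 < e" for e :: real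
      using that by (simp add: field_simps)
    ultimately show ?thesis unfolding tanh_real_altdef by blast
  qed
  note g = ellipticK_growth[of s]
  have "0 < tanh s * Re (ellipticK (of_real (tanh s)))" using g(1) assms by simp
  then have pos: "0 < Re (ellipticK (of_real (tanh s)))" using t by (simp add: zero_less_mult_iff)
  have norm: "norm (ellipticK (of_real (tanh s))) = Re (ellipticK (of_real (tanh s)))"
    using ellipticK_ellipticE_real(1)[of "tanh s"] t pos by (auto elim!: Reals_cases)
  have "tanh s * Re (ellipticK (of_real (tanh s))) \<le> 1 * Re (ellipticK (of_real (tanh s)))"
    using t pos by (intro mult_right_mono) auto
  then show "s \<le> norm (ellipticK (of_real (tanh s)))" using g(1) assms norm by simp
  have "1/2 * Re (ellipticK (of_real (tanh s))) \<le> tanh s * Re (ellipticK (of_real (tanh s)))"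
    using half pos by (intro mult_right_mono) auto
  then show "norm (ellipticK (of_real (tanh s))) \<le> pi * s" using g(2) assms norm by simp
qed

text \<open>On the curve \<open>k = tanh s\<close> the square of \<open>K\<close> tends to infinity, but at most like \<open>s\<^sup>2\<close>, while \<open>k - 1\<close> decays
  exponentially.\<close>

lemma ellipticK_square_transcendental:
  fixes p :: "nat \<Rightarrow> complex poly"
  assumes "i0 \<le> n" "p i0 \<noteq> 0"
    and rel: "\<And>k. k \<in> K_region \<Longrightarrow> (\<Sum>i\<le>n. poly (p i) k * ((ellipticK k)\<^sup>2) ^ i) = 0"
  shows False
proof (rule no_polynomial_relation_of_logarithmic_growth[where p = p and n = n and ?i0.0 = i0])
  let ?k = "\<lambda>s. complex_of_real (tanh s)"
  let ?c = "\<lambda>s. (ellipticK (?k s))\<^sup>2"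
  show "(?k \<longlongrightarrow> 1) at_top"
    using tendsto_of_real[OF tanh_real_at_top, where 'a = complex] by simp
  show "i0 \<le> n" "p i0 \<noteq> 0" by fact+
  show "?k s \<noteq> 1" for s using tanh_real_lt_1[of s] by (simp add: less_imp_neq)
  show "filterlim ?c at_infinity at_top"
  proof (rule filterlim_norm_at_top_imp_at_infinity, rule filterlim_at_top_mono)
    show "filterlim (\<lambda>s::real. s) at_top at_top" by (rule filterlim_ident)
    show "\<forall>\<^sub>F s in at_top. s \<le> norm (?c s)"
      using eventually_ge_at_top[of 1]
    proof eventually_elim
      case (elim s)
      have "s * 1 \<le> norm (ellipticK (?k s)) * norm (ellipticK (?k s))"
        using ellipticK_norm_growth(1)[OF elim] elim by (intro mult_mono) auto
      then show ?case by (simp add: norm_mult power2_eq_square)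
    qed
  qed
  show "((\<lambda>s. (?k s - 1) * ?c s ^ j) \<longlongrightarrow> 0) at_top" for j
  proof (rule Lim_null_comparison)
    show "\<forall>\<^sub>F s in at_top. norm ((?k s - 1) * ?c s ^ j) \<le> 2 * pi ^ (2 * j) * (s ^ (2 * j) / exp s)"
      using eventually_ge_at_top[of 1]
    proof eventually_elim
      case (elim s)
      have "norm (?k s - 1) = 1 - tanh s"
        using tanh_real_lt_1[of s] norm_of_real[of "tanh s - 1", where 'a = complex] by simp
      also have "\<dots> = 2 * exp (- 2 * s) / (1 + exp (- 2 * s))"
      proof -
        have "1 - (1 - e) / (1 + e) = 2 * e / (1 + e)" if "0 < e" for e :: real
          using that by (simp add: field_simps)
        then show ?thesis unfolding tanh_real_altdef by simp
      qed
      also have "\<dots> \<le> 2 * exp (- 2 * s) / 1" by (intro divide_left_mono) (auto intro: add_pos_pos)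
      also have "\<dots> \<le> 2 * exp (- s)" using elim by simp
      finally have 1: "norm (?k s - 1) \<le> 2 / exp s" by (simp add: exp_minus field_simps)
      have 2: "norm (ellipticK (?k s)) ^ (2 * j) \<le> (pi * s) ^ (2 * j)"
        using ellipticK_norm_growth(2)[OF elim] by (intro power_mono) auto
      have "norm ((?k s - 1) * ?c s ^ j) = norm (?k s - 1) * norm (ellipticK (?k s)) ^ (2 * j)"
        by (simp only: norm_mult norm_power power_mult)
      also have "\<dots> \<le> 2 / exp s * (pi * s) ^ (2 * j)"
        using 1 2 by (intro mult_mono) auto
      finally show ?case by (simp add: power_mult_distrib field_simps)
    qed
    have "((\<lambda>s::real. 2 * pi ^ (2 * j) * (s ^ (2 * j) / exp s)) \<longlongrightarrow> 2 * pi ^ (2 * j) * 0) at_top"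
      by (intro tendsto_mult tendsto_const tendsto_power_div_exp_0)
    then show "((\<lambda>s::real. 2 * pi ^ (2 * j) * (s ^ (2 * j) / exp s)) \<longlongrightarrow> 0) at_top" by simp
  qed
  show "\<forall>\<^sub>F s in at_top. (\<Sum>i\<le>n. poly (p i) (?k s) * ?c s ^ i) = 0"
    using eventually_ge_at_top[of "0::real"]
  proof eventually_elim
    case (elim s)
    then have "?k s \<in> K_region" using tanh_real_lt_1[of s] by (auto simp: K_region_def)
    then show ?case by (rule rel)
  qed
qed

text \<open>A relation on an open part of any branch is a relation for the defining integral.\<close>

lemma KE_branch_square_transcendental:
  fixes p :: "nat \<Rightarrow> complex poly"
  assumes br: "KE_branch D K E" and nz: "i0 \<le> n" "p i0 \<noteq> 0"
    and W: "open W" "W \<noteq> {}" "W \<subseteq> D"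
    and rel: "\<And>k. k \<in> W \<Longrightarrow> (\<Sum>i\<le>n. poly (p i) k * ((K k)\<^sup>2) ^ i) = 0"
  shows False
proof (rule ellipticK_square_transcendental[where p = p, OF nz])
  note reg = KE_branch_region[OF br]
  have "(\<lambda>k. \<Sum>i\<le>n. poly (p i) k * ((K k)\<^sup>2) ^ i) holomorphic_on D"
    using reg(4) by (intro holomorphic_intros)
  then have "(\<Sum>i\<le>n. poly (p i) k * ((K k)\<^sup>2) ^ i) = 0" if "k \<in> D" for k
    using analytic_continuation_open[OF W(1) reg(1) W(2) reg(2) W(3), of "\<lambda>k. \<Sum>i\<le>n. poly (p i) k * ((K k)\<^sup>2) ^ i" "\<lambda>_. 0" k]
      rel that by simp
  moreover have "(\<forall>k\<in>D. (\<Sum>i\<le>n. poly (p i) k * ((K k)\<^sup>2) ^ i) = 0) \<longleftrightarrow>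
      (\<forall>k\<in>K_region. (\<Sum>i\<le>n. poly (p i) k * ((ellipticK k)\<^sup>2) ^ i) = 0)"
    by (rule continuation_identity_iff[OF KE_branch_continuation[OF br] open_K_region connected_K_region
          K_region_nonempty ellipticK_holomorphic ellipticE_holomorphic])
       (auto intro!: holomorphic_intros)
  ultimately show "(\<Sum>i\<le>n. poly (p i) k * ((ellipticK k)\<^sup>2) ^ i) = 0" if "k \<in> K_region" for k
    using that by blast
qed

lemma cpoly_fun_on_line:
  fixes c :: "complex^4 \<Rightarrow> complex"
  assumes "cpoly_fun c"
  shows "\<exists>p. \<forall>k. c (vector [x, y, k * y, u]) = poly p k"
  using assms
proof induction
  case (const a)
  show ?case by (intro exI[of _ "[:a:]"]) simp
next
  case (coord i)
  have "\<exists>p. \<forall>k. (vector [x, y, k * y, u] :: complex^4) $ 1 = poly p k" by (intro exI[of _ "[:x:]"]) (simp add: vector_4_nth)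
  moreover have "\<exists>p. \<forall>k. (vector [x, y, k * y, u] :: complex^4) $ 2 = poly p k" by (intro exI[of _ "[:y:]"]) (simp add: vector_4_nth)
  moreover have "\<exists>p. \<forall>k. (vector [x, y, k * y, u] :: complex^4) $ 3 = poly p k" by (intro exI[of _ "[:0, y:]"]) (simp add: vector_4_nth)
  moreover have "\<exists>p. \<forall>k. (vector [x, y, k * y, u] :: complex^4) $ 4 = poly p k" by (intro exI[of _ "[:u:]"]) (simp add: vector_4_nth)
  ultimately show ?case using exhaust_4[of i] by (elim disjE) (simp_all only:)
next
  case (add p q)
  then show ?case by (metis poly_add)
next
  case (mult p q)
  then show ?case by (metis poly_mult)
qed

lemma cpoly_fun_continuous: "cpoly_fun c \<Longrightarrow> continuous_on S c"
  by (induction rule: cpoly_fun.induct) (auto intro!: continuous_intros)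

text \<open>On the line \<open>z = k y\<close> with \<open>x\<close>, \<open>y\<close>, \<open>u\<close> fixed the entry \<open>(2, 3)\<close> is a cubic polynomial in \<open>k\<close> times \<open>K(k)\<^sup>2\<close>,
  and the coefficients of an algebraic relation become polynomials in \<open>k\<close>. The line is taken
  through a point where one coefficient is nonzero, so that the relation does not degenerate.\<close>

lemma Omega_not_algebraic:
  assumes br: "KE_branch D K E" and l: "l \<noteq> 0"
  shows "\<not> algebraic_fun_on (\<lambda>X. Omega l K E X $ 2 $ 3) (dom_omega \<inter> dom_omega_t D K)"
proof
  interpret elliptic_pair D K E by (rule KE_branch_elliptic_pair[OF br])
  assume "algebraic_fun_on (\<lambda>X. Omega l K E X $ 2 $ 3) (dom_omega \<inter> dom_omega_t D K)"
  then obtain n c i0 X0 where poly: "\<And>i. i \<le> n \<Longrightarrow> cpoly_fun (c i)" and i0: "i0 \<le> n" "c i0 X0 \<noteq> 0"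
    and rel: "\<And>X. X \<in> dom_omega \<inter> dom_omega_t D K \<Longrightarrow> (\<Sum>i\<le>n. c i X * (Omega l K E X $ 2 $ 3) ^ i) = 0"
    unfolding algebraic_fun_on_def by blast
  have "open {X. c i0 X \<noteq> 0}"
    using cpoly_fun_continuous[OF poly[OF i0(1)]] by (intro open_Collect_neq continuous_on_const)
  moreover have open_x: "open {X :: complex^4. X $ 1 \<noteq> 0}" by (intro open_Collect_neq continuous_intros)
  ultimately have "open ({X. c i0 X \<noteq> 0} \<inter> {X. X $ 1 \<noteq> 0})" by (rule open_Int)
  moreover have "{X. c i0 X \<noteq> 0} \<inter> {X. X $ 1 \<noteq> 0} \<noteq> {}"
    using open_generic_coordinate[OF \<open>open {X. c i0 X \<noteq> 0}\<close>, of 1] i0(2) by blast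
  ultimately obtain X where X: "c i0 X \<noteq> 0" "X $ 1 \<noteq> 0" "X $ 2 \<noteq> 0"
    using open_generic_coordinate[of "{X. c i0 X \<noteq> 0} \<inter> {X. X $ 1 \<noteq> 0}" 2] by blast
  define L where "L k = (vector [X $ 1, X $ 2, k * X $ 2, X $ 4] :: complex^4)" for k
  have "\<exists>p. \<forall>k. c i (L k) = poly p k" if "i \<le> n" for i
    unfolding L_def by (rule cpoly_fun_on_line[OF poly[OF that]])
  then obtain p where p: "\<And>i k. i \<le> n \<Longrightarrow> c i (L k) = poly (p i) k" by metis
  have "L (X $ 3 / X $ 2) = X" using X by (simp add: L_def vec_eq_iff forall_4 vector_4_nth)
  with X(1) p[OF i0(1), of "X $ 3 / X $ 2"] have p_nz: "p i0 \<noteq> 0" by auto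
  define a where "a = l * two_over_pi * (X $ 2)\<^sup>2"
  have a: "a \<noteq> 0" using l X by (simp add: a_def two_over_pi_def)
  define W where "W = {k \<in> D. K k \<noteq> 0} \<inter> (- {1, - 1})"
  have "open {k \<in> D. K k \<noteq> 0}"
    by (intro open_nonzero open_D holomorphic_on_imp_continuous_on holomorphic_K)
  then have "open W" unfolding W_def by (intro open_Int open_Compl finite_imp_closed) auto
  moreover have "W \<noteq> {}"
    using KE_branch_generic[OF br] unfolding W_def by (auto simp: power2_eq_1_iff)
  moreover have "W \<subseteq> D" by (auto simp: W_def)
  moreover have "(\<Sum>i\<le>n. poly (p i * [:0, a, 0, - a:] ^ i) k * ((K k)\<^sup>2) ^ i) = 0" if "k \<in> W" for k
  proof -
    have k: "k \<in> D" "K k \<noteq> 0" "k\<^sup>2 \<noteq> 1" using that by (auto simp: W_def power2_eq_1_iff)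
    have "(k * X $ 2)\<^sup>2 \<noteq> (X $ 2)\<^sup>2" using k X by (simp add: power_mult_distrib)
    then have L: "L k \<in> dom_omega \<inter> dom_omega_t D K"
      using k X by (auto simp: L_def dom_omega_def dom_omega_t_def dom_ell_def vector_4_nth)
    have "Omega l K E (L k) $ 2 $ 3 = poly [:0, a, 0, - a:] k * (K k)\<^sup>2"
      using L X(3) by (simp add: Omega_normal skew4_nth L_def g23_def a_def algebra_simps power2_eq_square power3_eq_cube)
    with rel[OF L] p show ?thesis by (simp add: power_mult_distrib poly_power mult_ac)
  qed
  moreover have "p i0 * [:0, a, 0, - a:] ^ i0 \<noteq> 0" using p_nz a by simp
  ultimately show False
    using KE_branch_square_transcendental[OF br i0(1), of "\<lambda>i. p i * [:0, a, 0, - a:] ^ i" W] by blast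
qed

section \<open>Multivaluedness\<close>

text \<open>A branch of the square root with the cut along the positive imaginary axis. It agrees with the
  principal root in the closed lower half plane off the cut of that root, but extends across the
  negative real axis.\<close>

definition turned_sqrt :: "complex \<Rightarrow> complex" where
  "turned_sqrt \<zeta> = csqrt (\<i> * \<zeta>) * ((1 - \<i>) / of_real (sqrt 2))"

definition turned_sqrt_domain :: "complex set" where
  "turned_sqrt_domain = {\<zeta>. \<i> * \<zeta> \<notin> \<real>\<^sub>\<le>\<^sub>0}"

lemma turned_sqrt_domain_iff: "\<zeta> \<in> turned_sqrt_domain \<longleftrightarrow> \<not> (Re \<zeta> = 0 \<and> 0 \<le> Im \<zeta>)"
  unfolding turned_sqrt_domain_def mem_Collect_eq complex_nonpos_Reals_iff by auto

lemma open_turned_sqrt_domain: "open turned_sqrt_domain"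
proof -
  have "turned_sqrt_domain = - ({\<zeta>. Re \<zeta> = 0} \<inter> {\<zeta>. 0 \<le> Im \<zeta>})" by (auto simp: turned_sqrt_domain_iff)
  moreover have "open \<dots>"
    by (intro open_Compl closed_Int closed_Collect_eq closed_halfspace_Im_ge continuous_intros)
  ultimately show ?thesis by simp
qed

lemma turned_sqrt_nonzero: "\<zeta> \<in> turned_sqrt_domain \<Longrightarrow> turned_sqrt \<zeta> \<noteq> 0"
  by (auto simp: turned_sqrt_def turned_sqrt_domain_def complex_eq_iff[of 1 \<i>])

lemma turned_sqrt_holomorphic: "turned_sqrt holomorphic_on turned_sqrt_domain"
  unfolding turned_sqrt_def[abs_def] by (intro holomorphic_intros) (auto simp: turned_sqrt_domain_def)

lemma turned_sqrt_eq_csqrt: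
  assumes "Im \<zeta> \<le> 0" "\<zeta> \<notin> \<real>\<^sub>\<le>\<^sub>0"
  shows "turned_sqrt \<zeta> = csqrt \<zeta>" and "\<zeta> \<in> turned_sqrt_domain"
proof -
  show dom: "\<zeta> \<in> turned_sqrt_domain"
    using assms by (auto simp: turned_sqrt_domain_iff complex_nonpos_Reals_iff)
  define w where "w = csqrt (\<i> * \<zeta>)"
  have Re_w: "0 < Re w" unfolding w_def using dom by (intro Re_csqrt_pos) (simp add: turned_sqrt_domain_def)
  have w2: "w\<^sup>2 = \<i> * \<zeta>" by (simp add: w_def)
  have parts: "(Re w)\<^sup>2 - (Im w)\<^sup>2 = - Im \<zeta>" "2 * Re w * Im w = Re \<zeta>"
    using arg_cong[OF w2, of Re] arg_cong[OF w2, of Im] by (auto simp: power2_eq_square mult_ac)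
  have "\<bar>Im w\<bar> \<le> \<bar>Re w\<bar>" using parts(1) assms(1) by (simp add: abs_le_square_iff)
  then have "0 \<le> Re w + Im w" using Re_w by linarith
  moreover have "Re w + Im w \<noteq> 0"
  proof
    assume "Re w + Im w = 0"
    then have Im_w: "Im w = - Re w" by simp
    with parts have "Im \<zeta> = 0" "Re \<zeta> = - (2 * (Re w)\<^sup>2)" by (auto simp: power2_eq_square)
    with assms(2) show False by (simp add: complex_nonpos_Reals_iff)
  qed
  ultimately have pos: "0 < Re w + Im w" by simp
  have "csqrt \<zeta> = w * ((1 - \<i>) / of_real (sqrt 2))"
  proof (rule csqrt_unique)
    have "(of_real (sqrt 2) :: complex)\<^sup>2 = 2" by (simp flip: of_real_power)
    moreover have "(1 - \<i>)\<^sup>2 = - (2 * \<i>)" by (simp add: complex_eq_iff power2_eq_square)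
    ultimately show "(w * ((1 - \<i>) / of_real (sqrt 2)))\<^sup>2 = \<zeta>"
      by (simp only: power_mult_distrib power_divide w2) (simp add: complex_eq_iff)
    have "Re (w * ((1 - \<i>) / of_real (sqrt 2))) = (Re w + Im w) / sqrt 2"
      by (simp add: Re_divide_of_real[symmetric] del: Re_divide_of_real)
    then show "0 < Re (w * ((1 - \<i>) / of_real (sqrt 2))) \<or> Re (w * ((1 - \<i>) / of_real (sqrt 2))) = 0
        \<and> 0 \<le> Im (w * ((1 - \<i>) / of_real (sqrt 2)))"
      using pos by simp
  qed
  then show "turned_sqrt \<zeta> = csqrt \<zeta>" by (simp add: turned_sqrt_def w_def)
qed

text \<open>The two segments over this point replace the interval \<open>[0, \<pi>/2]\<close> as the path of integration. The
  singularity of the integrand at \<open>sin t = 1 / k\<close> reaches the interval when \<open>k\<close> crosses the real axis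
  at 2, but not this path.\<close>

definition detour :: complex where "detour = of_real (pi/4) + \<i>"

definition upper_strip :: "complex set" where
  "upper_strip = {z. 0 \<le> Re z \<and> Re z \<le> pi/2 \<and> 0 \<le> Im z}"

lemma Im_sin_square: "Im ((sin z)\<^sup>2) = 2 * (sin (Re z) * cosh (Im z)) * (cos (Re z) * sinh (Im z))"
  by (simp add: power2_eq_square Re_sin Im_sin sinh_def cosh_def field_simps)

text \<open>This keeps the radicands \<open>1 - k\<^sup>2 sin\<^sup>2 z\<close> off the cut of the turned root: \<open>k\<^sup>2\<close> has positive real
  and imaginary part if \<open>k\<close> is near 2 and above the cut.\<close>

lemma Im_sin_square_nonneg: "z \<in> upper_strip \<Longrightarrow> 0 \<le> Im ((sin z)\<^sup>2)"
  unfolding Im_sin_square upper_strip_def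
  by (auto intro!: mult_nonneg_nonneg sin_ge_zero cos_ge_zero)

lemma convex_upper_strip: "convex upper_strip"
proof -
  have "upper_strip = {z. 0 \<le> Re z} \<inter> {z. Re z \<le> pi/2} \<inter> {z. 0 \<le> Im z}" by (auto simp: upper_strip_def)
  moreover have "convex \<dots>"
    by (intro convex_Int convex_halfspace_Re_ge convex_halfspace_Re_le convex_halfspace_Im_ge)
  ultimately show ?thesis by simp
qed

lemma detour_triangle: "convex hull {0, detour, of_real (pi/2)} \<subseteq> upper_strip"
  by (intro hull_minimal convex_upper_strip) (auto simp: upper_strip_def detour_def)

lemma radicand_in_turned_sqrt_domain:
  assumes "0 < Re m" "0 < Im m" "0 \<le> Im v"
  shows "1 - m * v \<in> turned_sqrt_domain"
  unfolding turned_sqrt_domain_iff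
proof
  assume "Re (1 - m * v) = 0 \<and> 0 \<le> Im (1 - m * v)"
  then have 1: "Re m * Re v = 1 + Im m * Im v" and 2: "Re m * Im v + Im m * Re v \<le> 0" by auto
  have "0 < Re m * Re v" unfolding 1 using assms by (simp add: add_pos_nonneg)
  then have "0 < Re v" using assms by (simp add: zero_less_mult_iff)
  then have "0 < Im m * Re v" "0 \<le> Re m * Im v" using assms by auto
  with 2 show False by linarith
qed

lemma linepath_detour:
  assumes "t \<in> {0..1}"
  shows "linepath 0 detour t = of_real (t * pi/4) + \<i> * of_real t"
    "linepath detour (of_real (pi/2)) t = of_real ((1 + t) * pi/4) + \<i> * of_real (1 - t)"
  by (auto simp: linepath_def detour_def complex_eq_iff algebra_simps)

text \<open>On the open segments \<open>Im (sin\<^sup>2 z)\<close> is positive, so the radicand has negative imaginary part; at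
  the end points it is \<open>1\<close> or \<open>-3\<close>.\<close>

lemma radicand_at_2:
  assumes "t \<in> {0..1}"
  shows "1 - 2\<^sup>2 * (sin (linepath 0 detour t))\<^sup>2 \<in> turned_sqrt_domain"
    and "1 - 2\<^sup>2 * (sin (linepath detour (of_real (pi/2)) t))\<^sup>2 \<in> turned_sqrt_domain"
proof -
  have *: "1 - 2\<^sup>2 * (sin z)\<^sup>2 \<in> turned_sqrt_domain"
    if "(0 < Re z \<and> Re z < pi/2 \<and> 0 < Im z) \<or> z = 0 \<or> z = of_real (pi/2)" for z
    using that
  proof (elim disjE)
    assume "0 < Re z \<and> Re z < pi/2 \<and> 0 < Im z"
    then have "0 < Im ((sin z)\<^sup>2)"
      unfolding Im_sin_square by (auto intro!: mult_pos_pos sin_gt_zero cos_gt_zero)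
    then show ?thesis by (simp add: turned_sqrt_domain_iff)
  next
    assume "z = of_real (pi/2)"
    then have "sin z = of_real (sin (pi/2))" by (simp only: sin_of_real)
    then show ?thesis by (simp add: turned_sqrt_domain_iff)
  qed (simp add: turned_sqrt_domain_iff)
  have t: "0 \<le> t" "t \<le> 1" using assms by auto
  show "1 - 2\<^sup>2 * (sin (linepath 0 detour t))\<^sup>2 \<in> turned_sqrt_domain"
    unfolding linepath_detour[OF assms] using t by (intro *, cases "t = 0") auto
  show "1 - 2\<^sup>2 * (sin (linepath detour (of_real (pi/2)) t))\<^sup>2 \<in> turned_sqrt_domain"
    unfolding linepath_detour[OF assms] using t add_pos_nonneg[of pi "pi * t"]
    by (intro *, cases "t = 1") (auto simp: field_simps)
qed

text \<open>The path is compact, so the condition is open in \<open>k\<close>.\<close>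

lemma radicand_near_2:
  obtains \<epsilon> where "0 < \<epsilon>" "\<epsilon> \<le> 1/2"
    "\<And>k t. k \<in> ball 2 \<epsilon> \<Longrightarrow> t \<in> {0..1} \<Longrightarrow> 1 - k\<^sup>2 * (sin (linepath 0 detour t))\<^sup>2 \<in> turned_sqrt_domain"
    "\<And>k t. k \<in> ball 2 \<epsilon> \<Longrightarrow> t \<in> {0..1} \<Longrightarrow> 1 - k\<^sup>2 * (sin (linepath detour (of_real (pi/2)) t))\<^sup>2 \<in> turned_sqrt_domain"
proof -
  have near: "\<exists>\<epsilon>>0. \<forall>k\<in>ball 2 \<epsilon>. \<forall>t\<in>{0..1}. 1 - k\<^sup>2 * (sin (linepath a b t))\<^sup>2 \<in> turned_sqrt_domain"
    if at2: "\<And>t. t \<in> {0..1} \<Longrightarrow> 1 - 2\<^sup>2 * (sin (linepath a b t))\<^sup>2 \<in> turned_sqrt_domain" for a b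
  proof -
    have cont: "continuous_on UNIV (\<lambda>kt :: complex \<times> real. 1 - (fst kt)\<^sup>2 * (sin (linepath a b (snd kt)))\<^sup>2)"
      unfolding linepath_def by (intro continuous_intros)
    have "open ((\<lambda>kt :: complex \<times> real. 1 - (fst kt)\<^sup>2 * (sin (linepath a b (snd kt)))\<^sup>2) -` turned_sqrt_domain)"
      by (rule open_vimage[OF open_turned_sqrt_domain cont])
    moreover have "{2} \<times> {0..1} \<subseteq> (\<lambda>kt. 1 - (fst kt)\<^sup>2 * (sin (linepath a b (snd kt)))\<^sup>2) -` turned_sqrt_domain"
      using at2 by auto
    ultimately obtain X0 where "2 \<in> X0" "open X0" and X0: "X0 \<times> {0..1} \<subseteq> (\<lambda>kt. 1 - (fst kt)\<^sup>2 * (sin (linepath a b (snd kt)))\<^sup>2) -` turned_sqrt_domain"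
      using Elementary_Topology.tube_lemma[OF compact_Icc[of 0 "1::real"]] by blast
    then obtain \<epsilon> where "0 < \<epsilon>" "ball 2 \<epsilon> \<subseteq> X0" using openE by blast
    with X0 show ?thesis by (intro exI[of _ \<epsilon>]) fastforce
  qed
  from near[of 0 detour] near[of detour "of_real (pi/2)"] radicand_at_2
  obtain \<epsilon>1 \<epsilon>2 where e: "0 < \<epsilon>1" "\<forall>k\<in>ball 2 \<epsilon>1. \<forall>t\<in>{0..1}. 1 - k\<^sup>2 * (sin (linepath 0 detour t))\<^sup>2 \<in> turned_sqrt_domain"
    "0 < \<epsilon>2" "\<forall>k\<in>ball 2 \<epsilon>2. \<forall>t\<in>{0..1}. 1 - k\<^sup>2 * (sin (linepath detour (of_real (pi/2)) t))\<^sup>2 \<in> turned_sqrt_domain" by blast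
  show ?thesis
    by (rule that[of "min (1/2) (min \<epsilon>1 \<epsilon>2)"]) (use e in auto)
qed

definition detour_integral :: "(complex \<Rightarrow> complex) \<Rightarrow> complex \<Rightarrow> complex" where
  "detour_integral h k =
     contour_integral (linepath 0 detour) (\<lambda>z. h (1 - k\<^sup>2 * (sin z)\<^sup>2)) +
     contour_integral (linepath detour (of_real (pi/2))) (\<lambda>z. h (1 - k\<^sup>2 * (sin z)\<^sup>2))"

lemma linepath_integral_holomorphic:
  assumes "open U" and h: "h holomorphic_on turned_sqrt_domain"
    and dom: "\<And>k t. k \<in> U \<Longrightarrow> t \<in> {0..1} \<Longrightarrow> 1 - k\<^sup>2 * (sin (linepath a b t))\<^sup>2 \<in> turned_sqrt_domain"
  shows "(\<lambda>k. contour_integral (linepath a b) (\<lambda>z. h (1 - k\<^sup>2 * (sin z)\<^sup>2))) holomorphic_on U"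
proof -
  define r where "r k t = 1 - k\<^sup>2 * (sin (linepath a b t))\<^sup>2" for k and t :: real
  have r_cont: "continuous_on S (\<lambda>x. r (f x) (g x))" if "continuous_on S f" "continuous_on S g"
    for S :: "'s::t2_space set" and f :: "'s \<Rightarrow> complex" and g :: "'s \<Rightarrow> real"
    unfolding r_def linepath_def using that by (intro continuous_intros)
  have h_cont: "continuous_on turned_sqrt_domain h" and h'_cont: "continuous_on turned_sqrt_domain (deriv h)"
    using h open_turned_sqrt_domain by (auto intro!: holomorphic_on_imp_continuous_on holomorphic_deriv)
  have "((\<lambda>k. integral {0..1} (\<lambda>t. h (r k t) * (b - a))) has_field_derivative
      integral {0..1} (\<lambda>t. deriv h (r k t) * (- (2 * k * (sin (linepath a b t))\<^sup>2)) * (b - a))) (at k)" if k: "k \<in> U" for k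
  proof (rule has_field_derivative_param_integral[OF \<open>open U\<close> k])
    fix k and t :: real assume k: "k \<in> U" and t: "t \<in> {0..1}"
    have dh: "(h has_field_derivative deriv h (r k t)) (at (r k t))"
      using holomorphic_derivI[OF h open_turned_sqrt_domain] dom[OF k t] by (simp add: r_def)
    have "((\<lambda>k. r k t) has_field_derivative - (2 * k * (sin (linepath a b t))\<^sup>2)) (at k)"
      unfolding r_def by (auto intro!: derivative_eq_intros)
    from DERIV_cmult_right[OF DERIV_chain2[OF dh this]]
    show "((\<lambda>k. h (r k t) * (b - a)) has_field_derivative deriv h (r k t) * (- (2 * k * (sin (linepath a b t))\<^sup>2)) * (b - a)) (at k)" .
  next
    fix k assume k: "k \<in> U"
    show "continuous_on {0..1} (\<lambda>t. h (r k t) * (b - a))"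
      using dom[OF k] by (intro continuous_intros continuous_on_compose2[OF h_cont] r_cont) (auto simp: r_def)
  next
    show "continuous_on (U \<times> {0..1}) (\<lambda>(k, t). deriv h (r k t) * (- (2 * k * (sin (linepath a b t))\<^sup>2)) * (b - a))"
      unfolding split_beta using dom
      by (intro continuous_intros continuous_on_compose2[OF h'_cont] r_cont) (auto simp: r_def linepath_def intro!: continuous_intros)
  qed
  then have "(\<lambda>k. integral {0..1} (\<lambda>t. h (r k t) * (b - a))) holomorphic_on U"
    using \<open>open U\<close> by (auto simp: holomorphic_on_open)
  then show ?thesis
    by (simp add: contour_integral_integral vector_derivative_linepath_at r_def)
qed

text \<open>Cauchy's theorem for the triangle between the two paths.\<close>

lemma detour_integral_eq:
  assumes h: "h holomorphic_on turned_sqrt_domain" and m: "0 < Re (k\<^sup>2)" "0 < Im (k\<^sup>2)"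
  shows "detour_integral h k = integral {0..pi/2} (\<lambda>t. h (1 - k\<^sup>2 * (sin (of_real t))\<^sup>2))"
proof -
  let ?f = "\<lambda>z. h (1 - k\<^sup>2 * (sin z)\<^sup>2)"
  let ?H = "convex hull {0, detour, of_real (pi/2)}"
  have sub: "(\<lambda>z. 1 - k\<^sup>2 * (sin z)\<^sup>2) ` ?H \<subseteq> turned_sqrt_domain"
    using detour_triangle Im_sin_square_nonneg by (auto intro!: radicand_in_turned_sqrt_domain[OF m])
  have "(\<lambda>z. 1 - k\<^sup>2 * (sin z)\<^sup>2) holomorphic_on ?H" by (intro holomorphic_intros)
  from holomorphic_on_compose_gen[OF this h sub] have hol: "?f holomorphic_on ?H" by (simp add: o_def)
  have cont: "continuous_on ?H ?f" by (rule holomorphic_on_imp_continuous_on[OF hol])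
  have int: "?f contour_integrable_on linepath 0 detour" "?f contour_integrable_on linepath detour (of_real (pi/2))"
    "?f contour_integrable_on linepath (of_real (pi/2)) 0"
    by (intro contour_integrable_continuous_linepath continuous_on_subset[OF cont];
        simp add: segment_convex_hull hull_mono)+
  have "contour_integral (linepath 0 detour +++ linepath detour (of_real (pi/2)) +++ linepath (of_real (pi/2)) 0) ?f = 0"
    by (rule contour_integral_unique[OF Cauchy_theorem_triangle[OF hol]])
  then have "detour_integral h k + contour_integral (linepath (of_real (pi/2)) 0) ?f = 0"
    using int by (simp add: detour_integral_def add.assoc)
  moreover have "contour_integral (linepath (of_real (pi/2)) 0) ?f = - contour_integral (linepath 0 (of_real (pi/2))) ?f"
    using contour_integral_reversepath[of "linepath 0 (of_real (pi/2))" ?f] by simp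
  moreover have "contour_integral (linepath 0 (of_real (pi/2))) ?f = integral {0..pi/2} (\<lambda>t. ?f (of_real t))"
    using contour_integral_linepath_Reals_eq[of 0 "of_real (pi/2)" ?f] by simp
  ultimately show ?thesis by simp
qed

text \<open>On the upper half of a small disc at 2 the integral over the detour is \<open>K\<close>, and it is holomorphic
  on the whole disc, so it continues \<open>K\<close> across the cut.\<close>

lemma detour_branch:
  obtains \<epsilon> K2 E2 where "0 < \<epsilon>" "\<epsilon> \<le> 1/2" "KE_branch (ball 2 \<epsilon>) K2 E2"
    "\<And>k. k \<in> ball 2 \<epsilon> \<Longrightarrow> 0 < Im k \<Longrightarrow> K2 k = ellipticK k"
proof -
  obtain \<epsilon> where e: "0 < \<epsilon>" "\<epsilon> \<le> 1/2"
    and dom: "\<And>k t. k \<in> ball 2 \<epsilon> \<Longrightarrow> t \<in> {0..1} \<Longrightarrow> 1 - k\<^sup>2 * (sin (linepath 0 detour t))\<^sup>2 \<in> turned_sqrt_domain"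
    "\<And>k t. k \<in> ball 2 \<epsilon> \<Longrightarrow> t \<in> {0..1} \<Longrightarrow> 1 - k\<^sup>2 * (sin (linepath detour (of_real (pi/2)) t))\<^sup>2 \<in> turned_sqrt_domain"
    using radicand_near_2 by blast
  define K2 where "K2 = detour_integral (\<lambda>\<zeta>. 1 / turned_sqrt \<zeta>)"
  define E2 where "E2 = detour_integral turned_sqrt"
  have inv: "(\<lambda>\<zeta>. 1 / turned_sqrt \<zeta>) holomorphic_on turned_sqrt_domain"
    using turned_sqrt_nonzero by (intro holomorphic_intros turned_sqrt_holomorphic) auto
  have hol: "K2 holomorphic_on ball 2 \<epsilon>" "E2 holomorphic_on ball 2 \<epsilon>"
    unfolding K2_def E2_def detour_integral_def[abs_def]
    by (intro holomorphic_on_add linepath_integral_holomorphic open_ball inv turned_sqrt_holomorphic dom; assumption)+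
  have agree: "K2 k = ellipticK k \<and> E2 k = ellipticE k" if k: "k \<in> ball 2 \<epsilon>" "0 < Im k" for k
  proof -
    have "norm (2 - k) < 1/2" using k(1) e by (simp add: dist_norm)
    then have close: "\<bar>2 - Re k\<bar> < 1/2" "\<bar>Im k\<bar> < 1/2"
      using abs_Re_le_cmod[of "2 - k"] abs_Im_le_cmod[of "2 - k"] by auto
    have "Im k < Re k" "0 < Re k" using close by linarith+
    then have "(Im k)\<^sup>2 < (Re k)\<^sup>2" using k(2) by (intro power_strict_mono) auto
    then have m: "0 < Re (k\<^sup>2)" "0 < Im (k\<^sup>2)" using \<open>0 < Re k\<close> k(2) by (auto simp: power2_eq_square)
    then have slit: "k\<^sup>2 \<in> slit_plane" by (auto simp: slit_plane_def complex_is_Real_iff)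
    have turned_sqrt: "turned_sqrt (1 - k\<^sup>2 * (sin (of_real t))\<^sup>2) = Delta (k\<^sup>2) t" for t
      unfolding Delta_def
    proof (rule turned_sqrt_eq_csqrt(1)[OF _ Delta_radicand[OF slit]])
      show "Im (1 - k\<^sup>2 * (sin (complex_of_real t))\<^sup>2) \<le> 0"
        unfolding radicand_real using m(2) by (simp del: of_real_power)
    qed
    have "K2 k = K_par (k\<^sup>2)"
      unfolding K2_def detour_integral_eq[OF inv m] K_par_def turned_sqrt ..
    moreover have "E2 k = E_par (k\<^sup>2)"
      unfolding E2_def detour_integral_eq[OF turned_sqrt_holomorphic m] E_par_def turned_sqrt ..
    ultimately show ?thesis by (simp add: ellipticK_eq_K_par[OF slit] ellipticE_eq_E_par[OF slit])
  qed
  have "continuation K_region ellipticK ellipticE (ball 2 \<epsilon>) K2 E2"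
  \<comment> \<open>One step of continuation, glued on the upper half of the disc.\<close>
  proof (rule continuation.step[OF continuation.base _ _ hol])
    show "open (ball 2 \<epsilon> \<inter> {k. 0 < Im k})" by (intro open_Int open_ball open_halfspace_Im_gt)
    have "2 + \<i> * of_real (\<epsilon>/2) \<in> ball 2 \<epsilon> \<inter> {k. 0 < Im k}" using e by (simp add: dist_norm norm_mult)
    then show "ball 2 \<epsilon> \<inter> {k. 0 < Im k} \<noteq> {}" by blast
    show "ball 2 \<epsilon> \<inter> {k. 0 < Im k} \<subseteq> K_region \<inter> ball 2 \<epsilon>"
      by (auto simp: K_region_def complex_is_Real_iff)
  qed (use agree in auto)
  then have "KE_branch (ball 2 \<epsilon>) K2 E2" by (simp add: KE_branch_def K_region_def)
  with e agree that show ?thesis by blast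
qed

lemma ellipticK_cnj:
  assumes k: "k \<in> K_region"
  shows "ellipticK (cnj k) = cnj (ellipticK k)"
proof -
  note sp = K_region_square[OF k]
  have sp': "(cnj k)\<^sup>2 \<in> slit_plane" using sp by (auto simp: slit_plane_def complex_is_Real_iff simp flip: complex_cnj_power)
  have Delta: "Delta ((cnj k)\<^sup>2) t = cnj (Delta (k\<^sup>2) t)" for t
    unfolding Delta_def cnj_csqrt[OF Delta_radicand[OF sp]] by (simp add: sin_of_real)
  have "((\<lambda>t. 1 / Delta (k\<^sup>2) t) has_integral K_par (k\<^sup>2)) {0..pi/2}"
    unfolding K_par_def using Delta_integrable(1)[OF sp, of 1] by (intro integrable_integral) simp
  from has_integral_linear[OF this bounded_linear_cnj]
  have "((\<lambda>t. 1 / Delta ((cnj k)\<^sup>2) t) has_integral cnj (K_par (k\<^sup>2))) {0..pi/2}"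
    by (simp add: o_def Delta)
  then have "K_par ((cnj k)\<^sup>2) = cnj (K_par (k\<^sup>2))"
    unfolding K_par_def by (rule integral_unique)
  then show ?thesis by (simp add: ellipticK_eq_K_par[OF sp] ellipticK_eq_K_par[OF sp'])
qed

text \<open>Below the real axis \<open>1 / csqrt \<zeta>\<close> lies in the closed first quadrant, with the larger component
  determined by the sign of \<open>Re \<zeta>\<close>; as \<open>norm \<zeta> \<le> 8\<close>, that component is at least \<open>1 / 4\<close>.\<close>

lemma inverse_csqrt_bounds:
  assumes "Im \<zeta> \<le> 0" "\<zeta> \<notin> \<real>\<^sub>\<le>\<^sub>0" "norm \<zeta> \<le> 8"
  shows "0 \<le> Re (1 / csqrt \<zeta>)" "0 \<le> Im (1 / csqrt \<zeta>)"
    "0 \<le> Re \<zeta> \<Longrightarrow> 1/4 \<le> Re (1 / csqrt \<zeta>)" "Re \<zeta> \<le> 0 \<Longrightarrow> 1/4 \<le> Im (1 / csqrt \<zeta>)"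
proof -
  define w where "w = csqrt \<zeta>"
  have Re_w: "0 < Re w" unfolding w_def by (rule Re_csqrt_pos[OF assms(2)])
  have w2: "w\<^sup>2 = \<zeta>" by (simp add: w_def)
  have parts: "(Re w)\<^sup>2 - (Im w)\<^sup>2 = Re \<zeta>" "2 * Re w * Im w = Im \<zeta>"
    using arg_cong[OF w2, of Re] arg_cong[OF w2, of Im] by (auto simp: power2_eq_square mult_ac)
  have Im_w: "Im w \<le> 0"
  proof (rule ccontr)
    assume "\<not> Im w \<le> 0"
    then have "0 < 2 * Re w * Im w" using Re_w by simp
    with parts assms(1) show False by simp
  qed
  define N where "N = (Re w)\<^sup>2 + (Im w)\<^sup>2"
  have N: "0 < N" using Re_w unfolding N_def by (simp add: add_pos_nonneg)
  have N8: "N \<le> 8"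
  proof -
    have "N = norm (w\<^sup>2)" by (simp add: N_def norm_power cmod_power2)
    then show ?thesis using assms(3) w2 by simp
  qed
  have inv: "Re (1 / w) = Re w / N" "Im (1 / w) = - Im w / N"
    by (simp_all add: Re_divide Im_divide N_def)
  show "0 \<le> Re (1 / csqrt \<zeta>)" "0 \<le> Im (1 / csqrt \<zeta>)"
    using inv Re_w Im_w N by (auto simp: divide_nonpos_pos simp flip: w_def)
  have big: "1/4 \<le> a / N" if "0 \<le> a" "N \<le> 2 * a\<^sup>2" for a
  proof -
    have "N\<^sup>2 \<le> 8 * N" using N N8 by (simp add: power2_eq_square)
    also have "\<dots> \<le> (4 * a)\<^sup>2" using that by (simp add: power2_eq_square)
    finally have "N \<le> 4 * a" using that(1) by (auto intro: power2_le_imp_le)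
    then show ?thesis using N by (simp add: field_simps)
  qed
  show "1/4 \<le> Re (1 / csqrt \<zeta>)" if "0 \<le> Re \<zeta>"
    using big[of "Re w"] that parts(1) Re_w inv(1) by (simp add: N_def flip: w_def)
  show "1/4 \<le> Im (1 / csqrt \<zeta>)" if "Re \<zeta> \<le> 0"
    using big[of "- Im w"] that parts(1) Im_w inv(2) by (simp add: N_def flip: w_def)
qed

text \<open>The real part collects the interval \<open>[0, \<pi>/6]\<close>, where \<open>Re (1 - k\<^sup>2 sin\<^sup>2 t) \<ge> 0\<close>, the
  imaginary part the interval \<open>[\<pi>/4, \<pi>/2]\<close>, where it is at most 0. The bounds do not depend on
  the distance from the cut.\<close>

lemma ellipticK_above_cut:
  assumes y: "0 < y" "y < (1/2::real)"
  shows "1/10 \<le> Re (ellipticK (2 + \<i> * of_real y))" "1/10 \<le> Im (ellipticK (2 + \<i> * of_real y))"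
proof -
  define k where "k = 2 + \<i> * complex_of_real y"
  have m: "Re (k\<^sup>2) = 4 - y\<^sup>2" "Im (k\<^sup>2) = 4 * y" by (simp_all add: k_def power2_eq_square)
  have K: "k \<in> K_region" using y by (auto simp: K_region_def k_def complex_is_Real_iff)
  note sp = K_region_square[OF K]
  have y2: "0 \<le> y\<^sup>2" "y\<^sup>2 \<le> 1" using y by (auto simp: abs_square_le_1)
  define \<zeta> where "\<zeta> t = 1 - k\<^sup>2 * of_real ((sin t)\<^sup>2)" for t
  have parts: "Re (\<zeta> t) = 1 - (4 - y\<^sup>2) * (sin t)\<^sup>2" "Im (\<zeta> t) = - (4 * y * (sin t)\<^sup>2)" for t
    unfolding \<zeta>_def using m by (simp_all del: of_real_power)
  have \<zeta>_slit: "\<zeta> t \<notin> \<real>\<^sub>\<le>\<^sub>0" for t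
    using Delta_radicand[OF sp, of t] unfolding radicand_real \<zeta>_def .
  have "norm (k\<^sup>2) \<le> 7"
  proof -
    have "norm k \<le> 2 + 1/2" unfolding k_def using y norm_triangle_ineq[of 2 "\<i> * complex_of_real y"] by (simp add: norm_mult)
    then have "(norm k)\<^sup>2 \<le> (2 + 1/2)\<^sup>2" by (intro power_mono) auto
    moreover have "(2 + 1/2 :: real)\<^sup>2 \<le> 7" by (simp add: power2_eq_square)
    ultimately show ?thesis by (simp only: norm_power)
  qed
  then have \<zeta>_norm: "norm (\<zeta> t) \<le> 8" for t
  proof -
    have "norm (k\<^sup>2 * of_real ((sin t)\<^sup>2)) \<le> 7 * 1"
      unfolding norm_mult using \<open>norm (k\<^sup>2) \<le> 7\<close> by (intro mult_mono) (auto simp: norm_power abs_square_le_1 simp flip: power_abs)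
    then show ?thesis unfolding \<zeta>_def using norm_triangle_ineq4[of 1 "k\<^sup>2 * of_real ((sin t)\<^sup>2)"] by simp
  qed
  have bounds: "0 \<le> Re (1 / csqrt (\<zeta> t))" "0 \<le> Im (1 / csqrt (\<zeta> t))"
    "0 \<le> Re (\<zeta> t) \<Longrightarrow> 1/4 \<le> Re (1 / csqrt (\<zeta> t))" "Re (\<zeta> t) \<le> 0 \<Longrightarrow> 1/4 \<le> Im (1 / csqrt (\<zeta> t))" for t
  proof -
    have Im: "Im (\<zeta> t) \<le> 0" using y by (simp add: parts)
    show "0 \<le> Re (1 / csqrt (\<zeta> t))" "0 \<le> Im (1 / csqrt (\<zeta> t))"
      "0 \<le> Re (\<zeta> t) \<Longrightarrow> 1/4 \<le> Re (1 / csqrt (\<zeta> t))" "Re (\<zeta> t) \<le> 0 \<Longrightarrow> 1/4 \<le> Im (1 / csqrt (\<zeta> t))"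
      using inverse_csqrt_bounds[OF Im \<zeta>_slit \<zeta>_norm] by blast+
  qed
  have "((\<lambda>t. 1 / Delta (k\<^sup>2) t) has_integral ellipticK k) {0..pi/2}"
    unfolding ellipticK_eq_K_par[OF sp] K_par_def using Delta_integrable(1)[OF sp, of 1] by (intro integrable_integral) simp
  then have int: "((\<lambda>t. 1 / csqrt (\<zeta> t)) has_integral ellipticK k) {0..pi/2}"
    unfolding Delta_def radicand_real \<zeta>_def .
  note Re_int = has_integral_linear[OF int bounded_linear_Re, unfolded o_def]
  note Im_int = has_integral_linear[OF int bounded_linear_Im, unfolded o_def]
  have piece: "(b - a) * (1/4) \<le> I"
    if f: "(f has_integral I) {0..pi/2}" "\<And>t. 0 \<le> f t" and ab: "0 \<le> a" "a \<le> b" "b \<le> pi/2"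
      and low: "\<And>t. t \<in> {a..b} \<Longrightarrow> 1/4 \<le> f t" for f :: "real \<Rightarrow> real" and I a b
  proof -
    have sub: "{a..b} \<subseteq> {0..pi/2}" using ab by auto
    have int_ab: "f integrable_on {a..b}" using f(1) sub integrable_on_subinterval by blast
    have "((\<lambda>_. 1/4) has_integral (b - a) * (1/4)) {a..b}" using has_integral_const_real[of "1/4 :: real" a b] ab by simp
    then have "(b - a) * (1/4) \<le> integral {a..b} f"
      using low by (intro has_integral_le[OF _ integrable_integral[OF int_ab]]) auto
    also have "\<dots> \<le> integral {0..pi/2} f"
      using f by (intro integral_subset_le[OF sub int_ab]) auto
    finally show ?thesis using f(1) by (simp add: integral_unique)
  qed
  have "(pi/6 - 0) * (1/4) \<le> Re (ellipticK k)"
  proof (rule piece[OF Re_int bounds(1)])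
    fix t assume t: "t \<in> {0..pi/6}"
    then have "sin t \<le> sin (pi/6)" by (intro sin_monotone_2pi_le) auto
    moreover have "0 \<le> sin t" using t by (intro sin_ge_zero) auto
    ultimately have "(sin t)\<^sup>2 \<le> (1/2)\<^sup>2" by (intro power_mono) (auto simp: sin_30)
    then have "(4 - y\<^sup>2) * (sin t)\<^sup>2 \<le> 4 * (1/2)\<^sup>2" using y2 by (intro mult_mono) auto
    then show "1/4 \<le> Re (1 / csqrt (\<zeta> t))" by (intro bounds(3)) (simp add: parts power2_eq_square)
  qed auto
  then show "1/10 \<le> Re (ellipticK (2 + \<i> * of_real y))" using pi_gt3 by (simp add: k_def)
  have "(pi/2 - pi/4) * (1/4) \<le> Im (ellipticK k)"
  proof (rule piece[OF Im_int bounds(2)])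
    fix t assume t: "t \<in> {pi/4..pi/2}"
    then have "sin (pi/4) \<le> sin t" by (intro sin_monotone_2pi_le) auto
    then have "(sqrt 2 / 2)\<^sup>2 \<le> (sin t)\<^sup>2" by (intro power_mono) (auto simp: sin_45)
    then have "1/2 \<le> (sin t)\<^sup>2" by (simp add: power_divide)
    then have "2 * (1/2) \<le> (4 - y\<^sup>2) * (sin t)\<^sup>2" using y2 by (intro mult_mono) auto
    then show "1/4 \<le> Im (1 / csqrt (\<zeta> t))" by (intro bounds(4)) (simp add: parts)
  qed auto
  then show "1/10 \<le> Im (ellipticK (2 + \<i> * of_real y))" using pi_gt3 by (simp add: k_def)
qed

text \<open>Above the cut \<open>Im (K\<^sup>2)\<close> is at least \<open>2 / 100\<close>. The continued branch still has \<open>Im (K\<^sup>2) > 0\<close> just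
  below the cut, by continuity at 2, whereas the original branch takes conjugate values there. It is
  the square that matters, because the bracket contains \<open>K\<close> only through \<open>K\<^sup>2\<close> and \<open>E / K\<close>.\<close>

lemma branches_differ:
  obtains D2 K2 E2 k where "KE_branch D2 K2 E2" "k \<in> K_region" "k \<in> D2" "k\<^sup>2 \<noteq> 1" "k \<noteq> 0"
    "ellipticK k \<noteq> 0" "K2 k \<noteq> 0" "(ellipticK k)\<^sup>2 \<noteq> (K2 k)\<^sup>2"
proof -
  obtain \<epsilon> K2 E2 where e: "0 < \<epsilon>" "\<epsilon> \<le> 1/2" and br: "KE_branch (ball 2 \<epsilon>) K2 E2"
    and agree: "\<And>k. k \<in> ball 2 \<epsilon> \<Longrightarrow> 0 < Im k \<Longrightarrow> K2 k = ellipticK k"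
    using detour_branch by blast
  have mem: "2 + \<i> * of_real y \<in> ball 2 \<epsilon>" if "\<bar>y\<bar> < \<epsilon>" for y
    using that by (simp add: dist_norm norm_mult)
  have square_above: "2/100 \<le> Im ((ellipticK (2 + \<i> * of_real y))\<^sup>2)" if "0 < y" "y < \<epsilon>" for y
  proof -
    have "1/10 * (1/10) \<le> Re (ellipticK (2 + \<i> * of_real y)) * Im (ellipticK (2 + \<i> * of_real y))"
      using ellipticK_above_cut[of y] that e by (intro mult_mono) auto
    then show ?thesis by (simp add: power2_eq_square mult_ac)
  qed
  have cont: "isCont K2 2"
    using holomorphic_on_imp_continuous_on[OF KE_branch_region(4)[OF br]] e by (simp add: continuous_on_eq_continuous_at)
  have lim: "((\<lambda>y. Im ((K2 (2 + \<i> * of_real y))\<^sup>2)) \<longlongrightarrow> Im ((K2 2)\<^sup>2)) (at 0)"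
  proof -
    have "((\<lambda>y. 2 + \<i> * complex_of_real y) \<longlongrightarrow> 2 + \<i> * of_real 0) (at 0)" by (intro tendsto_intros)
    then have "((\<lambda>y. K2 (2 + \<i> * complex_of_real y)) \<longlongrightarrow> K2 2) (at 0)"
      using isCont_tendsto_compose[OF cont] by simp
    then show ?thesis by (intro tendsto_intros)
  qed
  have "2/100 \<le> Im ((K2 2)\<^sup>2)"
  proof (rule tendsto_lowerbound)
    show "((\<lambda>y. Im ((K2 (2 + \<i> * of_real y))\<^sup>2)) \<longlongrightarrow> Im ((K2 2)\<^sup>2)) (at_right 0)"
      using lim by (rule tendsto_within_subset[OF _ subset_UNIV])
    show "\<forall>\<^sub>F y in at_right 0. 2/100 \<le> Im ((K2 (2 + \<i> * of_real y))\<^sup>2)"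
      using e square_above agree mem unfolding eventually_at_right_field by (intro exI[of _ \<epsilon>]) auto
  qed simp
  then have "\<forall>\<^sub>F y in at_left 0. 0 < Im ((K2 (2 + \<i> * of_real y))\<^sup>2)"
    using order_tendstoD(1)[OF tendsto_within_subset[OF lim subset_UNIV], of 0 "{..<0}"] by simp
  then obtain b where "b < 0" and b: "\<And>y. b < y \<Longrightarrow> y < 0 \<Longrightarrow> 0 < Im ((K2 (2 + \<i> * of_real y))\<^sup>2)"
    unfolding eventually_at_left_field by auto
  define y where "y = max (b/2) (- \<epsilon>/2)"
  have y: "b < y" "y < 0" "- y < \<epsilon>" using \<open>b < 0\<close> e by (auto simp: y_def max_def)
  define k where "k = 2 + \<i> * complex_of_real y"
  have k_cnj: "k = cnj (2 + \<i> * of_real (- y))" by (simp add: k_def complex_eq_iff)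
  have up: "2 + \<i> * complex_of_real (- y) \<in> K_region" using y by (simp add: K_region_def complex_is_Real_iff)
  have "(ellipticK k)\<^sup>2 = cnj ((ellipticK (2 + \<i> * of_real (- y)))\<^sup>2)"
    unfolding k_cnj ellipticK_cnj[OF up] by simp
  then have "Im ((ellipticK k)\<^sup>2) = - Im ((ellipticK (2 + \<i> * of_real (- y)))\<^sup>2)"
    by (simp del: complex_cnj_power)
  then have neg: "Im ((ellipticK k)\<^sup>2) < 0" using square_above[of "- y"] y by linarith
  have pos: "0 < Im ((K2 k)\<^sup>2)" using b[of y] y by (simp add: k_def)
  have "k \<in> K_region" using y by (simp add: K_region_def k_def complex_is_Real_iff)
  moreover have "k \<in> ball 2 \<epsilon>" unfolding k_def using y by (intro mem) simp
  moreover have "k \<noteq> 0" "k \<noteq> 1" "k \<noteq> - 1" by (simp_all add: k_def complex_eq_iff)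
  moreover have "ellipticK k \<noteq> 0" "K2 k \<noteq> 0" "(ellipticK k)\<^sup>2 \<noteq> (K2 k)\<^sup>2" using neg pos by auto
  ultimately show ?thesis using br that by (auto simp: power2_eq_1_iff)
qed

lemma Omega_multivalued:
  assumes l: "l \<noteq> 0"
  shows "\<exists>D K E D2 K2 E2 X. KE_branch D K E \<and> KE_branch D2 K2 E2 \<and>
           X \<in> dom_omega \<inter> dom_omega_t D K \<inter> dom_omega_t D2 K2 \<and>
           Omega l K E X \<noteq> Omega l K2 E2 X"
proof -
  obtain D2 K2 E2 k where br2: "KE_branch D2 K2 E2" and k: "k \<in> K_region" "k \<in> D2" "k\<^sup>2 \<noteq> 1" "k \<noteq> 0"
    and K: "ellipticK k \<noteq> 0" "K2 k \<noteq> 0" "(ellipticK k)\<^sup>2 \<noteq> (K2 k)\<^sup>2"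
    using branches_differ by blast
  have br: "KE_branch K_region ellipticK ellipticE"
    unfolding KE_branch_def K_region_def by (rule continuation.base)
  define X where "X = (vector [1, 1, k, 0] :: complex^4)"
  have X: "X \<in> dom_omega \<inter> dom_omega_t K_region ellipticK" "X \<in> dom_omega \<inter> dom_omega_t D2 K2"
    unfolding X_def using k K by (auto intro!: dom_point[THEN IntD1] dom_point[THEN IntD2])
  interpret e1: elliptic_pair K_region ellipticK ellipticE by (rule KE_branch_elliptic_pair[OF br])
  interpret e2: elliptic_pair D2 K2 E2 by (rule KE_branch_elliptic_pair[OF br2])
  have "Omega l ellipticK ellipticE X $ 2 $ 3 = l * (two_over_pi * (k * (1 - k\<^sup>2) * (ellipticK k)\<^sup>2))"
    using e1.Omega_normal[of X l] X(1) by (simp add: skew4_nth X_def e1.g23_def)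
  moreover have "Omega l K2 E2 X $ 2 $ 3 = l * (two_over_pi * (k * (1 - k\<^sup>2) * (K2 k)\<^sup>2))"
    using e2.Omega_normal[of X l] X(2) by (simp add: skew4_nth X_def e2.g23_def)
  ultimately have "Omega l ellipticK ellipticE X \<noteq> Omega l K2 E2 X"
    using l k K(3) by (auto simp: two_over_pi_def)
  with br br2 X show ?thesis by blast
qed

section \<open>The bi-Hamiltonian structure\<close>

theorem theorem13:
  shows
    "(hamiltonian_on dom_omega system_S omega Ham \<and>
      (\<forall>X\<in>dom_omega. det (omega X) = 0) \<and>
      (\<forall>i j. rational_on (\<lambda>X. omega X $ i $ j) dom_omega))
     \<and>
     (\<forall>l. l \<noteq> 0 \<longrightarrow>
        (\<forall>D K E. KE_branch D K E \<longrightarrow>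
           poisson_on (dom_omega \<inter> dom_omega_t D K) (Omega l K E) \<and>
           (\<forall>W. open W \<longrightarrow> W \<noteq> {} \<longrightarrow> W \<subseteq> dom_omega \<inter> dom_omega_t D K \<longrightarrow>
              (\<exists>X\<in>W. det (Omega l K E X) \<noteq> 0)) \<and>
           (\<exists>i j. \<not> algebraic_fun_on (\<lambda>X. Omega l K E X $ i $ j) (dom_omega \<inter> dom_omega_t D K))) \<and>
        (\<exists>D K E D2 K2 E2 X. KE_branch D K E \<and> KE_branch D2 K2 E2 \<and>
           X \<in> dom_omega \<inter> dom_omega_t D K \<inter> dom_omega_t D2 K2 \<and>
           Omega l K E X \<noteq> Omega l K2 E2 X))
     \<and>
     (\<forall>D K E. KE_branch D K E \<longrightarrow>
        poisson_on (dom_omega_t D K) (omega_t K E) \<and>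
        (\<forall>X\<in>dom_omega_t D K. det (omega_t K E X) = 0) \<and>
        compatible_on (dom_omega \<inter> dom_omega_t D K) omega (omega_t K E) \<and>
        casimir_on (dom_omega \<inter> dom_ell D) omega (J1 K E) \<and>
        casimir_on ({X. X$1 \<noteq> 0} \<inter> dom_omega_t D K) (omega_t K E) Ham \<and>
        casimir_on {X \<in> dom_omega_t D K. J1 K E X \<noteq> 0} (omega_t K E) (NN K E) \<and>
        (\<forall>l. l \<noteq> 0 \<longrightarrow>
           bi_hamiltonian_on (dom_omega \<inter> dom_omega_t D K) system_S omega Ham (Omega l K E) Ham))
     \<and>
     (\<forall>D K' E'. KE'_branch D K' E' \<longrightarrow>
        casimir_on (dom_omega \<inter> dom_ell D) omega (J2 K' E'))"
proof (intro conjI allI impI ballI)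
  show "hamiltonian_on dom_omega system_S omega Ham" by (rule hamiltonian_omega)
  show "det (omega X) = 0" for X by (rule det_omega)
  show "rational_on (\<lambda>X. omega X $ i $ j) dom_omega" for i j by (rule rational_omega)
next
  fix l :: complex and D K E assume l: "l \<noteq> 0" and br: "KE_branch D K E"
  interpret elliptic_pair D K E by (rule KE_branch_elliptic_pair[OF br])
  show "poisson_on (dom_omega \<inter> dom_omega_t D K) (Omega l K E)" by (rule poisson_Omega)
  show "\<exists>X\<in>W. det (Omega l K E X) \<noteq> 0"
    if "open W" "W \<noteq> {}" "W \<subseteq> dom_omega \<inter> dom_omega_t D K" for W
    by (rule det_Omega_generic[OF l that])
  show "\<exists>i j. \<not> algebraic_fun_on (\<lambda>X. Omega l K E X $ i $ j) (dom_omega \<inter> dom_omega_t D K)"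
    using Omega_not_algebraic[OF br l] by blast
next
  fix l :: complex assume "l \<noteq> 0"
  then show "\<exists>D K E D2 K2 E2 X. KE_branch D K E \<and> KE_branch D2 K2 E2 \<and>
           X \<in> dom_omega \<inter> dom_omega_t D K \<inter> dom_omega_t D2 K2 \<and>
           Omega l K E X \<noteq> Omega l K2 E2 X"
    by (rule Omega_multivalued)
next
  fix D K E assume br: "KE_branch D K E"
  interpret elliptic_pair D K E by (rule KE_branch_elliptic_pair[OF br])
  show "poisson_on (dom_omega_t D K) (omega_t K E)" by (rule poisson_omega_t)
  show "det (omega_t K E X) = 0" if "X \<in> dom_omega_t D K" for X by (rule det_omega_t[OF that])
  show "compatible_on (dom_omega \<inter> dom_omega_t D K) omega (omega_t K E)" by (rule compatible_omega_omega_t)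
  show "casimir_on (dom_omega \<inter> dom_ell D) omega (J1 K E)" by (rule J1_casimir)
  show "casimir_on ({X. X$1 \<noteq> 0} \<inter> dom_omega_t D K) (omega_t K E) Ham" by (rule casimir_Ham)
  show "casimir_on {X \<in> dom_omega_t D K. J1 K E X \<noteq> 0} (omega_t K E) (NN K E)" by (rule NN_casimir)
  show "bi_hamiltonian_on (dom_omega \<inter> dom_omega_t D K) system_S omega Ham (Omega l K E) Ham" if "l \<noteq> 0" for l
    by (rule bi_hamiltonian_Omega[OF that KE_branch_dom_nonempty[OF br]])
next
  fix D K' E' assume "KE'_branch D K' E'"
  then show "casimir_on (dom_omega \<inter> dom_ell D) omega (J2 K' E')" by (rule J2_casimir)
qed

end
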